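(* Let $\diamondsuit\in\{\varnothing,\square,\mathrm{v},\mathrm{h}\}$, let $R=(R_1,\dots,R_L)$ be a sequence of partitions, $|R|=\sum_i|R_i|$, and let $\lambda$ be a partition. Then $$K^\diamondsuit_{\lambda;R}(t)=t^{|R|-|\lambda|}\sum_{\substack{\tau\\ |\tau|=|R|}}K^{\varnothing}_{\tau;R}(t)\sum_{\substack{\mu\in\mathcal{P}^\diamondsuit\\ |\mu|=|R|-|\lambda|}}c^\tau_{\lambda\mu},$$ where $\tau$ runs over partitions and $c^\tau_{\lambda\mu}$ is the Littlewood–Richardson coefficient.
   Context: $\Lambda$ is the ring of symmetric functions in $X=x_1+x_2+\cdots$ (rational coefficients, extended by auxiliary indeterminates as needed), with the scalar product for which Schur functions are orthonormal. Plethystic notation: $P[A]$ is obtained from $P\in\Lambda$ by expressing $P$ in power sums and replacing $p_k$ by $p_k[A]$, where $p_k[A]$ raises every indeterminate in $A$ (including $t$) to the $k$-th power and $p_k[A-B]=p_k[A]-p_k[B]$; $\Omega[A]=\exp(\sum_{k\ge1}p_k[A]/k)$. $P^\perp$ is the operator adjoint to multiplication by $P$ (in the $X$ variables); in particular $\Omega[XA]^\perp P[X]=P[X+A]$. The symbols: $\varnothing$, $\square$ (single cell), $\mathrm{h}$ (horizontal domino), $\mathrm{v}$ (vertical domino). Put $f_\varnothing=0$, $f_\square=s_1+s_{(1^2)}$, $f_{\mathrm{h}}=s_2$, $f_{\mathrm{v}}=s_{(1^2)}$; thus $f_\diamondsuit[tX]$ is $0$, $ts_1[X]+t^2s_{(1^2)}[X]$,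 $t^2s_2[X]$, $t^2s_{(1^2)}[X]$ respectively. $\mathcal{P}^\varnothing$ consists of the empty partition only, $\mathcal{P}^\square$ is the set of all partitions, $\mathcal{P}^{\mathrm h}$ the partitions all of whose rows have even length, $\mathcal{P}^{\mathrm v}$ the partitions all of whose columns have even length. Let $s^\diamondsuit_\lambda=\Omega[-f_\diamondsuit]^\perp s_\lambda$, a basis of $\Lambda$. Bernstein's operators $B_r\in\mathrm{End}(\Lambda)$ are defined by $\sum_{r\in\mathbb{Z}}B_rz^r=\Omega[zX]\,\Omega[-z^{-1}X]^\perp$ (skew, then multiply); $B_\nu=B_{\nu_1}\circ\cdots\circ B_{\nu_n}$ for $\nu\in\mathbb{Z}^n$. The $t$-analogue of $V\in\mathrm{End}(\Lambda)$ is $\widetilde V(P[X])=V^Y(P[tX+(1-t)Y])|_{Y\to X}$, where $V^Y$ is $V$ acting in a second set of variables $Y$ and afterwards $Y$ is replaced by $X$. Let $\widetilde B_{\nu,t^2}$ be the $t$-analogue of $B_\nu$ with $t$ replaced by $t^2$, and $$H^\diamondsuit_\nu=\Omega[f_\diamondsuit[tX]-f_\diamondsuit[X]]^\perp\circ\widetilde B_{\nu,t^2}\circ\Omega[f_\diamondsuit[X]-f_\diamondsuit[tX]]^\perp .$$ A partition $R_i$ is regarded as an element of $\mathbb{Z}^{\ell(R_i)}$, and $K^\diamondsuit_{\lambda;R}(t)$ is defined by $H^\diamondsuit_{R_1}\cdots H^\diamondsuit_{R_L}1=\sum_\lambda K^\diamondsuit_{\lambda;R}(t)\,s^\diamondsuit_\lambda$.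 (If $|\lambda|>|R|$ the right side of the claim is an empty sum, i.e. $0$.) *)

theory Defs
  imports
    "HOL-Library.Poly_Mapping"
    "HOL-Library.Groups_Big_Fun"
    "HOL-Computational_Algebra.Polynomial"
    "HOL-Computational_Algebra.Formal_Power_Series"
    "Jordan_Normal_Form.Determinant"
begin

subsection \<open>Partitions\<close>

definition is_partition :: "nat list \<Rightarrow> bool" where
  "is_partition la \<longleftrightarrow> sorted_wrt (\<ge>) la \<and> 0 \<notin> set la"

abbreviation (input) psize :: "nat list \<Rightarrow> nat" where
  "psize la \<equiv> sum_list la"

definition part :: "nat list \<Rightarrow> nat \<Rightarrow> nat" where
  "part la i = (if i < length la then la ! i else 0)"

definition column_length :: "nat list \<Rightarrow> nat \<Rightarrow> nat" where
  "column_length la j = card {i. i < length la \<and> j < la ! i}"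

datatype diamond = Empty | Box | VDom | HDom

fun diamond_partitions :: "diamond \<Rightarrow> nat list set" where
  "diamond_partitions Empty = {[]}"
| "diamond_partitions Box = {mu. is_partition mu}"
| "diamond_partitions HDom = {mu. is_partition mu \<and> (\<forall>r\<in>set mu. even r)}"
| "diamond_partitions VDom = {mu. is_partition mu \<and> (\<forall>j. even (column_length mu j))}"

subsection \<open>Symmetric functions\<close>

text \<open>Multivariate polynomials over \<open>'a\<close>; the first type argument is the exponent vector.\<close>

type_synonym 'a mpol = "(nat \<Rightarrow>\<^sub>0 nat) \<Rightarrow>\<^sub>0 'a"

definition const :: "'a::comm_ring_1 \<Rightarrow> 'a mpol" where
  "const c = Poly_Mapping.single 0 c"

definition var :: "nat \<Rightarrow> 'a::comm_ring_1 mpol" where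
  "var i = Poly_Mapping.single (Poly_Mapping.single i 1) 1"

text \<open>
  The ring of symmetric functions over the rationals, extended by the indeterminate \<open>t\<close>:
  over the rationals it is freely generated by the power sums \<open>p\<^sub>1, p\<^sub>2, \<dots>\<close>,
  and an element is stored as its expression in them. The generator \<open>p\<^sub>k\<close> is the
  polynomial variable with index \<open>k - 1\<close>, so \<open>psum k\<close> is meant for \<open>k \<ge> 1\<close> only. The
  passage to the underlying indeterminates \<open>x\<^sub>0, x\<^sub>1, \<dots>\<close> is \<open>expand\<close> below.
\<close>

type_synonym sym = "rat poly mpol"

definition psum :: "nat \<Rightarrow> 'a::comm_ring_1 mpol" where
  "psum k = var (k - 1)"

text \<open>
  Substitution \<open>p\<^sub>k \<mapsto> g k\<close>, with the coefficients mapped by \<open>\<phi>\<close>.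
\<close>

definition psubst :: "('a::comm_ring_1 \<Rightarrow> 'b::comm_ring_1) \<Rightarrow> (nat \<Rightarrow> 'b) \<Rightarrow> 'a mpol \<Rightarrow> 'b" where
  "psubst \<phi> g P = (\<Sum>m\<in>Poly_Mapping.keys P. \<phi> (Poly_Mapping.lookup P m) *
      (\<Prod>i\<in>Poly_Mapping.keys m. g (Suc i) ^ Poly_Mapping.lookup m i))"

text \<open>The symmetric polynomial \<open>P(x\<^sub>0, \<dots>, x\<^bsub>n-1\<^esub>)\<close>; here \<open>var i\<close> plays the role of \<open>x\<^sub>i\<close>.\<close>

definition expand :: "nat \<Rightarrow> sym \<Rightarrow> rat poly mpol" where
  "expand n = psubst const (\<lambda>k. \<Sum>i<n. var i ^ k)"

text \<open>
  Schur functions as quotients of alternants: \<open>alternant n la\<close> is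
  \<open>det (x\<^sub>i ^ (\<lambda>\<^sub>j + n - 1 - j))\<close> with \<open>i, j\<close> in \<open>{0..<n}\<close>, and \<open>alternant n []\<close> is the
  Vandermonde determinant.
\<close>

definition alternant :: "nat \<Rightarrow> nat list \<Rightarrow> rat poly mpol" where
  "alternant n la = det (mat n n (\<lambda>(i, j). var i ^ (part la j + (n - 1 - j))))"

definition schur :: "nat list \<Rightarrow> sym" where
  "schur la = (THE s. \<forall>n \<ge> length la. expand n s * alternant n [] = alternant n la)"

text \<open>
  The coefficients of \<open>P\<close> in a basis \<open>b\<close> of the symmetric functions indexed by partitions.
\<close>

definition expansion :: "(nat list \<Rightarrow> sym) \<Rightarrow> sym \<Rightarrow> nat list \<Rightarrow>\<^sub>0 rat poly" where
  "expansion b P = (THE c. (\<forall>la\<in>Poly_Mapping.keys c. is_partition la) \<and>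
      P = (\<Sum>la\<in>Poly_Mapping.keys c. const (Poly_Mapping.lookup c la) * b la))"

definition coefficient :: "(nat list \<Rightarrow> sym) \<Rightarrow> nat list \<Rightarrow> sym \<Rightarrow> rat poly" where
  "coefficient b la P = Poly_Mapping.lookup (expansion b P) la"

definition scalar :: "sym \<Rightarrow> sym \<Rightarrow> rat poly" where
  "scalar P Q = (\<Sum>la\<in>Poly_Mapping.keys (expansion schur P).
      coefficient schur la P * coefficient schur la Q)"

definition LR :: "nat list \<Rightarrow> nat list \<Rightarrow> nat list \<Rightarrow> rat poly" where
  "LR ta la mu = coefficient schur ta (schur la * schur mu)"

text \<open>\<open>skew P\<close> is the adjoint of multiplication by \<open>P\<close>.\<close>

definition skew :: "sym \<Rightarrow> sym \<Rightarrow> sym" where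
  "skew P Q = (THE S. \<forall>T. scalar S T = scalar Q (P * T))"

subsection \<open>Plethysm\<close>

definition tvar :: "rat poly" where
  "tvar = [:0, 1:]"

text \<open>
  \<open>adams k A\<close> is \<open>p\<^sub>k[A]\<close>: every indeterminate is raised to the \<open>k\<close>-th power,
  that is \<open>t \<mapsto> t ^ k\<close> and \<open>p\<^sub>j \<mapsto> p\<^bsub>jk\<^esub>\<close>.
\<close>

definition adams_coeff :: "nat \<Rightarrow> rat poly \<Rightarrow> rat poly" where
  "adams_coeff k c = pcompose c (monom 1 k)"

definition adams_ext :: "('a::comm_ring_1 \<Rightarrow> 'a) \<Rightarrow> nat \<Rightarrow> 'a mpol \<Rightarrow> 'a mpol" where
  "adams_ext \<psi> k = psubst (\<lambda>c. const (\<psi> c)) (\<lambda>j. psum (j * k))"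

definition adams :: "nat \<Rightarrow> sym \<Rightarrow> sym" where
  "adams k = adams_ext (adams_coeff k) k"

definition pleth :: "sym \<Rightarrow> sym \<Rightarrow> sym" where
  "pleth P A = psubst const (\<lambda>k. adams k A) P"

text \<open>The alphabet \<open>X\<close>, with \<open>X = p\<^sub>1[X]\<close>.\<close>

abbreviation XX :: sym where
  "XX \<equiv> psum 1"

text \<open>
  \<open>Omega A\<close> is \<open>\<Omega>[zA] = exp (\<Sum>k\<ge>1. p\<^sub>k[A] z ^ k / k)\<close> as a power series in an
  extra indeterminate \<open>z\<close>.
\<close>

definition Omega :: "sym \<Rightarrow> sym fps" where
  "Omega A = fps_compose (Abs_fps (\<lambda>n. const [:1 / fact n:]))
     (Abs_fps (\<lambda>k. if k = 0 then 0 else const [:1 / of_nat k:] * adams k A))"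

text \<open>
  The operator \<open>\<Omega>[A]\<^sup>\<perp>\<close>, i.e. \<open>\<Omega>[zA]\<^sup>\<perp>\<close> at \<open>z = 1\<close>, for \<open>A\<close> without constant term:
  the coefficient of \<open>z ^ n\<close> has no terms of degree below \<open>n\<close>, so only finitely
  many summands are nonzero on any given \<open>P\<close>.
\<close>

definition Omega_perp :: "sym \<Rightarrow> sym \<Rightarrow> sym" where
  "Omega_perp A P = Sum_any (\<lambda>n. skew (fps_nth (Omega A) n) P)"

subsection \<open>Bernstein operators and their \<open>t\<close>-analogues\<close>

text \<open>
  The coefficient of \<open>z ^ r\<close> in \<open>\<Omega>[zX] \<Omega>[-z\<^sup>-\<^sup>1X]\<^sup>\<perp>\<close>; again
  a finite sum on any given \<open>P\<close>.
\<close>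

definition bernstein :: "int \<Rightarrow> sym \<Rightarrow> sym" where
  "bernstein r P = Sum_any (\<lambda>n. if r + int n \<ge> 0
      then fps_nth (Omega XX) (nat (r + int n)) * skew (fps_nth (Omega (- XX)) n) P else 0)"

definition bernstein_list :: "int list \<Rightarrow> sym \<Rightarrow> sym" where
  "bernstein_list nu = foldr (\<lambda>r V. bernstein r \<circ> V) nu id"

text \<open>
  Symmetric functions in two alphabets: polynomials in the \<open>p\<^sub>k[Y]\<close> whose coefficients
  are symmetric functions of \<open>X\<close>.
\<close>

type_synonym sym2 = "sym mpol"

definition in_X :: "sym \<Rightarrow> sym2" where
  "in_X P = const P"

definition in_Y :: "sym \<Rightarrow> sym2" where
  "in_Y = psubst (\<lambda>c. const (const c)) psum"

definition adams2 :: "nat \<Rightarrow> sym2 \<Rightarrow> sym2" where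
  "adams2 k = adams_ext (adams k) k"

definition pleth2 :: "sym \<Rightarrow> sym2 \<Rightarrow> sym2" where
  "pleth2 P A = psubst (\<lambda>c. const (const c)) (\<lambda>k. adams2 k A) P"

text \<open>\<open>V\<^sup>Y\<close>: the linear operator \<open>V\<close> acting on the \<open>Y\<close> variables.\<close>

definition act_Y :: "(sym \<Rightarrow> sym) \<Rightarrow> sym2 \<Rightarrow> sym2" where
  "act_Y V Q = (\<Sum>m\<in>Poly_Mapping.keys Q.
      in_X (Poly_Mapping.lookup Q m) * in_Y (V (Poly_Mapping.single m 1)))"

definition Y_to_X :: "sym2 \<Rightarrow> sym" where
  "Y_to_X = psubst (\<lambda>c. c) psum"

definition t_analogue :: "rat poly \<Rightarrow> (sym \<Rightarrow> sym) \<Rightarrow> sym \<Rightarrow> sym" where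
  "t_analogue q V P = Y_to_X (act_Y V
      (pleth2 P (in_X (const q) * in_X XX + (1 - in_X (const q)) * in_Y XX)))"

subsection \<open>The polynomials \<open>K\<^sup>\<diamondsuit>\<close>\<close>

fun f_diamond :: "diamond \<Rightarrow> sym" where
  "f_diamond Empty = 0"
| "f_diamond Box = schur [1] + schur [1, 1]"
| "f_diamond HDom = schur [2]"
| "f_diamond VDom = schur [1, 1]"

text \<open>\<open>f\<^sub>\<diamondsuit>[tX]\<close>\<close>

definition f_diamond_t :: "diamond \<Rightarrow> sym" where
  "f_diamond_t d = pleth (f_diamond d) (const tvar * XX)"

definition s_diamond :: "diamond \<Rightarrow> nat list \<Rightarrow> sym" where
  "s_diamond d la = Omega_perp (- f_diamond d) (schur la)"

definition H_diamond :: "diamond \<Rightarrow> int list \<Rightarrow> sym \<Rightarrow> sym" where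
  "H_diamond d nu =
     Omega_perp (f_diamond_t d - f_diamond d)
     \<circ> t_analogue (tvar ^ 2) (bernstein_list nu)
     \<circ> Omega_perp (f_diamond d - f_diamond_t d)"

definition K_diamond :: "diamond \<Rightarrow> nat list \<Rightarrow> nat list list \<Rightarrow> rat poly" where
  "K_diamond d la R =
     coefficient (s_diamond d) la (foldr (\<lambda>r. H_diamond d (map int r)) R 1)"

end

theory Submission
  imports Defs
begin

text \<open>
  The conjugating operators \<open>\<Omega>[\<dots>]\<^sup>\<perp>\<close> in \<open>H\<^sup>\<diamondsuit>\<close> telescope along the product, so
  \<open>K\<^sup>\<diamondsuit>\<close> is the coefficient of \<open>s\<^sub>\<lambda>\<close> in \<open>\<Omega>[f\<^sub>\<diamondsuit>[tX]]\<^sup>\<perp> U\<close>, where \<open>U\<close> is the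
  product for the empty symbol. As \<open>U\<close> is homogeneous, the claim follows by adjointness from
  Littlewood's identities: the part of degree \<open>m\<close> of \<open>\<Omega>[f\<^sub>\<diamondsuit>[tX]]\<close> is \<open>t\<^sup>m\<close> times
  the sum of the \<open>s\<^sub>\<mu>\<close> with \<open>\<mu>\<close> of size \<open>m\<close> in \<open>\<P>\<^sup>\<diamondsuit>\<close>.

  For the square these identities are proved by comparing the logarithmic derivative
  of \<open>\<Omega>[s\<^sub>1 + s\<^sub>1\<^sub>1]\<close> with a recursion for the sum of all Schur functions, which comes from
  moving beads on an abacus. The two dominoes are obtained from the square by
  adding or removing vertical strips.
\<close>

section \<open>Substitution homomorphisms\<close>

text \<open>\<open>schur\<close> is a definite description that quantifies over all large numbers n
  of variables, so it has to be shown to be well defined. Uniqueness is the algebraic independence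
  of the power sums (\<open>expand_inj\<close>); existence comes from solving Euler's relation
  degree by degree. This recursion and the one for the sum of all Schur functions are instances of a
  single identity, \<open>antisymmetric_Euler\<close>, applied to \<open>alt n\<close> and to
  \<open>sgn_set {..<n}\<close>.

  Identities between generating series are reduced to logarithmic derivatives (\<open>logd\<close>):
  that of \<open>Omega A\<close> is the series of the p_k[A]. Coefficients in the Schur basis are
  read off as coefficients of monomials after multiplication by a Vandermonde determinant
  (\<open>cf\<close>), which turns the identities into signed counts of bead moves or of vertical
  strips.

  The series variable of \<open>Omega\<close> is not the degree: the dominoes have degree 2 and s_1
  + s_11 is not homogeneous. The two are related by \<open>sq\<close>, and truncations leave a
  remainder that is discarded at the end by its degree.\<close>

abbreviation lookup where "lookup \<equiv> Poly_Mapping.lookup"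
abbreviation keys where "keys \<equiv> Poly_Mapping.keys"
abbreviation single where "single \<equiv> Poly_Mapping.single"

lemma sum_single_lookup: "(\<Sum>m\<in>keys P. single m (lookup P m)) = P"
  by (rule poly_mapping_eqI) (auto simp: lookup_sum lookup_single when_def in_keys_iff)

lemma const_0 [simp]: "const 0 = 0" and const_1 [simp]: "const 1 = 1"
  and const_add: "const (a + b) = const a + const b"
  and const_diff: "const (a - b) = const a - const b"
  and const_uminus: "const (- a) = - const a"
  and const_mult: "const (a * b) = const a * const b"
  by (simp_all add: const_def single_add single_diff single_uminus mult_single)

lemma const_of_nat: "const (of_nat n) = of_nat n"
  by (simp add: const_def)

lemma const_power: "const (a ^ n) = const a ^ n"
  by (induction n) (simp_all add: const_mult)

lemma const_mult_single: "const a * single m b = single m (a * b)"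
  by (simp add: const_def mult_single)

lemma lookup_const_mult: "lookup (const a * P) m = a * lookup P m"
proof -
  have "const a * P = (\<Sum>k\<in>keys P. single k (a * lookup P k))"
    by (subst (1) sum_single_lookup [of P, symmetric]) (simp add: sum_distrib_left const_mult_single)
  then show ?thesis
    by (auto simp: lookup_sum lookup_single when_def in_keys_iff)
qed

lemma single_eq_const_mult: "single m c = const c * single m 1"
  by (simp add: const_mult_single)

definition wt :: "(nat \<Rightarrow>\<^sub>0 nat) \<Rightarrow> nat" where
  "wt m = (\<Sum>i\<in>keys m. Suc i * lookup m i)"

lemma wt_superset: "finite S \<Longrightarrow> keys m \<subseteq> S \<Longrightarrow> wt m = (\<Sum>i\<in>S. Suc i * lookup m i)"
  unfolding wt_def by (rule sum.mono_neutral_left) (auto simp: in_keys_iff)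

lemma wt_add [simp]: "wt (a + b) = wt a + wt b"
proof -
  let ?S = "keys a \<union> keys b"
  have "wt (a + b) = (\<Sum>i\<in>?S. Suc i * lookup (a + b) i)"
    by (rule wt_superset) (use keys_add [of a b] in auto)
  also have "\<dots> = (\<Sum>i\<in>?S. Suc i * lookup a i) + (\<Sum>i\<in>?S. Suc i * lookup b i)"
    by (simp add: lookup_add algebra_simps sum.distrib)
  also have "\<dots> = wt a + wt b"
    by (subst (1 2) wt_superset [where S = ?S]) auto
  finally show ?thesis .
qed

lemma wt_0 [simp]: "wt 0 = 0"
  by (simp add: wt_def)

lemma wt_single [simp]: "wt (single i k) = Suc i * k"
  by (simp add: wt_def)

lemma exponent_split:
  fixes m :: "nat \<Rightarrow>\<^sub>0 nat"
  assumes "i \<in> keys m"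
  shows "m = single i 1 + (m - single i 1)"
  using assms by (intro poly_mapping_eqI) (auto simp: lookup_add lookup_minus lookup_single when_def in_keys_iff)

lemma exponent_induct [case_names zero add]:
  fixes m :: "nat \<Rightarrow>\<^sub>0 nat"
  assumes "P 0" and step: "\<And>i m. P m \<Longrightarrow> P (single i 1 + m)"
  shows "P m"
proof (induction "wt m" arbitrary: m rule: less_induct)
  case less
  show ?case
  proof (cases "m = 0")
    case False
    then obtain i where i: "i \<in> keys m" by (metis keys_eq_empty all_not_in_conv)
    have m: "m = single i 1 + (m - single i 1)" by (rule exponent_split [OF i])
    have "wt m = wt (single i 1) + wt (m - single i 1)" by (subst m) (rule wt_add)
    then have "P (m - single i 1)" by (intro less) simp
    then show ?thesis using step m by metis
  qed (use assms in simp)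
qed

section \<open>Ring homomorphisms and evaluation of polynomials\<close>

definition is_hom :: "('a::comm_ring_1 \<Rightarrow> 'b::comm_ring_1) \<Rightarrow> bool" where
  "is_hom f \<longleftrightarrow> f 0 = 0 \<and> f 1 = 1 \<and> (\<forall>a b. f (a + b) = f a + f b) \<and> (\<forall>a b. f (a * b) = f a * f b)"

lemma is_hom_simps:
  assumes "is_hom f"
  shows "f 0 = 0" "f 1 = 1" "f (a + b) = f a + f b" "f (a * b) = f a * f b"
  using assms by (auto simp: is_hom_def)

lemma is_hom_uminus:
  assumes "is_hom f"
  shows "f (- a) = - f a"
proof -
  have "f (- a) + f a = f (- a + a)" by (rule is_hom_simps(3) [OF assms, symmetric])
  then show ?thesis by (simp add: is_hom_simps(1) [OF assms] eq_neg_iff_add_eq_0)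
qed

lemma is_hom_diff:
  assumes "is_hom f"
  shows "f (a - b) = f a - f b"
  using is_hom_simps(3) [OF assms, of a "- b"] is_hom_uminus [OF assms, of b] by simp

lemma is_hom_sum: "is_hom f \<Longrightarrow> f (sum g A) = (\<Sum>x\<in>A. f (g x))"
  by (induction A rule: infinite_finite_induct) (simp_all add: is_hom_simps)

lemma is_hom_power: "is_hom f \<Longrightarrow> f (a ^ n) = f a ^ n"
  by (induction n) (simp_all add: is_hom_simps)

lemma is_hom_of_nat: "is_hom f \<Longrightarrow> f (of_nat n) = of_nat n"
  by (induction n) (simp_all add: is_hom_simps)

lemma is_hom_const: "is_hom const"
  by (simp add: is_hom_def const_add const_mult)

lemma is_hom_id: "is_hom (\<lambda>c. c)"
  by (simp add: is_hom_def)

lemma is_hom_comp: "is_hom f \<Longrightarrow> is_hom g \<Longrightarrow> is_hom (\<lambda>c. f (g c))"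
  by (simp add: is_hom_def)

text \<open>The value of a single monomial under p_k -> g k; \<open>Suc i\<close> because the
  variable with index i is p_(i+1). It isolates the part of \<open>psubst\<close> that is
  multiplicative in the exponent.\<close>

definition ev :: "(nat \<Rightarrow> 'b::comm_ring_1) \<Rightarrow> (nat \<Rightarrow>\<^sub>0 nat) \<Rightarrow> 'b" where
  "ev g m = (\<Prod>i\<in>keys m. g (Suc i) ^ lookup m i)"

lemma ev_superset: "finite S \<Longrightarrow> keys m \<subseteq> S \<Longrightarrow> ev g m = (\<Prod>i\<in>S. g (Suc i) ^ lookup m i)"
  unfolding ev_def by (rule prod.mono_neutral_left) (auto simp: in_keys_iff)

lemma ev_add: "ev g (a + b) = ev g a * ev g b"
proof -
  let ?S = "keys a \<union> keys b"
  have "ev g (a + b) = (\<Prod>i\<in>?S. g (Suc i) ^ lookup (a + b) i)"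
    by (rule ev_superset) (use keys_add [of a b] in auto)
  also have "\<dots> = (\<Prod>i\<in>?S. g (Suc i) ^ lookup a i) * (\<Prod>i\<in>?S. g (Suc i) ^ lookup b i)"
    by (simp add: lookup_add power_add prod.distrib)
  also have "\<dots> = ev g a * ev g b"
    by (subst (1 2) ev_superset [where S = ?S]) auto
  finally show ?thesis .
qed

lemma ev_0 [simp]: "ev g 0 = 1"
  by (simp add: ev_def)

lemma ev_single [simp]: "ev g (single i k) = g (Suc i) ^ k"
  by (simp add: ev_def)

lemma psubst_ev: "psubst \<phi> g P = (\<Sum>m\<in>keys P. \<phi> (lookup P m) * ev g m)"
  by (simp add: psubst_def ev_def)

lemma psubst_superset:
  assumes "\<phi> 0 = 0" "finite S" "keys P \<subseteq> S"
  shows "psubst \<phi> g P = (\<Sum>m\<in>S. \<phi> (lookup P m) * ev g m)"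
  unfolding psubst_ev using assms by (intro sum.mono_neutral_left) (auto simp: in_keys_iff)

lemma psubst_add:
  assumes "is_hom \<phi>"
  shows "psubst \<phi> g (P + Q) = psubst \<phi> g P + psubst \<phi> g Q"
proof -
  let ?S = "keys P \<union> keys Q"
  have 0: "\<phi> 0 = 0" using assms by (simp add: is_hom_def)
  have "psubst \<phi> g (P + Q) = (\<Sum>m\<in>?S. \<phi> (lookup (P + Q) m) * ev g m)"
    using keys_add [of P Q] by (intro psubst_superset) (auto simp: 0)
  also have "\<dots> = (\<Sum>m\<in>?S. \<phi> (lookup P m) * ev g m) + (\<Sum>m\<in>?S. \<phi> (lookup Q m) * ev g m)"
    by (simp add: lookup_add is_hom_simps [OF assms] distrib_right sum.distrib)
  also have "\<dots> = psubst \<phi> g P + psubst \<phi> g Q"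
    by (subst (1 2) psubst_superset [where S = ?S]) (auto simp: 0)
  finally show ?thesis .
qed

lemma psubst_0 [simp]: "psubst \<phi> g 0 = 0"
  by (simp add: psubst_def)

lemma psubst_sum:
  assumes "is_hom \<phi>"
  shows "psubst \<phi> g (sum f A) = (\<Sum>x\<in>A. psubst \<phi> g (f x))"
  by (induction A rule: infinite_finite_induct) (simp_all add: psubst_add [OF assms])

lemma psubst_single:
  assumes "is_hom \<phi>"
  shows "psubst \<phi> g (single m c) = \<phi> c * ev g m"
  by (cases "c = 0") (use assms in \<open>simp_all add: psubst_ev is_hom_def\<close>)

lemma psubst_mult:
  assumes "is_hom \<phi>"
  shows "psubst \<phi> g (P * Q) = psubst \<phi> g P * psubst \<phi> g Q"
proof -
  have "psubst \<phi> g (P * Q) = psubst \<phi> g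
      ((\<Sum>m\<in>keys P. single m (lookup P m)) * (\<Sum>m\<in>keys Q. single m (lookup Q m)))"
    by (simp only: sum_single_lookup)
  also have "\<dots> = (\<Sum>m\<in>keys P. \<Sum>m'\<in>keys Q.
      (\<phi> (lookup P m) * ev g m) * (\<phi> (lookup Q m') * ev g m'))"
    by (simp add: sum_product psubst_sum assms mult_single psubst_single ev_add
        is_hom_simps [OF assms] mult_ac)
  also have "\<dots> = psubst \<phi> g P * psubst \<phi> g Q"
    by (simp add: psubst_ev sum_product)
  finally show ?thesis .
qed

lemma psubst_const: "is_hom \<phi> \<Longrightarrow> psubst \<phi> g (const c) = \<phi> c"
  by (simp add: const_def psubst_single)

lemma psubst_var: "is_hom \<phi> \<Longrightarrow> psubst \<phi> g (var i) = g (Suc i)"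
  by (simp add: var_def psubst_single is_hom_def)

lemma psubst_psum: "is_hom \<phi> \<Longrightarrow> k \<ge> 1 \<Longrightarrow> psubst \<phi> g (psum k) = g k"
  by (simp add: psum_def psubst_var)

lemma is_hom_psubst: "is_hom \<phi> \<Longrightarrow> is_hom (psubst \<phi> g)"
  using psubst_const [of \<phi> g 1]
  by (simp add: is_hom_def psubst_add psubst_mult)

lemma mpol_induct [case_names const add var]:
  fixes p :: "'a::comm_ring_1 mpol"
  assumes c: "\<And>c. P (const c)" and a: "\<And>p q. P p \<Longrightarrow> P q \<Longrightarrow> P (p + q)"
    and v: "\<And>i p. P p \<Longrightarrow> P (var i * p)"
  shows "P p"
proof -
  have s: "P (single m b)" for m b
  proof (induction m rule: exponent_induct)
    case zero
    then show ?case using c [of b] by (simp add: const_def)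
  next
    case (add i m)
    have "single (single i 1 + m) b = var i * single m b" by (simp add: var_def mult_single)
    then show ?case using v add by simp
  qed
  have "P (\<Sum>m\<in>S. single m (lookup p m))" if "finite S" for S
    using that by (induction S rule: finite_induct) (use c [of 0] in \<open>auto intro: a s\<close>)
  from this [of "keys p"] show ?thesis by (simp add: sum_single_lookup)
qed

lemma hom_eqI:
  fixes f g :: "'a::comm_ring_1 mpol \<Rightarrow> 'b::comm_ring_1"
  assumes "is_hom f" "is_hom g" "\<And>c. f (const c) = g (const c)" "\<And>i. f (var i) = g (var i)"
  shows "f p = g p"
  by (induction p rule: mpol_induct) (use assms in \<open>auto simp: is_hom_simps\<close>)

section \<open>Gradings\<close>

text \<open>The weight of \<open>p\<^sub>k\<close> is \<open>k\<close>, so \<open>wt\<close> is the degree in the underlying indeterminates.\<close>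

definition graded :: "nat set \<Rightarrow> 'a::comm_ring_1 mpol \<Rightarrow> bool" where
  "graded A P \<longleftrightarrow> (\<forall>m\<in>keys P. wt m \<in> A)"

lemma graded_0 [simp]: "graded A 0"
  by (simp add: graded_def)

lemma graded_mono: "graded A P \<Longrightarrow> A \<subseteq> B \<Longrightarrow> graded B P"
  by (auto simp: graded_def)

lemma graded_add: "graded A P \<Longrightarrow> graded A Q \<Longrightarrow> graded A (P + Q)"
  using keys_add [of P Q] by (fastforce simp: graded_def)

lemma graded_uminus [simp]: "graded A (- P) \<longleftrightarrow> graded A P"
  by (simp add: graded_def in_keys_iff)

lemma graded_diff: "graded A P \<Longrightarrow> graded A Q \<Longrightarrow> graded A (P - Q)"
  using graded_add [of A P "- Q"] by simp

lemma graded_sum: "(\<And>x. x \<in> S \<Longrightarrow> graded A (f x)) \<Longrightarrow> graded A (sum f S)"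
  by (induction S rule: infinite_finite_induct) (auto intro: graded_add)

lemma graded_single: "wt m \<in> A \<Longrightarrow> graded A (single m c)"
  by (simp add: graded_def in_keys_iff lookup_single when_def)

text \<open>The target set is a parameter, so that one rule serves homogeneous factors, factors of
  bounded degree and factors whose degree is bounded below.\<close>

lemma graded_mult:
  assumes "graded A P" "graded B Q" "\<And>a b. a \<in> A \<Longrightarrow> b \<in> B \<Longrightarrow> a + b \<in> C"
  shows "graded C (P * Q)"
  unfolding graded_def
proof
  fix m assume "m \<in> keys (P * Q)"
  then obtain a b where "m = a + b" "a \<in> keys P" "b \<in> keys Q"
    using keys_mult [of P Q] by blast
  then show "wt m \<in> C" using assms by (auto simp: graded_def)
qed

lemma graded_hom_mult: "graded {a} P \<Longrightarrow> graded {b} Q \<Longrightarrow> graded {a + b} (P * Q)"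
  by (erule graded_mult) auto

lemma graded_const: "graded {0} (const c)"
  by (simp add: const_def graded_single)

lemma graded_1: "graded {0} 1"
  using graded_const [of 1] by simp

lemma graded_const_mult: "graded A P \<Longrightarrow> graded A (const c * P)"
  by (erule graded_mult [OF graded_const]) auto

lemma graded_psum: "k \<ge> 1 \<Longrightarrow> graded {k} (psum k)"
  by (simp add: psum_def var_def graded_single)

lemma graded_exists: "\<exists>d. graded {..d} P"
proof -
  have "wt m \<le> Max (wt ` keys P)" if "m \<in> keys P" for m
    using that by (intro Max_ge) auto
  then have "graded {..Max (wt ` keys P)} P" by (simp add: graded_def)
  then show ?thesis ..
qed


section \<open>Alternants\<close>

text \<open>Only the values of the exponent function \<open>e\<close> below \<open>n\<close> matter.\<close>

definition add_at :: "(nat \<Rightarrow> nat) \<Rightarrow> nat \<Rightarrow> nat \<Rightarrow> nat \<Rightarrow> nat" where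
  "add_at e i k = e(i := e i + k)"

definition sub_at :: "(nat \<Rightarrow> nat) \<Rightarrow> nat \<Rightarrow> nat \<Rightarrow> nat \<Rightarrow> nat" where
  "sub_at e i k = e(i := e i - k)"

definition xmon :: "nat \<Rightarrow> (nat \<Rightarrow> nat) \<Rightarrow> 'a::comm_ring_1 mpol" where
  "xmon n e = (\<Prod>i<n. var i ^ e i)"

definition expo :: "nat \<Rightarrow> (nat \<Rightarrow> nat) \<Rightarrow> (nat \<Rightarrow>\<^sub>0 nat)" where
  "expo n e = (\<Sum>i<n. single i (e i))"

text \<open>The Leibniz expansion of det (x_i ^ e j) for arbitrary exponents. Unsorted and repeated
  exponents must be allowed, since raising or lowering one exponent by k leaves the decreasing
  ones.\<close>

definition alt :: "nat \<Rightarrow> (nat \<Rightarrow> nat) \<Rightarrow> 'a::comm_ring_1 mpol" where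
  "alt n e = (\<Sum>p | p permutes {..<n}. of_int (sign p) * xmon n (e \<circ> p))"

definition delta :: "nat \<Rightarrow> nat \<Rightarrow> nat" where
  "delta n j = n - 1 - j"

lemma lookup_expo: "lookup (expo n e) i = (if i < n then e i else 0)"
  by (simp add: expo_def lookup_sum lookup_single when_def)

lemma expo_eq_iff: "expo n e = expo n f \<longleftrightarrow> (\<forall>i<n. e i = f i)"
  by (auto simp: poly_mapping_eq_iff fun_eq_iff lookup_expo split: if_splits)

lemma expo_cong: "(\<And>i. i < n \<Longrightarrow> e i = f i) \<Longrightarrow> expo n e = expo n f"
  by (simp add: expo_eq_iff)

lemma var_power: "var i ^ k = single (single i k) 1"
proof (induction k)
  case (Suc k)
  then show ?case by (simp add: var_def mult_single flip: single_add)
qed simp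

lemma xmon_eq_single: "xmon n e = single (expo n e) 1"
proof -
  have "(\<Prod>i\<in>S. var i ^ e i) = single (\<Sum>i\<in>S. single i (e i)) (1::'a::comm_ring_1)" if "finite S" for S
    using that by (induction S rule: finite_induct) (simp_all add: var_power mult_single)
  then show ?thesis by (simp add: xmon_def expo_def)
qed

lemma xmon_cong: "(\<And>i. i < n \<Longrightarrow> e i = f i) \<Longrightarrow> xmon n e = xmon n f"
  by (simp add: xmon_def)

lemma alt_cong:
  assumes "\<And>i. i < n \<Longrightarrow> e i = f i"
  shows "alt n e = alt n f"
  unfolding alt_def
proof (rule sum.cong [OF refl])
  fix p assume "p \<in> {p. p permutes {..<n}}"
  then have "p i < n" if "i < n" for i
    using that by (metis lessThan_iff mem_Collect_eq permutes_in_image)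
  then show "of_int (sign p) * xmon n (e \<circ> p) = of_int (sign p) * xmon n (f \<circ> p)"
    by (simp add: assms cong: xmon_cong)
qed

text \<open>Reindex the Leibniz sum by composing with q on the left; the sign is
  multiplicative.\<close>

lemma alt_permute:
  assumes q: "q permutes {..<n}"
  shows "alt n (e \<circ> q) = (of_int (sign q) * alt n e :: 'a::comm_ring_1 mpol)"
proof -
  have "of_int (sign q) * (alt n e :: 'a mpol) =
      (\<Sum>p | p permutes {..<n}. of_int (sign q) * (of_int (sign p) * xmon n (e \<circ> p)))"
    by (simp add: alt_def sum_distrib_left)
  also have "\<dots> = (\<Sum>p | p permutes {..<n}. of_int (sign q) * (of_int (sign (q \<circ> p)) * xmon n (e \<circ> (q \<circ> p))))"
    by (rule setum_permutations_compose_left [OF q])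
  also have "\<dots> = (\<Sum>p | p permutes {..<n}. of_int (sign p) * xmon n (e \<circ> q \<circ> p))"
  proof (rule sum.cong [OF refl])
    fix p assume "p \<in> {p. p permutes {..<n}}"
    then have "sign (q \<circ> p) = sign q * sign p"
      using q by (auto intro!: sign_compose simp: permutation_permutes)
    then show "of_int (sign q) * (of_int (sign (q \<circ> p)) * xmon n (e \<circ> (q \<circ> p))) =
        of_int (sign p) * xmon n (e \<circ> q \<circ> p)"
      by (simp add: sign_idempotent comp_assoc mult.assoc [symmetric] flip: of_int_mult)
  qed
  also have "\<dots> = alt n (e \<circ> q)" by (simp add: alt_def)
  finally show ?thesis by simp
qed

text \<open>The property shared by \<open>alt n\<close>, by \<open>sgn_set {..<n}\<close> and by the
  coefficient functions of alternants. It is stated for functions of exponents so that Euler's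
  relation is proved once for all of them.\<close>

definition antisymmetric :: "nat \<Rightarrow> ((nat \<Rightarrow> nat) \<Rightarrow> 'b::comm_ring_1) \<Rightarrow> bool" where
  "antisymmetric n g \<longleftrightarrow> (\<forall>e f. (\<forall>i<n. e i = f i) \<longrightarrow> g e = g f) \<and>
     (\<forall>e. \<forall>i<n. \<forall>j<n. i \<noteq> j \<longrightarrow> g (e \<circ> transpose i j) = - g e)"

lemma antisymmetricD:
  assumes "antisymmetric n g"
  shows "(\<And>i. i < n \<Longrightarrow> e i = f i) \<Longrightarrow> g e = g f"
    and "i < n \<Longrightarrow> j < n \<Longrightarrow> i \<noteq> j \<Longrightarrow> g (e \<circ> transpose i j) = - g e"
  using assms by (auto simp: antisymmetric_def)

lemma antisymmetric_permute:
  assumes g: "antisymmetric n g" and q: "q permutes {..<n}"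
  shows "g (e \<circ> q) = of_int (sign q) * g e"
  using q finite_lessThan [of n]
proof (induction q arbitrary: e rule: permutes_induct)
  case id
  then show ?case by simp
next
  case (swap a b p)
  have "g (e \<circ> (transpose a b \<circ> p)) = of_int (sign p) * g (e \<circ> transpose a b)"
    unfolding comp_assoc [symmetric] by (rule swap)
  also have "g (e \<circ> transpose a b) = - g e"
    using swap by (intro antisymmetricD [OF g]) auto
  also have "sign (transpose a b \<circ> p) = - sign p"
    using swap by (subst sign_compose) (auto simp: sign_swap_id permutation_swap_id intro: permutation_permutes [THEN iffD2])
  then have "of_int (sign p) * - g e = of_int (sign (transpose a b \<circ> p)) * g e" by simp
  finally show ?case .
qed

lemma antisymmetric_repeat:
  fixes g :: "_ \<Rightarrow> 'b::{comm_ring_1,ring_char_0,semiring_no_zero_divisors}"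
  assumes g: "antisymmetric n g" and "i < n" "j < n" "i \<noteq> j" "e i = e j"
  shows "g e = 0"
proof -
  have "e \<circ> transpose i j = e"
    using assms(5) by (auto simp: transpose_def)
  then have "g e = - g e"
    using antisymmetricD(2) [OF g assms(2-4), of e] by simp
  then show ?thesis by (simp add: eq_neg_iff_add_eq_0 flip: mult_2)
qed

lemma antisymmetric_alt: "antisymmetric n (alt n)"
  unfolding antisymmetric_def
proof (intro conjI allI impI)
  fix e :: "nat \<Rightarrow> nat" and i j assume ij: "i < n" "j < n" "i \<noteq> j"
  then show "alt n (e \<circ> transpose i j) = - (alt n e :: 'a mpol)"
    by (subst alt_permute) (auto intro: permutes_swap_id simp: sign_swap_id)
qed (auto intro: alt_cong)

lemma alternant_eq_alt: "alternant n la = alt n (\<lambda>j. part la j + delta n j)"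
proof -
  have "alternant n la = (\<Sum>p | p permutes {0..<n}. signof p * (\<Prod>i=0..<n. var i ^ (part la (p i) + (n - 1 - p i))))"
    unfolding alternant_def
  proof (subst det_def', rule mat_carrier, rule sum.cong [OF refl])
    fix p assume "p \<in> {p. p permutes {0..<n}}"
    then have "p i < n" if "i < n" for i
      using that by (metis atLeastLessThan_iff mem_Collect_eq permutes_in_image le0)
    then show "signof p * (\<Prod>i = 0..<n. mat n n (\<lambda>(i, j). var i ^ (part la j + (n - 1 - j))) $$ (i, p i)) =
        signof p * (\<Prod>i=0..<n. var i ^ (part la (p i) + (n - 1 - p i)))"
      by simp
  qed
  then show ?thesis
    by (simp add: alt_def xmon_def delta_def atLeast0LessThan)
qed

lemma alternant_Nil: "alternant n [] = alt n (delta n)"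
  by (simp add: alternant_eq_alt part_def)

lemma is_hom_expand: "is_hom (expand n)"
  by (simp add: expand_def is_hom_psubst is_hom_const)

lemma expand_psum: "k \<ge> 1 \<Longrightarrow> expand n (psum k) = (\<Sum>i<n. var i ^ k)"
  by (simp add: expand_def psubst_psum is_hom_const)

lemma expand_const [simp]: "expand n (const c) = const c"
  by (simp add: expand_def psubst_const is_hom_const)

lemma var_power_mult_mon: "j < n \<Longrightarrow> var j ^ k * xmon n e = xmon n (e(j := e j + k))"
  unfolding xmon_def
  by (subst (1 2) prod.remove [of _ j]) (auto simp: power_add mult_ac intro!: prod.cong)

text \<open>A power sum is invariant under permutations of the indeterminates, so it can be
  multiplied into each Leibniz term: raising the exponent of x_j in the term of p amounts to raising
  the value of \<open>e\<close> at p j.\<close>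

lemma psum_mult_alt: "(\<Sum>i<n. var i ^ k) * alt n e = ((\<Sum>i<n. alt n (add_at e i k)) :: 'a::comm_ring_1 mpol)"
proof -
  have "(\<Sum>i<n. var i ^ k) * xmon n (e \<circ> p) = ((\<Sum>i<n. xmon n (e(i := e i + k) \<circ> p)) :: 'a mpol)"
    if p: "p permutes {..<n}" for p
  proof -
    have "(\<Sum>i<n. var i ^ k) * xmon n (e \<circ> p) = ((\<Sum>j<n. xmon n ((e \<circ> p)(j := e (p j) + k))) :: 'a mpol)"
      by (simp add: sum_distrib_right var_power_mult_mon)
    also have "\<dots> = (\<Sum>j<n. xmon n (e(p j := e (p j) + k) \<circ> p))"
    proof (rule sum.cong [OF refl])
      fix j
      have "(e \<circ> p)(j := e (p j) + k) = e(p j := e (p j) + k) \<circ> p"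
        using permutes_inj [OF p] by (auto simp: fun_eq_iff inj_eq)
      then show "xmon n ((e \<circ> p)(j := e (p j) + k)) = xmon n (e(p j := e (p j) + k) \<circ> p)" by simp
    qed
    also have "\<dots> = (\<Sum>i<n. xmon n (e(i := e i + k) \<circ> p))"
      by (rule sum.reindex_bij_betw [OF permutes_imp_bij [OF p]])
    finally show ?thesis .
  qed
  then have "\<forall>p\<in>{p. p permutes {..<n}}. (\<Sum>i<n. var i ^ k) * xmon n (e \<circ> p) =
      ((\<Sum>i<n. xmon n (e(i := e i + k) \<circ> p)) :: 'a mpol)" by blast
  then have "(\<Sum>i<n. var i ^ k) * (alt n e :: 'a mpol) =
      (\<Sum>p | p permutes {..<n}. \<Sum>i<n. of_int (sign p) * xmon n (e(i := e i + k) \<circ> p))"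
    by (simp add: alt_def sum_distrib_left [of _ _ "{p. p permutes {..<n}}"] mult.left_commute [of "\<Sum>i<n. var i ^ k"]
        sum_distrib_left [of "of_int (sign _)", symmetric])
  also have "\<dots> = (\<Sum>i<n. alt n (add_at e i k))"
    by (subst sum.swap) (simp add: alt_def add_at_def)
  finally show ?thesis .
qed


lemma antisymmetric_swap:
  assumes g: "antisymmetric n g" and "i < n" "j < n" "i \<noteq> j"
  shows "g (e(i := y, j := x)) = - g (e(i := x, j := y))"
proof -
  have "e(i := y, j := x) = e(i := x, j := y) \<circ> transpose i j"
    using assms(4) by (auto simp: fun_eq_iff transpose_def)
  then show ?thesis by (simp only: antisymmetricD(2) [OF assms])
qed

text \<open>Write h x y for the value with x at i and y at j. The sum of h over all x + y = e i + e
  j vanishes by exchanging the two places; its term x = e i is g e, and the remaining terms are the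
  two sums on the left.\<close>

lemma antisymmetric_pair:
  fixes g :: "_ \<Rightarrow> 'b::{comm_ring_1,ring_char_0,semiring_no_zero_divisors}"
  assumes g: "antisymmetric n g" and ij: "i < n" "j < n" "i \<noteq> j"
  shows "(\<Sum>k=1..e j. g (e(i := e i + k, j := e j - k))) +
    (\<Sum>k=1..e i. g (e(i := e i - k, j := e j + k))) = - g e"
proof -
  define h where "h x y = g (e(i := x, j := y))" for x y
  define a b where "a = e i" and "b = e j"
  have h: "h y x = - h x y" for x y
    unfolding h_def by (rule antisymmetric_swap [OF g ij])
  define f where "f x = h x (a + b - x)" for x
  define S where "S = (\<Sum>x\<le>a + b. f x)"
  have "S = (\<Sum>x\<le>a + b. f (a + b - x))"
    unfolding S_def by (rule sum.reindex_bij_witness [of _ "\<lambda>x. a + b - x" "\<lambda>x. a + b - x"]) auto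
  also have "\<dots> = (\<Sum>x\<le>a + b. - f x)"
    by (rule sum.cong) (auto simp: f_def h [of "a + b - _"])
  also have "\<dots> = - S" by (simp add: S_def sum_negf)
  finally have S: "S = 0" by (simp add: eq_neg_iff_add_eq_0 flip: mult_2)
  have "{..a + b} = {..<a} \<union> insert a {a + 1..a + b}" by auto
  then have "S = (\<Sum>x<a. f x) + (f a + (\<Sum>x=a + 1..a + b. f x))"
    unfolding S_def by (simp only:) (subst sum.union_disjoint, auto)
  also have "(\<Sum>x<a. f x) = (\<Sum>k=1..a. h (a - k) (b + k))"
    by (rule sum.reindex_bij_witness [of _ "\<lambda>k. a - k" "\<lambda>k. a - k"]) (auto simp: f_def add.commute)
  also have "(\<Sum>x=a + 1..a + b. f x) = (\<Sum>k=1..b. h (a + k) (b - k))"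
    by (rule sum.reindex_bij_witness [of _ "\<lambda>k. a + k" "\<lambda>k. k - a"]) (auto simp: f_def add.commute)
  also have "f a = g e" by (simp add: f_def h_def a_def b_def)
  finally show ?thesis
    unfolding S h_def a_def b_def by (simp add: algebra_simps eq_neg_iff_add_eq_0)
qed

text \<open>Moving \<open>k\<close> from the \<open>j\<close>-th exponent to the \<open>i\<close>-th one: for \<open>i \<noteq> j\<close> the contributions
  of the pair \<open>{i, j}\<close> cancel against those with the two values exchanged, except for \<open>- g e\<close>.\<close>

lemma antisymmetric_Euler:
  fixes g :: "_ \<Rightarrow> 'b::{comm_ring_1,ring_char_0,semiring_no_zero_divisors}"
  assumes g: "antisymmetric n g"
  shows "2 * (\<Sum>j<n. \<Sum>k=1..e j. \<Sum>i<n. g (add_at (sub_at e j k) i k)) =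
    of_int (2 * (\<Sum>j<n. int (e j)) - int n * (int n - 1)) * g e"
proof -
  define T where "T i j = (\<Sum>k=1..e j. g (e(i := e i + k, j := e j - k)))" for i j
  have T: "T i j + T j i = - g e" if "i < n" "j < n" "i \<noteq> j" for i j
    using antisymmetric_pair [OF g that, of e] that by (simp add: T_def fun_upd_twist)
  have inner: "(\<Sum>k=1..e j. \<Sum>i<n. g (add_at (sub_at e j k) i k)) =
      of_nat (e j) * g e + (\<Sum>i\<in>{..<n} - {j}. T i j)" if "j < n" for j
  proof -
    have "(\<Sum>k=1..e j. \<Sum>i<n. g (add_at (sub_at e j k) i k)) =
      (\<Sum>k=1..e j. g e + (\<Sum>i\<in>{..<n} - {j}. g (e(i := e i + k, j := e j - k))))"
      using that by (intro sum.cong refl, subst sum.remove [of _ j])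
        (auto simp: add_at_def sub_at_def fun_upd_twist intro!: sum.cong)
    also have "\<dots> = of_nat (e j) * g e + (\<Sum>k=1..e j. \<Sum>i\<in>{..<n} - {j}. g (e(i := e i + k, j := e j - k)))"
      by (simp add: sum.distrib)
    also have "(\<Sum>k=1..e j. \<Sum>i\<in>{..<n} - {j}. g (e(i := e i + k, j := e j - k))) = (\<Sum>i\<in>{..<n} - {j}. T i j)"
      unfolding T_def by (rule sum.swap)
    finally show ?thesis .
  qed
  \<comment> \<open>The off-diagonal part. Each of the n (n - 1) ordered pairs contributes - g e to
    2 D, while the terms with i = j merely restore \<open>e\<close> and give e j times g e.\<close>
  define D where "D = (\<Sum>j<n. \<Sum>i\<in>{..<n} - {j}. T i j)"
  have swap: "(\<Sum>j<n. \<Sum>i\<in>{..<n} - {j}. T j i) = D"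
  proof -
    have un: "(\<Sum>i\<in>{..<n} - {j}. f i) = (\<Sum>i<n. if i = j then 0 else f i)" for f :: "nat \<Rightarrow> 'b" and j
      by (rule sum.mono_neutral_cong_left) auto
    have "(\<Sum>j<n. \<Sum>i\<in>{..<n} - {j}. T j i) = (\<Sum>i<n. \<Sum>j<n. if i = j then 0 else T j i)"
      unfolding un by (rule sum.swap)
    also have "\<dots> = D"
      unfolding D_def un by (intro sum.cong) auto
    finally show ?thesis .
  qed
  have "2 * D = (\<Sum>j<n. \<Sum>i\<in>{..<n} - {j}. T i j + T j i)"
    by (simp add: sum.distrib swap) (simp add: D_def)
  also have "\<dots> = (\<Sum>j<n. \<Sum>i\<in>{..<n} - {j}. - g e)"
    by (intro sum.cong refl T) auto
  also have "\<dots> = - (of_nat n * of_nat (n - 1) * g e)"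
    by (cases n) (simp_all add: mult.assoc sum_negf)
  also have "(of_nat n * of_nat (n - 1) :: 'b) = of_int (int n * (int n - 1))"
    by (cases n) auto
  finally have D: "2 * D = - (of_int (int n * (int n - 1)) * g e)" .
  have "(\<Sum>j<n. \<Sum>k=1..e j. \<Sum>i<n. g (add_at (sub_at e j k) i k)) =
      (\<Sum>j<n. of_nat (e j)) * g e + D"
    by (subst sum.cong [OF refl inner]) (simp_all add: sum.distrib D_def sum_distrib_right)
  then show ?thesis
    using D by (simp add: algebra_simps)
qed

section \<open>Sorting exponents\<close>

definition strict_dec :: "nat \<Rightarrow> (nat \<Rightarrow> nat) \<Rightarrow> bool" where
  "strict_dec n e \<longleftrightarrow> (\<forall>i j. i < j \<and> j < n \<longrightarrow> e j < e i)"

text \<open>The number of larger values is the rank of an index. For injective \<open>e\<close> the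
  ranks form a permutation, and its inverse sorts.\<close>

lemma sort_exponents:
  fixes e :: "nat \<Rightarrow> nat"
  assumes inj: "inj_on e {..<n}"
  shows "\<exists>q. q permutes {..<n} \<and> strict_dec n (e \<circ> q)"
proof -
  define U where "U i = {j. j < n \<and> e i < e j}" for i
  define r where "r i = (if i < n then card (U i) else i)" for i
  have fin: "finite (U i)" for i by (simp add: U_def)
  have less: "card (U b) < card (U a)" if "a < n" "b < n" "e a < e b" for a b
    by (rule psubset_card_mono [OF fin]) (use that in \<open>auto simp: U_def\<close>)
  have "r i < n" if "i < n" for i
  proof -
    have "card (U i) < card {..<n}"
      by (rule psubset_card_mono) (use that in \<open>auto simp: U_def\<close>)
    then show ?thesis using that by (simp add: r_def)
  qed
  moreover have "inj_on r {..<n}"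
  proof (rule inj_onI)
    fix a b assume "a \<in> {..<n}" "b \<in> {..<n}" "r a = r b"
    then show "a = b"
      using less [of a b] less [of b a] inj_onD [OF inj, of a b]
      by (cases "e a" "e b" rule: linorder_cases) (auto simp: r_def)
  qed
  ultimately have "bij_betw r {..<n} {..<n}"
    by (intro bij_betw_imageI endo_inj_surj) auto
  then have r: "r permutes {..<n}"
    by (rule bij_imp_permutes) (simp add: r_def)
  define q where "q = inv_into UNIV r"
  have q: "q permutes {..<n}" unfolding q_def by (rule permutes_inv [OF r])
  have "e (q j) < e (q i)" if "i < j" "j < n" for i j
  proof -
    have lt: "q i < n" "q j < n" using q that by (auto dest: permutes_in_image [of _ _ i] permutes_in_image [of _ _ j])
    have "r (q i) = i" "r (q j) = j"
      unfolding q_def by (rule permutes_inverses [OF r])+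
    then have "card (U (q i)) < card (U (q j))"
      using that lt by (simp add: r_def)
    moreover have "card (U (q j)) \<le> card (U (q i))" if "e (q i) \<le> e (q j)"
      by (rule card_mono [OF fin]) (use that in \<open>auto simp: U_def\<close>)
    ultimately show ?thesis by linarith
  qed
  then show ?thesis using q by (auto simp: strict_dec_def)
qed

text \<open>The last value is at least 0 and each step to the left adds at least 1; the induction
  runs over the distance m from the last index.\<close>

lemma strict_dec_ge_delta:
  assumes "strict_dec n e" "j < n"
  shows "delta n j \<le> e j"
proof -
  have "\<forall>j. n = Suc (j + m) \<longrightarrow> m \<le> e j" for m
  proof (induction m)
    case (Suc m)
    show ?case
    proof (intro allI impI)
      fix j assume n: "n = Suc (j + Suc m)"
      then have "m \<le> e (Suc j)" using Suc by simp
      also have "e (Suc j) < e j" using assms(1) n by (simp add: strict_dec_def)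
      finally show "Suc m \<le> e j" by simp
    qed
  qed simp
  from this [of "delta n j"] show ?thesis using assms(2) by (simp add: delta_def)
qed

text \<open>\<open>is_partition\<close> admits no zero entries, whereas exponents below n come with
  trailing empty rows that have to be dropped.\<close>

definition strip :: "nat \<Rightarrow> (nat \<Rightarrow> nat) \<Rightarrow> nat list" where
  "strip n v = filter (\<lambda>x. 0 < x) (map v [0..<n])"

definition antitone_below :: "nat \<Rightarrow> (nat \<Rightarrow> nat) \<Rightarrow> bool" where
  "antitone_below n v \<longleftrightarrow> (\<forall>i j. i \<le> j \<and> j < n \<longrightarrow> v j \<le> v i)"

lemma strip_eq:
  assumes "antitone_below n v"
  shows "\<exists>m\<le>n. strip n v = map v [0..<m] \<and> (\<forall>j<m. 0 < v j) \<and> (\<forall>j. m \<le> j \<and> j < n \<longrightarrow> v j = 0)"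
  using assms
proof (induction n)
  case (Suc n)
  then have "antitone_below n v" by (simp add: antitone_below_def)
  then obtain m where m: "m \<le> n" "strip n v = map v [0..<m]" "\<forall>j<m. 0 < v j"
    "\<forall>j. m \<le> j \<and> j < n \<longrightarrow> v j = 0" using Suc.IH by blast
  show ?case
  proof (cases "v n = 0")
    case True
    have "strip (Suc n) v = strip n v" using True by (simp add: strip_def)
    moreover have "v j = 0" if "m \<le> j" "j < Suc n" for j
      using that m(4) True by (cases "j = n") auto
    ultimately show ?thesis using m by (intro exI [of _ m]) simp
  next
    case False
    have "m = n"
    proof (rule ccontr)
      assume "m \<noteq> n"
      then have "v m = 0" using m by simp
      moreover have "v n \<le> v m" using Suc.prems m(1) by (simp add: antitone_below_def)
      ultimately show False using False by simp
    qed
    moreover have "strip (Suc n) v = strip n v @ [v n]" using False by (simp add: strip_def)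
    ultimately show ?thesis using m(2,3) False
      by (intro exI [of _ "Suc n"]) (auto simp: less_Suc_eq)
  qed
qed (simp add: strip_def)

lemma strip_props:
  assumes v: "antitone_below n v"
  shows "is_partition (strip n v)" "length (strip n v) \<le> n"
    "j < n \<Longrightarrow> part (strip n v) j = v j" "psize (strip n v) = (\<Sum>j<n. v j)"
proof -
  obtain m where m: "m \<le> n" "strip n v = map v [0..<m]" "\<forall>j<m. 0 < v j"
    "\<forall>j. m \<le> j \<and> j < n \<longrightarrow> v j = 0" using strip_eq [OF v] by blast
  show "is_partition (strip n v)"
    using m v by (auto simp: is_partition_def sorted_wrt_iff_nth_less antitone_below_def)
  show "length (strip n v) \<le> n" using m by simp
  show "part (strip n v) j = v j" if "j < n" using that m by (auto simp: part_def)
  have "psize (strip n v) = (\<Sum>j<m. v j)"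
    by (simp add: m interv_sum_list_conv_sum_set_nat atLeast0LessThan)
  also have "\<dots> = (\<Sum>j<n. v j)"
    using m by (intro sum.mono_neutral_left) auto
  finally show "psize (strip n v) = (\<Sum>j<n. v j)" .
qed

text \<open>The positions of n beads on the abacus of \<open>la\<close>, one for each row, empty
  rows included.\<close>

definition beta :: "nat \<Rightarrow> nat list \<Rightarrow> nat \<Rightarrow> nat" where
  "beta n la j = part la j + delta n j"

lemma alternant_eq: "alternant n la = alt n (beta n la)"
  by (simp add: alternant_eq_alt beta_def [abs_def])

lemma part_antitone: "is_partition la \<Longrightarrow> i \<le> j \<Longrightarrow> part la j \<le> part la i"
  by (cases "i = j") (auto simp: is_partition_def part_def sorted_wrt_iff_nth_less)

lemma strict_dec_beta: "is_partition la \<Longrightarrow> strict_dec n (beta n la)"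
  unfolding strict_dec_def beta_def delta_def
  by (intro allI impI add_le_less_mono part_antitone) auto

lemma psize_eq_sum_part: "length la \<le> n \<Longrightarrow> psize la = (\<Sum>j<n. part la j)"
proof -
  assume "length la \<le> n"
  then have "(\<Sum>j<n. part la j) = (\<Sum>j<length la. part la j)"
    by (intro sum.mono_neutral_right) (auto simp: part_def)
  then show ?thesis by (simp add: part_def sum_list_sum_nth atLeast0LessThan)
qed

lemma sum_delta: "2 * (\<Sum>j<n. delta n j) = n * (n - 1)"
proof -
  have "(\<Sum>j<n. delta n j) = (\<Sum>j<n. j)"
    unfolding delta_def by (rule sum.reindex_bij_witness [of _ "\<lambda>k. n - 1 - k" "\<lambda>k. n - 1 - k"]) auto
  also have "2 * \<dots> = n * (n - 1)"
  proof (induction n)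
    case (Suc n)
    then show ?case by (cases n) auto
  qed simp
  finally show ?thesis .
qed

lemma length_le_psize: "is_partition la \<Longrightarrow> length la \<le> psize la"
proof (induction la)
  case (Cons a la)
  then show ?case by (auto simp: is_partition_def)
qed simp

text \<open>Subtracting the staircase inverts \<open>beta n\<close>: neighbouring staircase values
  differ by 1, so strictly decreasing exponents become weakly decreasing rows.\<close>

lemma strict_dec_partition:
  assumes e: "strict_dec n e"
  defines "la \<equiv> strip n (\<lambda>j. e j - delta n j)"
  shows "is_partition la" "length la \<le> n" "\<And>j. j < n \<Longrightarrow> e j = beta n la j"
    "(\<Sum>j<n. e j) = psize la + (\<Sum>j<n. delta n j)"
proof -
  have adj: "e (Suc i) - delta n (Suc i) \<le> e i - delta n i" if "Suc i < n" for i
  proof -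
    have "e (Suc i) < e i" using e that by (auto simp: strict_dec_def)
    then show ?thesis using that by (simp add: delta_def)
  qed
  have "antitone_below n (\<lambda>j. e j - delta n j)"
    unfolding antitone_below_def
  proof (intro allI impI)
    fix i j assume "i \<le> j \<and> j < n"
    then have "i \<le> j" "j < n" by auto
    then show "e j - delta n j \<le> e i - delta n i"
    proof (induction j rule: dec_induct)
      case (step m)
      then show ?case using adj [of m] by linarith
    qed simp
  qed
  note s = strip_props [OF this, folded la_def]
  show "is_partition la" "length la \<le> n" using s by auto
  show e_eq: "e j = beta n la j" if "j < n" for j
    using s(3) [OF that] strict_dec_ge_delta [OF e that] by (simp add: beta_def)
  have "(\<Sum>j<n. e j) = (\<Sum>j<n. part la j + delta n j)"
    by (intro sum.cong) (auto simp: e_eq beta_def)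
  then show "(\<Sum>j<n. e j) = psize la + (\<Sum>j<n. delta n j)"
    using s(2) by (simp add: sum.distrib psize_eq_sum_part [of la n])
qed


section \<open>Algebraic independence of the power sums\<close>

lemma lookup_single_mult_add:
  fixes P :: "'a::comm_ring_1 mpol"
  shows "lookup (single a c * P) (a + m) = c * lookup P m"
proof -
  have "single a c * P = (\<Sum>k\<in>keys P. single (a + k) (c * lookup P k))"
    by (subst (1) sum_single_lookup [of P, symmetric]) (simp add: sum_distrib_left mult_single)
  then show ?thesis
    by (auto simp: lookup_sum lookup_single when_def in_keys_iff)
qed

lemma lookup_single_mult_0:
  fixes P :: "'a::comm_ring_1 mpol"
  assumes m: "\<And>k. m \<noteq> a + k"
  shows "lookup (single a c * P) m = 0"
proof -
  have "single a c * P = (\<Sum>k\<in>keys P. single (a + k) (c * lookup P k))"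
    by (subst (1) sum_single_lookup [of P, symmetric]) (simp add: sum_distrib_left mult_single)
  then show ?thesis
    by (simp add: lookup_sum lookup_single when_def not_sym [OF m])
qed

lemma lookup_var_mult:
  "lookup (var j * P) m = (if lookup m j = 0 then 0 else lookup P (m - single j 1))"
proof (cases "lookup m j = 0")
  case True
  then have "m \<noteq> single j 1 + k" for k by (metis add_is_0 lookup_add lookup_single_eq one_neq_zero)
  then show ?thesis using True by (simp add: var_def lookup_single_mult_0)
next
  case False
  then have "m = single j 1 + (m - single j 1)" by (intro exponent_split) (simp add: in_keys_iff)
  then show ?thesis using False lookup_single_mult_add [of "single j 1" 1 P "m - single j 1"]
    by (simp add: var_def)
qed

text \<open>The formal partial derivative by the variable with index i, used both for p_(i+1) and
  for x_i. The truncated subtraction in the exponent is harmless: it truncates only where the factor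
  \<open>lookup m i\<close> is 0.\<close>

definition pd :: "nat \<Rightarrow> 'a::comm_ring_1 mpol \<Rightarrow> 'a mpol" where
  "pd i P = (\<Sum>m\<in>keys P. single (m - single i 1) (of_nat (lookup m i) * lookup P m))"

lemma lookup_pd: "lookup (pd i P) m = of_nat (Suc (lookup m i)) * lookup P (single i 1 + m)"
proof -
  have "lookup (pd i P) m =
      (\<Sum>k\<in>keys P. if k = single i 1 + m then of_nat (lookup k i) * lookup P k else 0)"
    unfolding pd_def lookup_sum
  proof (rule sum.cong [OF refl])
    fix k assume "k \<in> keys P"
    show "lookup (single (k - single i 1) (of_nat (lookup k i) * lookup P k)) m =
        (if k = single i 1 + m then of_nat (lookup k i) * lookup P k else 0)"
    proof (cases "lookup k i = 0")
      case True
      then have "k \<noteq> single i 1 + m" by (metis add_is_0 lookup_add lookup_single_eq one_neq_zero)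
      then show ?thesis using True by simp
    next
      case False
      then have "k = single i 1 + (k - single i 1)" by (intro exponent_split) (simp add: in_keys_iff)
      then have "k - single i 1 = m \<longleftrightarrow> k = single i 1 + m" by (metis add_left_cancel)
      then show ?thesis by (simp add: lookup_single when_def)
    qed
  qed
  then show ?thesis by (simp add: lookup_add in_keys_iff)
qed

lemma pd_add: "pd i (P + Q) = pd i P + pd i Q"
  by (rule poly_mapping_eqI) (simp add: lookup_pd lookup_add algebra_simps)

lemma pd_const: "pd i (const c) = 0"
proof (rule poly_mapping_eqI)
  fix m :: "nat \<Rightarrow>\<^sub>0 nat"
  have "single i 1 + m \<noteq> 0" by (metis add_is_0 lookup_add lookup_single_eq lookup_zero one_neq_zero)
  then show "lookup (pd i (const c)) m = lookup 0 m"
    by (simp add: lookup_pd const_def lookup_single when_def)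
qed

lemma pd_const_mult: "pd i (const c * P) = const c * pd i P"
  by (rule poly_mapping_eqI) (simp only: lookup_pd lookup_const_mult mult.left_commute)

lemma pd_var_mult: "pd i (var j * P) = (if i = j then P else 0) + var j * pd i P"
proof (rule poly_mapping_eqI)
  fix m :: "nat \<Rightarrow>\<^sub>0 nat"
  consider "i = j" "lookup m j = 0" | "i = j" "lookup m j \<noteq> 0" | "i \<noteq> j" "lookup m j = 0" | "i \<noteq> j" "lookup m j \<noteq> 0"
    by blast
  then show "lookup (pd i (var j * P)) m = lookup ((if i = j then P else 0) + var j * pd i P) m"
  proof cases
    case 1
    then show ?thesis by (simp add: lookup_pd lookup_add lookup_var_mult)
  next
    case 2
    have "m = single j 1 + (m - single j 1)"
      by (rule exponent_split) (use 2 in \<open>simp add: in_keys_iff\<close>)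
    then have "lookup P (single j 1 + (m - single j 1)) = lookup P m" by simp
    then show ?thesis using 2
      by (simp add: lookup_pd lookup_add lookup_var_mult lookup_minus distrib_right)
  next
    case 3
    then show ?thesis by (simp add: lookup_pd lookup_add lookup_var_mult lookup_single when_def)
  next
    case 4
    then have "single i 1 + m - single j 1 = single i 1 + (m - single j 1)"
      by (intro poly_mapping_eqI) (auto simp: lookup_add lookup_minus lookup_single when_def)
    then show ?thesis using 4
      by (simp add: lookup_pd lookup_add lookup_var_mult lookup_single lookup_minus when_def)
  qed
qed

lemma pd_mult: "pd i (P * Q) = pd i P * Q + P * pd i Q"
proof (induction P rule: mpol_induct)
  case (var j p)
  have "pd i (var j * p * Q) = (if i = j then p * Q else 0) + var j * pd i (p * Q)"
    by (simp only: mult.assoc pd_var_mult)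
  also have "\<dots> = pd i (var j * p) * Q + var j * p * pd i Q"
    unfolding var pd_var_mult by (simp add: algebra_simps)
  finally show ?case .
qed (simp_all only: pd_const pd_const_mult pd_add distrib_right mult_zero_left add_0 add_ac)

lemma pd_sum: "pd i (sum f A) = (\<Sum>x\<in>A. pd i (f x))"
  using pd_const [of i 0] by (induction A rule: infinite_finite_induct) (simp_all add: pd_add)

lemma pd_var_power:
  "pd i (var j ^ Suc k) = (if i = j then of_nat (Suc k) * var j ^ k else 0 :: 'a::comm_ring_1 mpol)"
proof (induction k)
  case 0
  have "pd i 1 = (0 :: 'a mpol)" using pd_const [of i 1] by simp
  then show ?case using pd_var_mult [of i j "1 :: 'a mpol"] by simp
next
  case (Suc k)
  have "pd i (var j ^ Suc (Suc k)) = (if i = j then var j ^ Suc k else 0) + var j * pd i (var j ^ Suc k :: 'a mpol)"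
    unfolding power_Suc [of _ "Suc k"] by (rule pd_var_mult)
  also have "\<dots> = (if i = j then of_nat (Suc (Suc k)) * var j ^ Suc k else 0)"
    unfolding Suc by (cases "i = j") (simp_all add: algebra_simps)
  finally show ?case .
qed

lemma expand_var: "expand n (var j) = (\<Sum>i<n. var i ^ Suc j)"
  using expand_psum [of "Suc j" n] by (simp add: psum_def)

text \<open>The chain rule, with dp_(k+1)/dx_i = (k + 1) x_i ^ k. Stating it for every sufficiently
  large K lets polynomials be combined without tracking which power sums occur in them.\<close>

lemma pd_expand:
  assumes "i < n"
  shows "\<exists>K0. \<forall>K\<ge>K0. pd i (expand n P) =
    (\<Sum>k<K. of_nat (Suc k) * var i ^ k * expand n (pd k P))"
proof (induction P rule: mpol_induct)
  case (const c)
  then show ?case by (auto simp: pd_const is_hom_simps [OF is_hom_expand])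
next
  case (add p q)
  then obtain K1 K2 where "\<forall>K\<ge>K1. pd i (expand n p) = (\<Sum>k<K. of_nat (Suc k) * var i ^ k * expand n (pd k p))"
    "\<forall>K\<ge>K2. pd i (expand n q) = (\<Sum>k<K. of_nat (Suc k) * var i ^ k * expand n (pd k q))" by blast
  then show ?case
    by (intro exI [of _ "max K1 K2"])
      (auto simp: pd_add is_hom_simps [OF is_hom_expand] distrib_left sum.distrib simp del: of_nat_Suc)
next
  case (var j p)
  then obtain K1 where K1: "\<forall>K\<ge>K1. pd i (expand n p) =
    (\<Sum>k<K. of_nat (Suc k) * var i ^ k * expand n (pd k p))" by blast
  have "pd i (expand n (var j * p)) =
      (\<Sum>k<K. of_nat (Suc k) * var i ^ k * expand n (pd k (var j * p)))" if "K \<ge> max K1 (Suc j)" for K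
  proof -
    have 1: "pd i (expand n (var j)) = of_nat (Suc j) * var i ^ j"
      using assms by (simp add: expand_var pd_sum pd_var_power del: of_nat_Suc power_Suc)
    have "(\<Sum>k<K. of_nat (Suc k) * var i ^ k * expand n (pd k (var j * p))) =
        (\<Sum>k<K. (if k = j then of_nat (Suc j) * var i ^ j * expand n p else 0) +
          expand n (var j) * (of_nat (Suc k) * var i ^ k * expand n (pd k p)))"
      unfolding pd_var_mult is_hom_simps [OF is_hom_expand]
      by (rule sum.cong) (simp_all add: is_hom_simps [OF is_hom_expand] algebra_simps del: of_nat_Suc)
    also have "\<dots> = of_nat (Suc j) * var i ^ j * expand n p + expand n (var j) * pd i (expand n p)"
      using that K1 by (auto simp: sum.distrib simp del: of_nat_Suc simp flip: sum_distrib_left)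
    also have "\<dots> = pd i (expand n (var j * p))"
      by (simp add: is_hom_simps [OF is_hom_expand] pd_mult 1 del: of_nat_Suc)
    finally show ?thesis by simp
  qed
  then show ?case by blast
qed

lemma inj_var: "inj (var :: nat \<Rightarrow> 'a::comm_ring_1 mpol)"
proof (rule injI)
  fix i j assume "var i = (var j :: 'a mpol)"
  then have "lookup (var i :: 'a mpol) (single i 1) = lookup (var j :: 'a mpol) (single i 1)" by simp
  then have "single i (1::nat) = single j 1"
    by (simp add: var_def lookup_single when_def split: if_splits)
  then have "lookup (single i (1::nat)) i = lookup (single j 1) i" by simp
  then show "i = j" by (simp add: lookup_single when_def split: if_splits)
qed

text \<open>The Jacobian criterion: the equations \<open>\<Sum>k. k x\<^sub>i ^ (k - 1) (\<partial>P / \<partial>p\<^sub>k) = 0\<close> form a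
  Vandermonde system for the partial derivatives of \<open>P\<close>.\<close>

lemma expand_inj:
  assumes "graded {..d} P" "d \<le> n" "expand n P = 0"
  shows "P = 0"
  using assms
proof (induction d arbitrary: P rule: less_induct)
  case (less d)
  \<comment> \<open>Differentiating by p_(k+1) lowers the weight by k + 1, so the induction
    hypothesis applies to the derivatives, and only those with k < d can be nonzero.\<close>
  have wt: "wt m + k < d" if "m \<in> keys (pd k P)" for m k
  proof -
    from that have "single k 1 + m \<in> keys P"
      unfolding in_keys_iff lookup_pd by (metis mult_zero_right)
    then have "wt (single k 1 + m) \<le> d" using less.prems(1) by (auto simp: graded_def)
    then show ?thesis by simp
  qed
  have large: "pd k P = 0" if "d \<le> k" for k
  proof -
    have "m \<notin> keys (pd k P)" for m using wt [of m k] that by auto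
    then show ?thesis by (intro poly_mapping_eqI) (simp add: in_keys_iff)
  qed
  \<comment> \<open>A univariate polynomial over the ring in the x_i, whose value at x_i is the
    derivative of \<open>expand n P\<close> by x_i. It has n distinct roots but degree below d, and
    d is at most n, so it is zero. Counting roots stands in for inverting the Vandermonde
    matrix.\<close>
  define p where "p = (\<Sum>k<d. monom (of_nat (Suc k) * expand n (pd k P)) k)"
  have root: "poly p (var i) = 0" if i: "i < n" for i
  proof -
    obtain K where K: "\<forall>K'\<ge>K. pd i (expand n P) =
      (\<Sum>k<K'. of_nat (Suc k) * var i ^ k * expand n (pd k P))" using pd_expand [OF i] by blast
    have "poly p (var i) = (\<Sum>k<d. of_nat (Suc k) * var i ^ k * expand n (pd k P))"
      by (simp add: p_def poly_sum poly_monom mult_ac)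
    also have "\<dots> = (\<Sum>k<max K d. of_nat (Suc k) * var i ^ k * expand n (pd k P))"
      by (rule sum.mono_neutral_left) (auto simp: large is_hom_simps [OF is_hom_expand])
    also have "\<dots> = pd i (expand n P)" by (rule K [rule_format, symmetric]) simp
    also have "\<dots> = 0" using less.prems pd_const [of i 0] by simp
    finally show ?thesis .
  qed
  have deg: "coeff p k = (if k < d then of_nat (Suc k) * expand n (pd k P) else 0)" for k
    by (auto simp: p_def coeff_sum simp del: of_nat_Suc)
  have "p = 0"
  proof (rule ccontr)
    assume "p \<noteq> 0"
    have "n = card (var ` {..<n} :: rat poly mpol set)"
      by (subst card_image) (auto intro: inj_on_subset [OF inj_var])
    also have "\<dots> \<le> card {x. poly p x = 0}"
      using root by (intro card_mono poly_roots_finite \<open>p \<noteq> 0\<close>) auto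
    also have "\<dots> \<le> degree p" by (rule card_poly_roots_bound [OF \<open>p \<noteq> 0\<close>])
    also have "degree p < d"
    proof (cases "d = 0")
      case True
      then show ?thesis using \<open>p \<noteq> 0\<close> by (simp add: p_def)
    next
      case False
      then have "degree p \<le> d - 1" by (intro degree_le) (auto simp: deg)
      then show ?thesis using False by simp
    qed
    finally show False using less.prems by simp
  qed
  have pd0: "pd k P = 0" for k
  proof (cases "k < d")
    case True
    have "of_nat (Suc k) * expand n (pd k P) = 0"
      using deg [of k] True \<open>p = 0\<close> by (simp del: of_nat_Suc)
    then have "expand n (pd k P) = 0" by (simp del: of_nat_Suc)
    moreover have "graded {..d - 1} (pd k P)" unfolding graded_def
    proof
      fix m assume "m \<in> keys (pd k P)"
      then show "wt m \<in> {..d - 1}" using wt [of m k] by simp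
    qed
    ultimately show ?thesis
      using True less.prems(2) by - (rule less.IH [of "d - 1" "pd k P"], simp_all)
  qed (simp add: large)
  \<comment> \<open>In characteristic 0 a polynomial whose derivatives all vanish is constant, and
    \<open>expand\<close> maps constants to themselves.\<close>
  have "lookup P m = 0" if "m \<noteq> 0" for m
  proof -
    from that obtain i where i: "i \<in> keys m" by (metis keys_eq_empty all_not_in_conv)
    have "of_nat (Suc (lookup (m - single i 1) i)) * lookup P (single i 1 + (m - single i 1)) = 0"
      using pd0 [of i] lookup_pd [of i P "m - single i 1"] by simp
    then have "lookup P (single i 1 + (m - single i 1)) = 0" by (simp del: of_nat_Suc)
    then show ?thesis by (simp only: exponent_split [OF i, symmetric])
  qed
  then have P: "P = const (lookup P 0)"
    by (intro poly_mapping_eqI) (simp add: const_def lookup_single when_def)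
  then have "const (lookup P 0) = (0 :: rat poly mpol)"
    using less.prems(3) expand_const [of n "lookup P 0"] by (simp flip: P)
  then have "lookup P 0 = 0" unfolding const_def by (metis lookup_single_eq lookup_zero)
  then show "P = 0" by (subst P) simp
qed


section \<open>Schur functions\<close>

text \<open>Passes from l to n variables without changing the vector v = e - delta l: empty rows are
  appended and the longer staircase is added back.\<close>

definition pad :: "nat \<Rightarrow> nat \<Rightarrow> (nat \<Rightarrow> nat) \<Rightarrow> nat \<Rightarrow> nat" where
  "pad l n e j = (if j < l then e j + (n - l) else delta n j)"

lemma alt_repeat:
  assumes "i < n" "j < n" "i \<noteq> j" "e i = e j"
  shows "alt n e = (0 :: rat poly mpol)"
  by (rule antisymmetric_repeat [OF antisymmetric_alt assms])

text \<open>Both sides are 2 |v|, which does not see the appended empty rows. The doubling avoids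
  halving the staircase sum; integers are needed because |v| may be negative.\<close>

lemma sum_pad:
  assumes "l \<le> n"
  shows "2 * (\<Sum>j<n. int (pad l n e j)) - int n * (int n - 1) =
    2 * (\<Sum>j<l. int (e j)) - int l * (int l - 1)"
proof -
  have "(\<Sum>j\<in>{..<l} \<union> {l..<n}. int (pad l n e j)) =
      (\<Sum>j<l. int (pad l n e j)) + (\<Sum>j=l..<n. int (pad l n e j))"
    by (rule sum.union_disjoint) auto
  also have "{..<l} \<union> {l..<n} = {..<n}" using assms by auto
  also have "(\<Sum>j<l. int (pad l n e j)) = (\<Sum>j<l. int (e j)) + int l * (int n - int l)"
    using assms by (simp add: pad_def sum.distrib sum_subtractf of_nat_diff algebra_simps)
  also have "(\<Sum>j=l..<n. int (pad l n e j)) = (\<Sum>j<n - l. int (delta (n - l) j))"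
    by (rule sum.reindex_bij_witness [of _ "\<lambda>j. j + l" "\<lambda>j. j - l"]) (use assms in \<open>auto simp: pad_def delta_def\<close>)
  finally have "2 * (\<Sum>j<n. int (pad l n e j)) =
      2 * (\<Sum>j<l. int (e j)) + 2 * int l * (int n - int l) + 2 * (\<Sum>j<n - l. int (delta (n - l) j))"
    by (simp add: algebra_simps)
  also have "2 * (\<Sum>j<n - l. int (delta (n - l) j)) = int (n - l) * (int (n - l) - 1)"
    using arg_cong [OF sum_delta [of "n - l"], of int] by (cases "n - l") (auto simp: algebra_simps)
  finally show ?thesis
    using assms by (simp add: of_nat_diff algebra_simps)
qed

text \<open>A bead lowered from within the padding, or from one of the first l places to a position
  below n - l, lands on an occupied position of the padding, and the alternant vanishes.\<close>

lemma alt_pad_sub: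
  assumes l: "l \<le> n" and j: "j < n" and k: "1 \<le> k" "k \<le> pad l n e j"
  shows "alt n (sub_at (pad l n e) j k) =
    (if j < l \<and> k \<le> e j then alt n (pad l n (sub_at e j k)) else (0 :: rat poly mpol))"
proof (cases "j < l \<and> k \<le> e j")
  case True
  then show ?thesis
    by (auto intro!: alt_cong simp: sub_at_def pad_def)
next
  case False
  \<comment> \<open>The padding bead that is hit: position x < n - l is held by index n - 1 - x, and
    lowering index j of the padding by k leads to index j + k.\<close>
  define j' where "j' = (if j < l then n - 1 - (e j + (n - l) - k) else j + k)"
  have "alt n (sub_at (pad l n e) j k) = (0 :: rat poly mpol)"
    by (rule alt_repeat [of j n j'])
      (use False assms in \<open>auto simp: j'_def sub_at_def pad_def delta_def split: if_splits\<close>)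
  then show ?thesis using False by auto
qed

text \<open>Euler's relation \<open>|v| s\<^sub>v = \<Sum>k. p\<^sub>k \<Sum>j. s\<^bsub>v - k e_j\<^esub>\<close> for \<open>s\<^sub>v\<close> with \<open>v\<close> an arbitrary
  integer vector defines \<open>s\<^sub>v\<close> by recursion on \<open>|v|\<close>; here \<open>v = e - delta l\<close>.\<close>

lemma schur_exists_exponent:
  "\<exists>S::sym. graded {d. 2 * d + l * (l - 1) = 2 * (\<Sum>j<l. e j)} S \<and>
    (\<forall>n\<ge>l. expand n S * alt n (delta n) = alt n (pad l n e))"
proof (induction "\<Sum>j<l. e j" arbitrary: e rule: less_induct)
  case less
  show ?case
  proof (cases "inj_on e {..<l}")
    \<comment> \<open>Repeated exponents make every padded alternant zero. This covers all cases
      with |v| negative, where the set of admissible degrees is empty.\<close>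
    case False
    then obtain i j where "i < l" "j < l" "i \<noteq> j" "e i = e j" by (auto simp: inj_on_def)
    then have "alt n (pad l n e) = (0 :: rat poly mpol)" if "n \<ge> l" for n
      using that by (intro alt_repeat [of i n j]) (auto simp: pad_def)
    then show ?thesis by (intro exI [of _ 0]) (simp add: is_hom_simps [OF is_hom_expand])
  next
    case True
    then obtain q where q: "q permutes {..<l}" and dec: "strict_dec l (e \<circ> q)"
      using sort_exponents by blast
    have sum_q: "(\<Sum>j<l. e (q j)) = (\<Sum>j<l. e j)"
      by (rule sum.reindex_bij_betw [OF permutes_imp_bij [OF q]])
    show ?thesis
    proof (cases "\<forall>j<l. e (q j) = delta l j")
      \<comment> \<open>Sorting leads to the empty partition, so S is the sign of the sorting
        permutation.\<close>
      case delta: True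
      have "expand n (const (of_int (sign q))) * alt n (delta n) = (alt n (pad l n e) :: rat poly mpol)"
        if n: "n \<ge> l" for n
      proof -
        have qn: "q permutes {..<n}" by (rule permutes_subset [OF q]) (use n in auto)
        have "alt n (delta n) = (alt n (pad l n e \<circ> q) :: rat poly mpol)"
        proof (rule alt_cong)
          fix j assume "j < n"
          show "delta n j = (pad l n e \<circ> q) j"
          proof (cases "j < l")
            case True
            then have "q j < l" using permutes_in_image [OF q, of j] by simp
            then show ?thesis using delta [rule_format, OF True] True n by (simp add: pad_def delta_def)
          next
            case False
            then have "q j = j" using q by (simp add: permutes_not_in)
            then show ?thesis using False by (simp add: pad_def)
          qed
        qed
        also have "\<dots> = of_int (sign q) * alt n (pad l n e)" by (rule alt_permute [OF qn])
        finally have "alt n (delta n) = of_int (sign q) * (alt n (pad l n e) :: rat poly mpol)" .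
        moreover have "const (of_int (sign q)) = (of_int (sign q) :: rat poly mpol)"
          by (simp add: const_def)
        moreover have "of_int (sign q) * of_int (sign q) = (1 :: rat poly mpol)"
          by (simp add: sign_idempotent flip: of_int_mult)
        ultimately show ?thesis
          unfolding expand_const by (simp only: mult.assoc [symmetric] mult_1)
      qed
      moreover have "2 * (\<Sum>j<l. e j) = l * (l - 1)"
        using sum_delta [of l] delta sum_q by simp
      ultimately show ?thesis
        by (intro exI [of _ "const (of_int (sign q))"]) (auto intro: graded_mono [OF graded_const])
    next
      case False
      then obtain j0 where j0: "j0 < l" "e (q j0) \<noteq> delta l j0" by blast
      \<comment> \<open>W is 2 |v|. It is positive because the sorted exponents dominate the
        staircase and differ from it, so Euler's relation can be divided by it.\<close>
      define W where "W = 2 * (\<Sum>j<l. int (e j)) - int l * (int l - 1)"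
      have "(\<Sum>j<l. delta l j) < (\<Sum>j<l. e (q j))"
        using j0 strict_dec_ge_delta [OF dec] by (intro sum_strict_mono_ex1) force+
      then have "l * (l - 1) < 2 * (\<Sum>j<l. e j)"
        using sum_delta [of l] sum_q by linarith
      then have "int (l * (l - 1)) < 2 * (\<Sum>j<l. int (e j))"
        by (metis of_nat_less_iff of_nat_mult of_nat_numeral of_nat_sum)
      then have W: "W > 0" unfolding W_def by (cases l) (auto simp: algebra_simps)
      have IH: "\<exists>S::sym. graded {d. 2 * d + l * (l - 1) = 2 * (\<Sum>i<l. sub_at e j k i)} S \<and>
          (\<forall>n\<ge>l. expand n S * alt n (delta n) = alt n (pad l n (sub_at e j k)))"
        and sum_sub: "(\<Sum>i<l. sub_at e j k i) + k = (\<Sum>i<l. e i)"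
        if "j < l" "1 \<le> k" "k \<le> e j" for j k
      proof -
        show sum: "(\<Sum>i<l. sub_at e j k i) + k = (\<Sum>i<l. e i)"
          using that by (subst (1 2) sum.remove [of _ j]) (auto simp: sub_at_def)
        show "\<exists>S::sym. graded {d. 2 * d + l * (l - 1) = 2 * (\<Sum>i<l. sub_at e j k i)} S \<and>
          (\<forall>n\<ge>l. expand n S * alt n (delta n) = alt n (pad l n (sub_at e j k)))"
          by (rule less.hyps) (use sum that in linarith)
      qed
      then have "\<forall>j k. \<exists>S::sym. j < l \<and> 1 \<le> k \<and> k \<le> e j \<longrightarrow>
          graded {d. 2 * d + l * (l - 1) = 2 * (\<Sum>i<l. sub_at e j k i)} S \<and>
          (\<forall>n\<ge>l. expand n S * alt n (delta n) = alt n (pad l n (sub_at e j k)))" by blast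
      then obtain F :: "nat \<Rightarrow> nat \<Rightarrow> sym" where F: "\<And>j k. j < l \<Longrightarrow> 1 \<le> k \<Longrightarrow> k \<le> e j \<Longrightarrow>
          graded {d. 2 * d + l * (l - 1) = 2 * (\<Sum>i<l. sub_at e j k i)} (F j k)"
        "\<And>j k n. j < l \<Longrightarrow> 1 \<le> k \<Longrightarrow> k \<le> e j \<Longrightarrow> n \<ge> l \<Longrightarrow>
          expand n (F j k) * alt n (delta n) = alt n (pad l n (sub_at e j k))"
        by metis
      define S0 where "S0 = (\<Sum>j<l. \<Sum>k=1..e j. psum k * F j k)"
      define S where "S = const [:2 / of_int W:] * S0"
      have "graded {d. 2 * d + l * (l - 1) = 2 * (\<Sum>j<l. e j)} S"
        unfolding S_def S0_def
      proof (intro graded_const_mult graded_sum)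
        fix j k assume jk: "j \<in> {..<l}" "k \<in> {1..e j}"
        show "graded {d. 2 * d + l * (l - 1) = 2 * (\<Sum>j<l. e j)} (psum k * F j k)"
          by (rule graded_mult [OF graded_psum F(1)]) (use jk sum_sub [of j k] in auto)
      qed
      moreover have "expand n S * alt n (delta n) = alt n (pad l n e)" if n: "n \<ge> l" for n
      proof -
        define E where "E = pad l n e"
        have "2 * (\<Sum>j<n. \<Sum>k=1..E j. \<Sum>i<n. alt n (add_at (sub_at E j k) i k)) =
            of_int W * (alt n E :: rat poly mpol)"
        proof -
          have "antisymmetric n (alt n :: _ \<Rightarrow> rat poly mpol)" by (rule antisymmetric_alt)
          from antisymmetric_Euler [OF this, of E] show ?thesis
            by (simp only: E_def sum_pad [OF n] W_def)
        qed
        \<comment> \<open>Raising by k, summed over all places, is multiplication by p_k. Then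
          \<open>alt_pad_sub\<close> confines the lowering to the first l places, where the
          induction hypothesis supplies \<open>F\<close>.\<close>
        also have "(\<Sum>j<n. \<Sum>k=1..E j. \<Sum>i<n. alt n (add_at (sub_at E j k) i k)) =
            (\<Sum>j<n. \<Sum>k=1..E j. (\<Sum>i<n. var i ^ k) * (alt n (sub_at E j k) :: rat poly mpol))"
          by (simp add: psum_mult_alt)
        also have "\<dots> = (\<Sum>j<n. \<Sum>k=1..E j. if j < l \<and> k \<le> e j
            then (\<Sum>i<n. var i ^ k) * alt n (pad l n (sub_at e j k)) else 0)"
        proof (intro sum.cong refl)
          fix j k assume "j \<in> {..<n}" "k \<in> {1..E j}"
          then have "alt n (sub_at E j k) =
              (if j < l \<and> k \<le> e j then alt n (pad l n (sub_at e j k)) else (0 :: rat poly mpol))"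
            using alt_pad_sub [OF n, of j k e] by (simp add: E_def)
          then show "(\<Sum>i<n. var i ^ k) * alt n (sub_at E j k) = (if j < l \<and> k \<le> e j
            then (\<Sum>i<n. var i ^ k) * alt n (pad l n (sub_at e j k)) else (0 :: rat poly mpol))" by simp
        qed
        also have "\<dots> = (\<Sum>j<l. \<Sum>k=1..E j. if k \<le> e j
            then (\<Sum>i<n. var i ^ k) * alt n (pad l n (sub_at e j k)) else 0)"
          by (rule sum.mono_neutral_cong_right) (use n in \<open>auto intro!: sum.neutral sum.cong\<close>)
        also have "\<dots> = (\<Sum>j<l. \<Sum>k=1..e j. (\<Sum>i<n. var i ^ k) * alt n (pad l n (sub_at e j k)))"
          by (intro sum.cong refl sum.mono_neutral_cong_right) (use n in \<open>auto simp: E_def pad_def\<close>)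
        also have "\<dots> = (\<Sum>j<l. \<Sum>k=1..e j. expand n (psum k) * (expand n (F j k) * alt n (delta n)))"
          by (intro sum.cong refl) (use n in \<open>simp add: F expand_psum\<close>)
        also have "\<dots> = expand n S0 * alt n (delta n)"
          by (simp add: S0_def is_hom_sum [OF is_hom_expand] is_hom_simps [OF is_hom_expand] sum_distrib_right mult.assoc)
        finally have eq: "2 * (expand n S0 * alt n (delta n)) = of_int W * (alt n E :: rat poly mpol)" .
        have c2: "const [:2 / of_int W:] = const [:1 / of_int W:] * (2 :: rat poly mpol)"
        proof -
          have "(2 :: rat poly mpol) = const [:2:]"
            using const_of_nat [of 2, where 'a = "rat poly"] by (simp add: numeral_poly)
          then show ?thesis by (simp only: const_mult [symmetric]) simp
        qed
        have cW: "const [:1 / of_int W:] * of_int W = (1 :: rat poly mpol)"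
          using W by (simp add: const_def mult_single of_int_poly flip: single_of_int one_pCons)
        have "expand n S * alt n (delta n) = const [:1 / of_int W:] * (2 * (expand n S0 * alt n (delta n)))"
          by (simp only: S_def is_hom_simps [OF is_hom_expand] expand_const) (simp only: c2 mult.assoc)
        also have "\<dots> = alt n E"
          unfolding eq by (simp add: mult.assoc [symmetric] cW)
        finally show ?thesis by (simp add: E_def)
      qed
      ultimately show ?thesis by blast
    qed
  qed
qed


section \<open>Coefficients of alternants and uniqueness of Schur functions\<close>

lemma lookup_alt:
  "lookup (alt n f :: 'a::comm_ring_1 mpol) (expo n e) =
    (\<Sum>p | p permutes {..<n}. if \<forall>i<n. f (p i) = e i then of_int (sign p) else 0)"
proof -
  have "lookup (of_int (sign p) * xmon n (f \<circ> p) :: 'a mpol) (expo n e) =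
      (if \<forall>i<n. f (p i) = e i then of_int (sign p) else 0)" for p
  proof -
    have "of_int (sign p) * xmon n (f \<circ> p) = (single (expo n (f \<circ> p)) (of_int (sign p)) :: 'a mpol)"
      by (simp add: xmon_eq_single sign_def single_uminus)
    then show ?thesis by (simp add: lookup_single when_def expo_eq_iff)
  qed
  then show ?thesis by (simp add: alt_def lookup_sum)
qed

text \<open>Two decreasing sequences force p to be increasing, and an increasing permutation of an
  initial segment is the identity. Hence an alternant with decreasing exponents contains only one
  monomial with decreasing exponents.\<close>

lemma strict_dec_permutation:
  assumes f: "strict_dec n f" and e: "strict_dec n e" and p: "p permutes {..<n}"
    and eq: "\<And>i. i < n \<Longrightarrow> f (p i) = e i"
  shows "p = id"
proof -
  have lt: "p i < n" if "i < n" for i using permutes_in_image [OF p, of i] that by simp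
  have mono: "p i < p j" if "i < j" "j < n" for i j
  proof (rule ccontr)
    assume "\<not> p i < p j"
    then have "f (p i) \<le> f (p j)"
      using f lt [of i] that by (cases "p i = p j") (auto simp: strict_dec_def less_imp_le)
    moreover have "e j < e i" using e that by (simp add: strict_dec_def)
    ultimately show False using eq [of i] eq [of j] that by simp
  qed
  have "i \<le> p i" if "i < n" for i
    using that
  proof (induction i)
    case (Suc i)
    then have "i \<le> p i" by simp
    also have "p i < p (Suc i)" using mono Suc.prems by simp
    finally show ?case by simp
  qed simp
  then show ?thesis by (intro permutes_natset_ge [OF p]) auto
qed

lemma lookup_alt_strict_dec:
  assumes f: "strict_dec n f" and e: "strict_dec n e"
  shows "lookup (alt n f :: 'a::comm_ring_1 mpol) (expo n e) = (if \<forall>i<n. f i = e i then 1 else 0)"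
proof -
  have "(if \<forall>i<n. f (p i) = e i then of_int (sign p) else 0) =
      (if p = id then if \<forall>i<n. f i = e i then 1 else 0 else (0 :: 'a))"
    if "p permutes {..<n}" for p
    using strict_dec_permutation [OF f e that] by auto
  then have "lookup (alt n f :: 'a mpol) (expo n e) =
      (\<Sum>p | p permutes {..<n}. if p = id then if \<forall>i<n. f i = e i then 1 else 0 else 0)"
    unfolding lookup_alt by (intro sum.cong) auto
  then show ?thesis by (simp add: finite_permutations permutes_id)
qed

lemma strict_dec_delta: "strict_dec n (delta n)"
  by (auto simp: strict_dec_def delta_def)

lemma alt_delta_nonzero: "alt n (delta n) \<noteq> (0 :: 'a::comm_ring_1 mpol)"
proof
  assume "alt n (delta n) = (0 :: 'a mpol)"
  then have "lookup (alt n (delta n) :: 'a mpol) (expo n (delta n)) = 0" by simp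
  then show False by (simp add: lookup_alt_strict_dec strict_dec_delta)
qed

lemma beta_inj:
  assumes "is_partition la" "is_partition mu" "length la \<le> n" "length mu \<le> n"
    and eq: "\<And>i. i < n \<Longrightarrow> beta n la i = beta n mu i"
  shows "la = mu"
proof -
  have part: "part la i = part mu i" if "i < n" for i using eq [OF that] by (simp add: beta_def)
  have pos: "part nu i > 0" if "is_partition nu" "i < length nu" for nu i
    using that by (metis is_partition_def nth_mem not_gr0 part_def)
  have "length la = length mu"
  proof (cases "length la" "length mu" rule: linorder_cases)
    case less
    then show ?thesis using part [of "length la"] pos [of mu "length la"] assms by (simp add: part_def)
  next
    case greater
    then show ?thesis using part [of "length mu"] pos [of la "length mu"] assms by (simp add: part_def)
  qed
  moreover have "la ! i = mu ! i" if "i < length la" for i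
    using part [of i] that calculation assms(3) by (simp add: part_def)
  ultimately show ?thesis by (rule nth_equalityI)
qed

lemma lookup_alternant:
  assumes "is_partition la" "is_partition mu" "length la \<le> n" "length mu \<le> n"
  shows "lookup (alternant n la) (expo n (beta n mu)) = (if la = mu then 1 else 0)"
  using beta_inj [OF assms] assms
  by (auto simp: alternant_eq lookup_alt_strict_dec strict_dec_beta)

text \<open>Existence is the recursion above, started with the exponents of \<open>la\<close> in
  exactly \<open>length la\<close> variables. For uniqueness, two candidates differ by an element of
  bounded degree; in enough variables the Vandermonde determinant cancels and
  \<open>expand_inj\<close> applies.\<close>

lemma schur_ex1:
  assumes la: "is_partition la"
  shows "\<exists>!s. \<forall>n\<ge>length la. expand n s * alternant n [] = alternant n la"
    and "\<exists>s. graded {psize la} s \<and> (\<forall>n\<ge>length la. expand n s * alternant n [] = alternant n la)"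
proof -
  let ?l = "length la"
  have eq: "alt n (pad ?l n (beta ?l la)) = alternant n la" if "n \<ge> ?l" for n
    unfolding alternant_eq using that
    by (intro alt_cong) (auto simp: pad_def beta_def delta_def part_def)
  have "2 * d + ?l * (?l - 1) = 2 * (\<Sum>j<?l. beta ?l la j) \<longleftrightarrow> d = psize la" for d
    using sum_delta [of ?l] psize_eq_sum_part [of la ?l] by (simp add: beta_def sum.distrib)
  then show ex: "\<exists>s. graded {psize la} s \<and> (\<forall>n\<ge>?l. expand n s * alternant n [] = alternant n la)"
    using schur_exists_exponent [of ?l "beta ?l la"] eq by (simp add: alternant_Nil)
  have "s = s'" if s: "\<forall>n\<ge>?l. expand n s * alternant n [] = alternant n la"
    and s': "\<forall>n\<ge>?l. expand n s' * alternant n [] = alternant n la" for s s'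
  proof -
    obtain d where d: "graded {..d} (s - s')" using graded_exists by blast
    define n where "n = max d ?l"
    have "(expand n s - expand n s') * alternant n [] = 0"
      using s s' by (simp add: n_def left_diff_distrib)
    then have "expand n (s - s') = 0"
      by (simp add: alternant_Nil is_hom_diff [OF is_hom_expand] alt_delta_nonzero)
    then have "s - s' = 0" by (rule expand_inj [OF d, rotated]) (simp add: n_def)
    then show ?thesis by simp
  qed
  then show "\<exists>!s. \<forall>n\<ge>?l. expand n s * alternant n [] = alternant n la"
    using ex by blast
qed

lemma expand_schur:
  assumes "is_partition la" "n \<ge> length la"
  shows "expand n (schur la) * alt n (delta n) = alternant n la"
  using theI' [OF schur_ex1(1) [OF assms(1)]] assms(2) by (simp add: schur_def alternant_Nil)

lemma graded_schur:
  assumes "is_partition la"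
  shows "graded {psize la} (schur la)"
proof -
  obtain s where s: "graded {psize la} s"
    "\<forall>n\<ge>length la. expand n s * alternant n [] = alternant n la" using schur_ex1(2) [OF assms] by blast
  then have "schur la = s" unfolding schur_def by (intro the1_equality schur_ex1(1) assms)
  then show ?thesis using s by simp
qed

section \<open>Schur functions span every degree\<close>

definition Par :: "nat \<Rightarrow> nat list set" where
  "Par d = {la. is_partition la \<and> psize la = d}"

lemma finite_Par: "finite (Par d)"
proof (rule finite_subset)
  show "Par d \<subseteq> {xs. set xs \<subseteq> {..d} \<and> length xs \<le> d}"
    using length_le_psize member_le_sum_list by (fastforce simp: Par_def)
qed (rule finite_lists_length_le, simp)

text \<open>An invariant for induction on monomials in the power sums: times the Vandermonde
  determinant they stay in a span of alternants, d being the degree in excess of the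
  staircase.\<close>

definition aspan :: "nat \<Rightarrow> nat \<Rightarrow> rat poly mpol \<Rightarrow> bool" where
  "aspan n d Q \<longleftrightarrow> (\<exists>c. Q = (\<Sum>la\<in>Par d. const (c la) * alternant n la))"

lemma aspan_0: "aspan n d 0"
  unfolding aspan_def by (rule exI [of _ "\<lambda>_. 0"]) simp

lemma aspan_add: "aspan n d P \<Longrightarrow> aspan n d Q \<Longrightarrow> aspan n d (P + Q)"
  unfolding aspan_def
proof (elim exE)
  fix c c' assume "P = (\<Sum>la\<in>Par d. const (c la) * alternant n la)" "Q = (\<Sum>la\<in>Par d. const (c' la) * alternant n la)"
  then show "\<exists>c. P + Q = (\<Sum>la\<in>Par d. const (c la) * alternant n la)"
    by (intro exI [of _ "\<lambda>la. c la + c' la"]) (simp add: const_add distrib_right sum.distrib)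
qed

lemma aspan_const_mult: "aspan n d P \<Longrightarrow> aspan n d (const a * P)"
  unfolding aspan_def
proof (elim exE)
  fix c assume "P = (\<Sum>la\<in>Par d. const (c la) * alternant n la)"
  then show "\<exists>c. const a * P = (\<Sum>la\<in>Par d. const (c la) * alternant n la)"
    by (intro exI [of _ "\<lambda>la. a * c la"]) (simp add: const_mult sum_distrib_left mult.assoc)
qed

lemma aspan_sum: "(\<And>x. x \<in> A \<Longrightarrow> aspan n d (f x)) \<Longrightarrow> aspan n d (sum f A)"
  by (induction A rule: infinite_finite_induct) (auto intro: aspan_0 aspan_add)

lemma aspan_alternant: "la \<in> Par d \<Longrightarrow> aspan n d (alternant n la)"
  unfolding aspan_def
proof (intro exI)
  assume "la \<in> Par d"
  then show "alternant n la = (\<Sum>mu\<in>Par d. const (if mu = la then 1 else 0) * alternant n mu)"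
    by (simp add: if_distrib if_distribR finite_Par cong: if_cong)
qed

text \<open>Sorting gives the alternant of a partition up to sign; if two exponents coincide, the
  alternant is 0.\<close>

lemma aspan_alt:
  assumes "(\<Sum>j<n. e j) = d + (\<Sum>j<n. delta n j)"
  shows "aspan n d (alt n e)"
proof (cases "inj_on e {..<n}")
  case False
  then obtain i j where "i < n" "j < n" "i \<noteq> j" "e i = e j" by (auto simp: inj_on_def)
  then show ?thesis by (simp add: alt_repeat aspan_0)
next
  case True
  then obtain q where q: "q permutes {..<n}" and dec: "strict_dec n (e \<circ> q)"
    using sort_exponents by blast
  note la = strict_dec_partition [OF dec]
  define la where "la = strip n (\<lambda>j. (e \<circ> q) j - delta n j)"
  have "(\<Sum>j<n. (e \<circ> q) j) = (\<Sum>j<n. e j)"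
    unfolding comp_def by (rule sum.reindex_bij_betw [OF permutes_imp_bij [OF q]])
  then have "la \<in> Par d" using la(1,4) assms by (simp add: Par_def la_def)
  have "alternant n la = alt n (e \<circ> q)"
    unfolding alternant_eq by (rule alt_cong) (simp only: la_def la(3) [symmetric])
  also have "\<dots> = of_int (sign q) * alt n e" by (rule alt_permute [OF q])
  finally have "of_int (sign q) * alternant n la = of_int (sign q * sign q) * alt n e"
    by (simp only: of_int_mult mult.assoc)
  then have "alt n e = const (of_int (sign q)) * alternant n la"
    by (simp only: sign_idempotent const_def single_of_int of_int_1 mult_1)
  then show ?thesis using \<open>la \<in> Par d\<close> by (simp add: aspan_const_mult aspan_alternant)
qed

lemma sum_add_at: "j < n \<Longrightarrow> (\<Sum>i<n. add_at e j k i) = (\<Sum>i<n. e i) + k"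
  by (subst (1 2) sum.remove [of _ j]) (auto simp: add_at_def)

lemma sum_beta: "length la \<le> n \<Longrightarrow> (\<Sum>j<n. beta n la j) = psize la + (\<Sum>j<n. delta n j)"
  by (simp add: beta_def sum.distrib psize_eq_sum_part)

lemma aspan_psum_mult:
  assumes "aspan n d Q" "d \<le> n" "k \<ge> 1"
  shows "aspan n (d + k) (expand n (psum k) * Q)"
proof -
  obtain c where Q: "Q = (\<Sum>la\<in>Par d. const (c la) * alternant n la)" using assms(1) by (auto simp: aspan_def)
  have "aspan n (d + k) (expand n (psum k) * alternant n la)" if "la \<in> Par d" for la
  proof -
    have len: "length la \<le> n" and sz: "psize la = d"
      using that length_le_psize [of la] assms(2) by (auto simp: Par_def)
    have "expand n (psum k) * alternant n la = (\<Sum>i<n. alt n (add_at (beta n la) i k))"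
      using assms(3) by (simp add: expand_psum alternant_eq psum_mult_alt)
    then show ?thesis
      by (simp only:) (intro aspan_sum aspan_alt, simp add: sum_add_at sum_beta [OF len] sz)
  qed
  then have "aspan n (d + k) (const (c la) * (expand n (psum k) * alternant n la))" if "la \<in> Par d" for la
    using that by (intro aspan_const_mult)
  then show ?thesis
    unfolding Q sum_distrib_left by (intro aspan_sum) (simp add: mult.left_commute)
qed

lemma aspan_single:
  assumes "wt m \<le> n"
  shows "aspan n (wt m) (expand n (single m 1) * alt n (delta n))"
  using assms
proof (induction m rule: exponent_induct)
  case zero
  have "aspan n 0 (alternant n [])"
    by (rule aspan_alternant) (simp add: Par_def is_partition_def)
  then show ?case by (simp add: alternant_Nil is_hom_simps [OF is_hom_expand])
next
  case (add i m)
  have "single (single i 1 + m) 1 = psum (Suc i) * (single m 1 :: sym)"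
    by (simp add: psum_def var_def mult_single)
  moreover have "aspan n (wt m + Suc i) (expand n (psum (Suc i)) * (expand n (single m 1) * alt n (delta n)))"
    using add by (intro aspan_psum_mult) auto
  ultimately show ?case
    by (simp add: is_hom_simps [OF is_hom_expand] mult.assoc add.commute)
qed

text \<open>In exactly d variables every partition of d fits and \<open>expand d\<close> is
  injective up to degree d. So it is enough to write P times the Vandermonde determinant as a
  combination of alternants and to compare.\<close>

lemma schur_span_hom:
  assumes P: "graded {d} P"
  shows "\<exists>c. P = (\<Sum>la\<in>Par d. const (c la) * schur la)"
proof -
  have "aspan d d (expand d P * alt d (delta d))"
  proof -
    have "expand d P * alt d (delta d) =
        (\<Sum>m\<in>keys P. const (lookup P m) * (expand d (single m 1) * alt d (delta d)))"
      by (subst (1) sum_single_lookup [of P, symmetric], subst single_eq_const_mult)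
        (simp add: is_hom_sum [OF is_hom_expand] is_hom_simps [OF is_hom_expand] sum_distrib_right mult.assoc)
    also have "aspan d d \<dots>"
    proof (intro aspan_sum aspan_const_mult)
      fix m assume "m \<in> keys P"
      then have "wt m = d" using P by (auto simp: graded_def)
      then show "aspan d d (expand d (single m 1) * alt d (delta d))" using aspan_single [of m d] by simp
    qed
    finally show ?thesis .
  qed
  then obtain c where c: "expand d P * alt d (delta d) = (\<Sum>la\<in>Par d. const (c la) * alternant d la)"
    by (auto simp: aspan_def)
  define P' where "P' = (\<Sum>la\<in>Par d. const (c la) * schur la)"
  have "expand d P' * alt d (delta d) = (\<Sum>la\<in>Par d. const (c la) * (expand d (schur la) * alt d (delta d)))"
    by (simp add: P'_def is_hom_sum [OF is_hom_expand] is_hom_simps [OF is_hom_expand] sum_distrib_right mult.assoc)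
  also have "\<dots> = (\<Sum>la\<in>Par d. const (c la) * alternant d la)"
    using length_le_psize by (intro sum.cong refl) (auto simp: Par_def expand_schur)
  finally have "(expand d P - expand d P') * alt d (delta d) = 0" using c by (simp add: left_diff_distrib)
  then have "expand d (P - P') = 0" by (simp add: is_hom_diff [OF is_hom_expand] alt_delta_nonzero)
  moreover have "graded {d} P'"
    unfolding P'_def by (intro graded_sum graded_const_mult) (use graded_schur in \<open>auto simp: Par_def\<close>)
  then have "graded {..d} (P - P')"
    by (intro graded_mono [OF graded_diff [OF P]]) auto
  ultimately have "P - P' = 0" using expand_inj [of d "P - P'" d] by blast
  then show ?thesis unfolding P'_def by auto
qed

section \<open>Coefficients in the Schur basis\<close>

definition comb :: "(nat list \<Rightarrow>\<^sub>0 rat poly) \<Rightarrow> sym" where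
  "comb c = (\<Sum>la\<in>keys c. const (lookup c la) * schur la)"

lemma comb_superset: "finite S \<Longrightarrow> keys c \<subseteq> S \<Longrightarrow> comb c = (\<Sum>la\<in>S. const (lookup c la) * schur la)"
  unfolding comb_def by (rule sum.mono_neutral_left) (auto simp: in_keys_iff)

lemma comb_add: "comb (c + c') = comb c + comb c'"
proof -
  let ?S = "keys c \<union> keys c'"
  have "comb (c + c') = (\<Sum>la\<in>?S. const (lookup (c + c') la) * schur la)"
    by (rule comb_superset) (use keys_add [of c c'] in auto)
  also have "\<dots> = (\<Sum>la\<in>?S. const (lookup c la) * schur la) + (\<Sum>la\<in>?S. const (lookup c' la) * schur la)"
    by (simp add: lookup_add const_add distrib_right sum.distrib)
  also have "\<dots> = comb c + comb c'" by (subst (1 2) comb_superset [of ?S]) auto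
  finally show ?thesis .
qed

lemma comb_diff: "comb (c - c') = comb c - comb c'"
  using comb_add [of "c - c'" c'] by simp

lemma comb_0 [simp]: "comb 0 = 0"
  by (simp add: comb_def)

lemma comb_single [simp]: "comb (single la a) = const a * schur la"
  by (simp add: comb_def in_keys_iff)

definition supported :: "nat set \<Rightarrow> (nat list \<Rightarrow>\<^sub>0 rat poly) \<Rightarrow> bool" where
  "supported A c \<longleftrightarrow> (\<forall>la\<in>keys c. is_partition la \<and> psize la \<in> A)"

lemma supported_add: "supported A c \<Longrightarrow> supported A c' \<Longrightarrow> supported A (c + c')"
  using keys_add [of c c'] by (auto simp: supported_def)

lemma supported_diff: "supported A c \<Longrightarrow> supported A c' \<Longrightarrow> supported A (c - c')"
  using keys_diff by (fastforce simp: supported_def)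

lemma schur_span:
  assumes "graded A P"
  shows "\<exists>c. supported A c \<and> P = comb c"
proof -
  have sum: "\<exists>c. supported A c \<and> (\<Sum>x\<in>S. f x) = comb c"
    if "finite S" "\<And>x. x \<in> S \<Longrightarrow> \<exists>c. supported A c \<and> f x = comb c" for S and f :: "'b \<Rightarrow> sym"
    using that
  proof (induction S rule: finite_induct)
    case empty
    then show ?case by (intro exI [of _ 0]) (simp add: supported_def)
  next
    case (insert x S)
    then obtain c c' where "supported A c" "f x = comb c" "supported A c'" "(\<Sum>x\<in>S. f x) = comb c'" by blast
    then show ?case using insert by (intro exI [of _ "c + c'"]) (simp add: comb_add supported_add)
  qed
  have "\<exists>c. supported A c \<and> (\<Sum>m\<in>keys P. single m (lookup P m)) = comb c"
  proof (rule sum)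
    fix m assume "m \<in> keys P"
    then have wt: "wt m \<in> A" using assms by (simp add: graded_def)
    obtain c where c: "single m (lookup P m) = (\<Sum>la\<in>Par (wt m). const (c la) * schur la)"
      using schur_span_hom [of "wt m" "single m (lookup P m)"] by (auto simp: graded_single)
    have "\<exists>c'. supported A c' \<and> (\<Sum>la\<in>Par (wt m). const (c la) * schur la) = comb c'"
    proof (rule sum [OF finite_Par])
      fix la assume "la \<in> Par (wt m)"
      then show "\<exists>c'. supported A c' \<and> const (c la) * schur la = comb c'"
        using wt by (intro exI [of _ "single la (c la)"]) (auto simp: supported_def Par_def in_keys_iff lookup_single when_def)
    qed
    then show "\<exists>c. supported A c \<and> single m (lookup P m) = comb c" using c by simp
  qed simp
  then show ?thesis by (simp add: sum_single_lookup)
qed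

text \<open>Among the alternants that occur, only that of \<open>mu\<close> contains the monomial
  with exponents \<open>beta n mu\<close>.\<close>

lemma lookup_expand_comb:
  assumes c: "supported A c" and mu: "is_partition mu" "length mu \<le> n"
    and len: "\<And>la. la \<in> keys c \<Longrightarrow> length la \<le> n"
  shows "lookup (expand n (comb c) * alt n (delta n)) (expo n (beta n mu)) = lookup c mu"
proof -
  have "expand n (comb c) * alt n (delta n) = (\<Sum>la\<in>keys c. const (lookup c la) * (expand n (schur la) * alt n (delta n)))"
    by (simp add: comb_def is_hom_sum [OF is_hom_expand] is_hom_simps [OF is_hom_expand] sum_distrib_right mult.assoc)
  also have "\<dots> = (\<Sum>la\<in>keys c. const (lookup c la) * alternant n la)"
    using c len by (intro sum.cong refl) (simp add: supported_def expand_schur)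
  also have "lookup \<dots> (expo n (beta n mu)) = (\<Sum>la\<in>keys c. if la = mu then lookup c la else 0)"
    unfolding lookup_sum lookup_const_mult
    using c mu len by (intro sum.cong refl) (auto simp: supported_def lookup_alternant)
  also have "\<dots> = lookup c mu" by (simp add: in_keys_iff)
  finally show ?thesis .
qed

lemma comb_inj:
  assumes "supported A c" "comb c = 0"
  shows "c = 0"
proof (rule poly_mapping_eqI)
  fix mu
  show "lookup c mu = lookup 0 mu"
  proof (cases "mu \<in> keys c")
    case True
    define n where "n = Max (length ` keys c)"
    have len: "length la \<le> n" if "la \<in> keys c" for la
      using that by (simp add: n_def)
    have "lookup (expand n (comb c) * alt n (delta n)) (expo n (beta n mu)) = lookup c mu"
      using True assms(1) len by (intro lookup_expand_comb [OF assms(1)]) (auto simp: supported_def)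
    then show ?thesis using assms(2) by (simp add: is_hom_simps [OF is_hom_expand])
  qed (simp add: in_keys_iff)
qed

lemma expansion_comb:
  assumes "supported A c"
  shows "expansion schur (comb c) = c"
  unfolding expansion_def
proof (rule the_equality)
  show "(\<forall>la\<in>keys c. is_partition la) \<and> comb c = (\<Sum>la\<in>keys c. const (lookup c la) * schur la)"
    using assms by (simp add: supported_def comb_def)
next
  fix c' assume c': "(\<forall>la\<in>keys c'. is_partition la) \<and> comb c = (\<Sum>la\<in>keys c'. const (lookup c' la) * schur la)"
  have "supported UNIV (c' - c)"
    by (rule supported_diff) (use c' assms in \<open>auto simp: supported_def\<close>)
  moreover have "comb c' = comb c" using c' by (simp add: comb_def)
  then have "comb (c' - c) = 0" by (simp add: comb_diff)
  ultimately have "c' - c = 0" by (rule comb_inj)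
  then show "c' = c" by simp
qed

lemma expansion_schur:
  assumes "graded A P"
  shows "supported A (expansion schur P)" "comb (expansion schur P) = P"
  using schur_span [OF assms] expansion_comb by force+

lemma coefficient_graded:
  assumes "graded A P" "coefficient schur la P \<noteq> 0"
  shows "is_partition la" "psize la \<in> A"
  using expansion_schur(1) [OF assms(1)] assms(2)
  by (auto simp: supported_def coefficient_def in_keys_iff)

lemma graded_UNIV [simp]: "graded UNIV P"
  by (simp add: graded_def)

lemma coefficient_add: "coefficient schur la (P + Q) = coefficient schur la P + coefficient schur la Q"
proof -
  have "expansion schur (comb (expansion schur P + expansion schur Q)) = expansion schur P + expansion schur Q"
    by (intro expansion_comb supported_add expansion_schur(1)) (rule graded_UNIV)+
  then show ?thesis
    by (simp add: comb_add expansion_schur(2) [OF graded_UNIV] coefficient_def lookup_add)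
qed

lemma coefficient_0 [simp]: "coefficient schur la 0 = 0"
  using expansion_comb [of UNIV 0] by (simp add: supported_def coefficient_def)

lemma coefficient_sum: "coefficient schur la (sum f A) = (\<Sum>x\<in>A. coefficient schur la (f x))"
  by (induction A rule: infinite_finite_induct) (simp_all add: coefficient_add)

lemma coefficient_schur: "is_partition mu \<Longrightarrow> coefficient schur la (schur mu) = (if la = mu then 1 else 0)"
  using expansion_comb [of UNIV "single mu 1"] by (simp add: supported_def coefficient_def lookup_single when_def)

lemma coefficient_const_mult: "coefficient schur la (const a * P) = a * coefficient schur la P"
proof -
  let ?c = "expansion schur P"
  have *: "coefficient schur la (const b * schur mu) = b * coefficient schur la (schur mu)"
    if "is_partition mu" for b mu
    using expansion_comb [of UNIV "single mu b"] that
    by (simp add: coefficient_schur) (simp add: supported_def coefficient_def lookup_single when_def in_keys_iff)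
  have "coefficient schur la (const a * comb ?c) = (\<Sum>mu\<in>keys ?c. coefficient schur la (const (a * lookup ?c mu) * schur mu))"
    by (simp add: comb_def sum_distrib_left coefficient_sum const_mult mult.assoc)
  also have "\<dots> = (\<Sum>mu\<in>keys ?c. a * coefficient schur la (const (lookup ?c mu) * schur mu))"
    using expansion_schur(1) [OF graded_UNIV, of P]
    by (intro sum.cong refl) (simp add: * supported_def mult.assoc)
  also have "\<dots> = a * coefficient schur la (comb ?c)"
    by (simp add: comb_def coefficient_sum sum_distrib_left)
  finally show ?thesis by (simp add: expansion_schur(2) [OF graded_UNIV])
qed

lemma schur_eqI:
  assumes "\<And>la. is_partition la \<Longrightarrow> coefficient schur la P = coefficient schur la Q"
  shows "P = Q"
proof -
  have "expansion schur P = expansion schur Q"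
  proof (rule poly_mapping_eqI)
    fix la
    show "lookup (expansion schur P) la = lookup (expansion schur Q) la"
    proof (cases "is_partition la")
      case True
      then show ?thesis using assms [of la] by (simp add: coefficient_def)
    next
      case False
      then have "coefficient schur la R = 0" for R
        using coefficient_graded(1) [OF graded_UNIV] by blast
      then show ?thesis by (simp add: coefficient_def)
    qed
  qed
  then show ?thesis by (metis expansion_schur(2) graded_UNIV)
qed

text \<open>The bridge from basis expansions to concrete polynomials; the degree bound makes n
  variables enough for all partitions that occur in P.\<close>

lemma coefficient_eq_lookup:
  assumes P: "graded {..n} P" and la: "is_partition la" "length la \<le> n"
  shows "coefficient schur la P = lookup (expand n P * alt n (delta n)) (expo n (beta n la))"
proof -
  have "lookup (expand n (comb (expansion schur P)) * alt n (delta n)) (expo n (beta n la)) =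
      lookup (expansion schur P) la"
  proof (rule lookup_expand_comb [OF expansion_schur(1) [OF P] la])
    fix mu assume "mu \<in> keys (expansion schur P)"
    then show "length mu \<le> n"
      using expansion_schur(1) [OF P] length_le_psize [of mu] by (auto simp: supported_def)
  qed
  then show ?thesis by (simp add: expansion_schur(2) [OF P] coefficient_def)
qed


section \<open>Scalar product and skewing\<close>

lemma scalar_superset:
  assumes "finite S" "\<And>la. coefficient schur la P \<noteq> 0 \<Longrightarrow> la \<in> S"
  shows "scalar P Q = (\<Sum>la\<in>S. coefficient schur la P * coefficient schur la Q)"
  unfolding scalar_def
  by (rule sum.mono_neutral_left) (use assms in \<open>auto simp: coefficient_def in_keys_iff\<close>)

lemma finite_support: "finite {la. coefficient schur la P \<noteq> 0}"
  unfolding coefficient_def by (rule finite_lookup)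

text \<open>\<open>scalar\<close> sums over the support of its first argument; over the union of
  both supports its symmetry becomes visible.\<close>

lemma scalar_common:
  "scalar P Q = (\<Sum>la\<in>{la. coefficient schur la P \<noteq> 0} \<union> {la. coefficient schur la Q \<noteq> 0}.
     coefficient schur la P * coefficient schur la Q)"
  by (rule scalar_superset) (auto simp: finite_support)

lemma scalar_commute: "scalar P Q = scalar Q P"
  unfolding scalar_common by (simp add: Un_commute mult.commute)

lemma scalar_add_right: "scalar P (Q + Q') = scalar P Q + scalar P Q'"
  by (simp add: scalar_def coefficient_add distrib_left sum.distrib)

lemma scalar_0_right [simp]: "scalar P 0 = 0"
  by (simp add: scalar_def)

lemma scalar_sum_right: "scalar P (sum f A) = (\<Sum>x\<in>A. scalar P (f x))"
  by (induction A rule: infinite_finite_induct) (simp_all add: scalar_add_right)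

lemma scalar_const_mult_right: "scalar P (const a * Q) = a * scalar P Q"
  by (simp add: scalar_def coefficient_const_mult sum_distrib_left mult.left_commute)

lemma scalar_add_left: "scalar (P + P') Q = scalar P Q + scalar P' Q"
  by (simp add: scalar_commute [of _ Q] scalar_add_right)

lemma scalar_const_mult_left: "scalar (const a * P) Q = a * scalar P Q"
  by (simp add: scalar_commute [of _ Q] scalar_const_mult_right)

lemma scalar_sum_left: "scalar (sum f A) Q = (\<Sum>x\<in>A. scalar (f x) Q)"
  by (simp add: scalar_commute [of _ Q] scalar_sum_right)

lemma scalar_schur_left:
  assumes "is_partition la"
  shows "scalar (schur la) Q = coefficient schur la Q"
proof -
  have "scalar (schur la) Q = (\<Sum>mu\<in>{la}. coefficient schur mu (schur la) * coefficient schur mu Q)"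
    using assms by (intro scalar_superset) (auto simp: coefficient_schur split: if_splits)
  then show ?thesis using assms by (simp add: coefficient_schur)
qed

lemma scalar_schur_right: "is_partition la \<Longrightarrow> scalar P (schur la) = coefficient schur la P"
  by (simp add: scalar_commute [of P] scalar_schur_left)

lemma scalar_graded_disjoint:
  assumes "graded A P" "graded B Q" "A \<inter> B = {}"
  shows "scalar P Q = 0"
  unfolding scalar_def
proof (rule sum.neutral, rule ballI)
  fix la
  show "coefficient schur la P * coefficient schur la Q = 0"
    using coefficient_graded(2) [OF assms(1), of la] coefficient_graded(2) [OF assms(2), of la] assms(3)
    by (metis disjoint_iff mult_eq_0_iff)
qed

lemma graded_coefficientI:
  assumes "\<And>la. is_partition la \<Longrightarrow> coefficient schur la P \<noteq> 0 \<Longrightarrow> psize la \<in> A"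
  shows "graded A P"
proof -
  have "P = comb (expansion schur P)" by (simp add: expansion_schur(2) [OF graded_UNIV])
  moreover have "graded A (comb (expansion schur P))"
    unfolding comb_def
  proof (intro graded_sum graded_const_mult)
    fix la assume la: "la \<in> keys (expansion schur P)"
    then have "is_partition la" using expansion_schur(1) [OF graded_UNIV, of P] by (simp add: supported_def)
    moreover have "psize la \<in> A"
      using assms [OF \<open>is_partition la\<close>] la by (simp add: coefficient_def in_keys_iff)
    ultimately show "graded A (schur la)"
      by (intro graded_mono [OF graded_schur]) auto
  qed
  ultimately show ?thesis by simp
qed

lemma scalar_eqI:
  assumes "\<And>T. scalar S T = scalar S' T"
  shows "S = S'"
  by (rule schur_eqI) (metis assms scalar_schur_right)

lemma finite_Par_le: "finite {la. is_partition la \<and> psize la \<le> d}"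
proof -
  have "{la. is_partition la \<and> psize la \<le> d} = (\<Union>k\<le>d. Par k)" by (auto simp: Par_def)
  then show ?thesis by (simp add: finite_Par)
qed

text \<open>Represent the functional T -> scalar Q (P * T) in the orthonormal Schur basis. Finitely
  many terms suffice, because multiplication by P does not lower degrees and \<open>scalar\<close>
  separates them.\<close>

lemma skew_exists: "\<exists>S. \<forall>T. scalar S T = scalar Q (P * T)"
proof -
  obtain d where d: "graded {..d} Q" using graded_exists by blast
  define L where "L = {la. is_partition la \<and> psize la \<le> d}"
  have L: "finite L" unfolding L_def by (rule finite_Par_le)
  define S where "S = (\<Sum>la\<in>L. const (scalar Q (P * schur la)) * schur la)"
  have S: "scalar S (schur mu) = scalar Q (P * schur mu)" if mu: "is_partition mu" for mu
  proof -
    have "scalar S (schur mu) = (\<Sum>la\<in>L. scalar Q (P * schur la) * coefficient schur mu (schur la))"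
      by (simp add: S_def scalar_sum_left scalar_const_mult_left scalar_schur_right mu)
    also have "\<dots> = (\<Sum>la\<in>L. if la = mu then scalar Q (P * schur la) else 0)"
      by (intro sum.cong refl) (auto simp: L_def coefficient_schur)
    also have "\<dots> = (if mu \<in> L then scalar Q (P * schur mu) else 0)"
      using L by simp
    also have "\<dots> = scalar Q (P * schur mu)"
    proof (cases "mu \<in> L")
      case False
      then have "psize mu > d" using mu by (simp add: L_def)
      then have "graded {d<..} (P * schur mu)"
        by (intro graded_mult [OF graded_UNIV graded_schur [OF mu]]) auto
      then have "scalar Q (P * schur mu) = 0"
        by (rule scalar_graded_disjoint [OF d]) auto
      then show ?thesis by simp
    qed simp
    finally show ?thesis .
  qed
  have "scalar S T = scalar Q (P * T)" for T
  proof -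
    have T: "T = comb (expansion schur T)" by (simp add: expansion_schur(2) [OF graded_UNIV])
    have "scalar S (comb c) = scalar Q (P * comb c)" if "supported UNIV c" for c
      using that by (simp add: comb_def supported_def scalar_sum_right scalar_const_mult_right S
          sum_distrib_left mult.left_commute [of P])
    from this [OF expansion_schur(1) [OF graded_UNIV, of T]] T show ?thesis by simp
  qed
  then show ?thesis by blast
qed

lemma scalar_skew: "scalar (skew P Q) T = scalar Q (P * T)"
proof -
  have "\<exists>!S. \<forall>T. scalar S T = scalar Q (P * T)"
    using skew_exists [of Q P] by (auto intro: scalar_eqI)
  from theI' [OF this] show ?thesis by (simp add: skew_def)
qed

lemma skew_eqI: "(\<And>T. scalar S T = scalar Q (P * T)) \<Longrightarrow> skew P Q = S"
  by (rule scalar_eqI) (simp add: scalar_skew)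

lemma skew_add_left: "skew (P + P') Q = skew P Q + skew P' Q"
  by (rule skew_eqI) (simp add: scalar_add_left scalar_skew distrib_right scalar_add_right)

lemma skew_add_right: "skew P (Q + Q') = skew P Q + skew P Q'"
  by (rule skew_eqI) (simp add: scalar_add_left scalar_skew)

lemma skew_0_left [simp]: "skew 0 Q = 0"
  by (rule skew_eqI) (simp add: scalar_commute [of 0])

lemma skew_0_right [simp]: "skew P 0 = 0"
  by (rule skew_eqI) (simp add: scalar_commute [of 0])

lemma skew_sum_left: "skew (sum f A) Q = (\<Sum>x\<in>A. skew (f x) Q)"
  by (induction A rule: infinite_finite_induct) (simp_all add: skew_add_left)

lemma skew_sum_right: "skew P (sum f A) = (\<Sum>x\<in>A. skew P (f x))"
  by (induction A rule: infinite_finite_induct) (simp_all add: skew_add_right)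

lemma skew_const_mult_right: "skew P (const a * Q) = const a * skew P Q"
  by (rule skew_eqI) (simp add: scalar_const_mult_left scalar_skew)

lemma skew_1_left: "skew 1 Q = Q"
  by (rule skew_eqI) simp

lemma skew_mult: "skew (P * P') Q = skew P (skew P' Q)"
  by (rule skew_eqI) (simp add: scalar_skew mult_ac)

text \<open>By adjointness, multiplication by an element of degree a becomes lowering by a.\<close>

lemma graded_skew:
  assumes P: "graded A P" and Q: "graded B Q"
  shows "graded {k. \<exists>a\<in>A. k + a \<in> B} (skew P Q)"
proof (rule graded_coefficientI)
  fix la assume la: "is_partition la" "coefficient schur la (skew P Q) \<noteq> 0"
  then have "scalar Q (P * schur la) \<noteq> 0"
    by (simp add: scalar_schur_right [symmetric] scalar_skew)
  moreover have "graded ((\<lambda>a. psize la + a) ` A) (P * schur la)"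
    by (rule graded_mult [OF P graded_schur [OF la(1)]]) auto
  ultimately have "B \<inter> (\<lambda>a. psize la + a) ` A \<noteq> {}"
    using scalar_graded_disjoint [OF Q] by blast
  then show "psize la \<in> {k. \<exists>a\<in>A. k + a \<in> B}" by auto
qed

lemma graded_empty: "graded {} P \<longleftrightarrow> P = 0"
  by (auto simp: graded_def)

section \<open>Exponential generating series\<close>

text \<open>L is the logarithmic derivative of F, stated without division. It turns products of
  series into sums and, in characteristic 0, determines F (\<open>logd_unique\<close>).\<close>

definition logd :: "'a::comm_ring_1 fps \<Rightarrow> 'a fps \<Rightarrow> bool" where
  "logd F L \<longleftrightarrow> fps_nth F 0 = 1 \<and> fps_deriv F = F * L"

lemma logd_rec:
  assumes "logd F L"
  shows "of_nat (Suc n) * fps_nth F (Suc n) = (\<Sum>i\<le>n. fps_nth F i * fps_nth L (n - i))"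
proof -
  have "fps_nth (fps_deriv F) n = fps_nth (F * L) n" using assms by (simp add: logd_def)
  then show ?thesis by (simp add: fps_mult_nth atLeast0AtMost)
qed

lemma logd_recI:
  assumes "fps_nth F 0 = 1"
    "\<And>n. of_nat (Suc n) * fps_nth F (Suc n) = (\<Sum>i\<le>n. fps_nth F i * fps_nth L (n - i))"
  shows "logd F L"
  using assms by (simp add: logd_def fps_eq_iff fps_mult_nth atLeast0AtMost)

lemma logd_unique:
  fixes F G :: "'a::{idom,ring_char_0} fps"
  assumes "logd F L" "logd G L"
  shows "F = G"
proof -
  have "fps_nth F n = fps_nth G n" for n
  proof (induction n rule: less_induct)
    case (less n)
    show ?case
    proof (cases n)
      case 0
      then show ?thesis using assms by (simp add: logd_def)
    next
      case (Suc k)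
      have "(\<Sum>i\<le>k. fps_nth F i * fps_nth L (k - i)) = (\<Sum>i\<le>k. fps_nth G i * fps_nth L (k - i))"
        using less Suc by (intro sum.cong) auto
      then have "of_nat (Suc k) * fps_nth F (Suc k) = of_nat (Suc k) * fps_nth G (Suc k)"
        using logd_rec [OF assms(1)] logd_rec [OF assms(2)] by simp
      then show ?thesis unfolding Suc mult_cancel_left by (simp del: of_nat_Suc)
    qed
  qed
  then show ?thesis by (simp add: fps_eq_iff)
qed

lemma logd_mult: "logd F L \<Longrightarrow> logd G M \<Longrightarrow> logd (F * G) (L + M)"
  by (simp add: logd_def algebra_simps)

lemma logd_1: "logd 1 0"
  by (simp add: logd_def)

lemma logd_compose:
  fixes F :: "'a::idom fps"
  assumes "logd F L" "fps_nth G 0 = 0"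
  shows "logd (F oo G) ((L oo G) * fps_deriv G)"
  using assms by (simp add: logd_def fps_compose_deriv fps_compose_mult_distrib mult.assoc)

text \<open>The family S covers both exact degrees {n} and lower bounds {n..}. Coefficient n of L
  belongs to degree \<open>Suc n\<close> because of the derivative.\<close>

lemma logd_graded:
  fixes F :: "sym fps"
  assumes F: "logd F L" and L: "\<And>n. graded (S (Suc n)) (fps_nth L n)"
    and S: "0 \<in> S 0" "\<And>i j a b. a \<in> S i \<Longrightarrow> b \<in> S j \<Longrightarrow> a + b \<in> S (i + j)"
  shows "graded (S n) (fps_nth F n)"
proof (induction n rule: less_induct)
  case (less n)
  show ?case
  proof (cases n)
    case 0
    then show ?thesis using F S(1) by (auto simp: logd_def intro: graded_mono [OF graded_1])
  next
    case (Suc k)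
    have "graded (S n) (const [:1 / of_nat (Suc k):] * (of_nat (Suc k) * fps_nth F (Suc k)))"
      unfolding logd_rec [OF F]
    proof (intro graded_const_mult graded_sum graded_mult [OF less L])
      fix i a b assume "i \<in> {..k}" "a \<in> S i" "b \<in> S (Suc (k - i))"
      then show "a + b \<in> S n" using S(2) [of a i b "Suc (k - i)"] Suc by (simp add: Suc_diff_le)
    qed (use Suc in auto)
    moreover have "const [:1 / of_nat (Suc k):] * of_nat (Suc k) = (1 :: sym)"
      by (simp add: const_of_nat [symmetric] const_mult [symmetric] of_nat_poly del: of_nat_Suc flip: one_pCons)
    ultimately show ?thesis by (simp add: Suc mult.assoc [symmetric] del: of_nat_Suc)
  qed
qed

section \<open>Plethystic exponentials and their adjoints\<close>

lemma is_hom_adams_coeff: "is_hom (adams_coeff k)"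
  by (simp add: is_hom_def adams_coeff_def pcompose_add pcompose_mult pcompose_1)

lemma is_hom_const_adams_coeff: "is_hom (\<lambda>c. const (adams_coeff k c))"
  by (rule is_hom_comp [OF is_hom_const is_hom_adams_coeff])

lemma is_hom_adams: "is_hom (adams k)"
  unfolding adams_def adams_ext_def
  by (rule is_hom_psubst [OF is_hom_const_adams_coeff])

lemma adams_const: "adams k (const c) = const (adams_coeff k c)"
  by (simp add: adams_def adams_ext_def psubst_const is_hom_const_adams_coeff)

lemma adams_psum: "j \<ge> 1 \<Longrightarrow> adams k (psum j) = psum (j * k)"
  by (simp add: adams_def adams_ext_def psubst_psum is_hom_const_adams_coeff)

lemma adams_coeff_tvar: "adams_coeff k tvar = tvar ^ k"
proof -
  have "monom 1 k = (tvar :: rat poly) ^ k"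
    by (simp add: tvar_def monom_altdef)
  then show ?thesis by (simp add: adams_coeff_def tvar_def pcompose_pCons)
qed

lemma adams_coeff_const: "adams_coeff k [:c:] = [:c:]"
  by (simp add: adams_coeff_def)

lemma graded_adams:
  assumes "k \<ge> 1" "graded {1..} A"
  shows "graded {k..} (adams k A)"
proof -
  have ev: "graded {wt m * k} (ev (\<lambda>j. psum (j * k)) m :: sym)" for m
  proof (induction m rule: exponent_induct)
    case zero
    then show ?case by (simp add: graded_1)
  next
    case (add i m)
    have "graded {Suc i * k + wt m * k} (psum (Suc i * k) * ev (\<lambda>j. psum (j * k)) m :: sym)"
      using assms(1) by (intro graded_hom_mult graded_psum add) simp
    then show ?case by (simp add: ev_add algebra_simps)
  qed
  have "graded {k..} (const (adams_coeff k (lookup A m)) * ev (\<lambda>j. psum (j * k)) m)" if "m \<in> keys A" for m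
  proof -
    have "wt m \<ge> 1" using that assms(2) by (auto simp: graded_def)
    then have "k \<le> wt m * k" by simp
    then show ?thesis by (intro graded_const_mult graded_mono [OF ev]) simp
  qed
  then show ?thesis unfolding adams_def adams_ext_def psubst_ev by (intro graded_sum)
qed

text \<open>The exponential series is its own derivative, and differentiating p_k[A] z^k / k cancels
  the denominator, so coefficient n is p_(n+1)[A].\<close>

lemma logd_Omega: "logd (Omega A) (Abs_fps (\<lambda>n. adams (Suc n) A))"
proof -
  define E :: "sym fps" where "E = Abs_fps (\<lambda>n. const [:1 / fact n:])"
  define B where "B = Abs_fps (\<lambda>k. if k = 0 then 0 else const [:1 / of_nat k:] * adams k A)"
  have "of_nat (Suc n) * const [:1 / fact (Suc n):] = (const [:1 / fact n:] :: sym)" for n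
    by (simp add: const_of_nat [symmetric] const_mult [symmetric] of_nat_poly del: of_nat_Suc)
  then have "fps_deriv E = E"
    by (simp add: fps_eq_iff E_def del: of_nat_Suc)
  moreover have "of_nat (Suc n) * (const [:1 / of_nat (Suc n):] * P) = (P :: sym)" for n P
    by (simp add: const_of_nat [symmetric] const_mult [symmetric] mult.assoc [symmetric] of_nat_poly
        del: of_nat_Suc flip: one_pCons)
  then have "fps_deriv B = Abs_fps (\<lambda>n. adams (Suc n) A)"
    by (simp add: fps_eq_iff B_def del: of_nat_Suc)
  moreover have "logd E 1" using \<open>fps_deriv E = E\<close> by (simp add: logd_def E_def flip: one_pCons)
  then have "logd (E oo B) ((1 oo B) * fps_deriv B)" by (rule logd_compose) (simp add: B_def)
  ultimately show ?thesis by (simp add: Omega_def E_def B_def)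
qed

lemma Omega_add: "Omega (A + B) = Omega A * Omega B"
proof (rule logd_unique [OF logd_Omega])
  have "Abs_fps (\<lambda>n. adams (Suc n) (A + B)) = Abs_fps (\<lambda>n. adams (Suc n) A) + Abs_fps (\<lambda>n. adams (Suc n) B)"
    by (simp add: fps_eq_iff is_hom_simps [OF is_hom_adams])
  then show "logd (Omega A * Omega B) (Abs_fps (\<lambda>n. adams (Suc n) (A + B)))"
    by (simp add: logd_mult logd_Omega)
qed

lemma Omega_0: "Omega 0 = 1"
  by (rule logd_unique [OF logd_Omega])
    (simp add: logd_1 is_hom_simps [OF is_hom_adams] flip: fps_zero_def)

lemma graded_Omega:
  assumes "graded {1..} A"
  shows "graded {n..} (fps_nth (Omega A) n)"
  using logd_graded [OF logd_Omega, of "\<lambda>n. {n..}" A n] graded_adams [OF _ assms] by simp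

text \<open>Coefficient n of \<open>Omega A\<close> has no terms of degree below n, so for n > d it
  skews everything of degree at most d to 0. The formal sum becomes a finite one with a range that
  depends only on d.\<close>

lemma Omega_perp_eq:
  assumes A: "graded {1..} A" and P: "graded {..d} P"
  shows "Omega_perp A P = (\<Sum>n\<le>d. skew (fps_nth (Omega A) n) P)"
  unfolding Omega_perp_def
proof (rule Sum_any.expand_superset)
  have "skew (fps_nth (Omega A) n) P = 0" if "n > d" for n
  proof -
    have "graded {k. \<exists>a\<in>{n..}. k + a \<in> {..d}} (skew (fps_nth (Omega A) n) P)"
      by (rule graded_skew [OF graded_Omega [OF A] P])
    then have "graded {} (skew (fps_nth (Omega A) n) P)"
      by (rule graded_mono) (use that in auto)
    then show ?thesis by (simp add: graded_empty)
  qed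
  then show "{n. skew (fps_nth (Omega A) n) P \<noteq> 0} \<subseteq> {..d}"
    by (auto simp flip: not_less)
qed simp

lemma graded_Omega_perp:
  assumes A: "graded {1..} A" and P: "graded {..d} P"
  shows "graded {..d} (Omega_perp A P)"
  unfolding Omega_perp_eq [OF assms]
proof (rule graded_sum)
  fix n
  have "graded {k. \<exists>a\<in>{n..}. k + a \<in> {..d}} (skew (fps_nth (Omega A) n) P)"
    by (rule graded_skew [OF graded_Omega [OF A] P])
  then show "graded {..d} (skew (fps_nth (Omega A) n) P)"
    by (rule graded_mono) auto
qed

lemma Omega_perp_add_right:
  assumes A: "graded {1..} A"
  shows "Omega_perp A (P + Q) = Omega_perp A P + Omega_perp A Q"
proof -
  obtain d1 d2 where "graded {..d1} P" "graded {..d2} Q" using graded_exists by blast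
  then have d: "graded {..max d1 d2} P" "graded {..max d1 d2} Q"
    by (auto elim!: graded_mono)
  show ?thesis
    by (simp add: Omega_perp_eq [OF A d(1)] Omega_perp_eq [OF A d(2)] Omega_perp_eq [OF A graded_add [OF d]]
        skew_add_right sum.distrib)
qed

lemma Omega_perp_const_mult:
  assumes A: "graded {1..} A"
  shows "Omega_perp A (const a * P) = const a * Omega_perp A P"
proof -
  obtain d where d: "graded {..d} P" using graded_exists by blast
  show ?thesis
    by (simp add: Omega_perp_eq [OF A d] Omega_perp_eq [OF A graded_const_mult [OF d]]
        skew_const_mult_right sum_distrib_left)
qed

lemma Omega_perp_0_left: "Omega_perp 0 P = P"
proof -
  obtain d where d: "graded {..d} P" using graded_exists by blast
  have "Omega_perp 0 P = (\<Sum>n\<le>d. if n = 0 then P else 0)"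
    unfolding Omega_perp_eq [OF graded_0 d] Omega_0
    by (intro sum.cong) (auto simp: skew_1_left)
  then show ?thesis by simp
qed

text \<open>The Cauchy product runs over the triangle i + j \<le> d, the iterated operators over a
  square; outside the triangle the degree would drop by more than d.\<close>

lemma Omega_perp_add:
  assumes A: "graded {1..} A" and B: "graded {1..} B"
  shows "Omega_perp (A + B) P = Omega_perp A (Omega_perp B P)"
proof -
  obtain d where d: "graded {..d} P" using graded_exists by blast
  define f where "f i j = skew (fps_nth (Omega A) i) (skew (fps_nth (Omega B) j) P)" for i j
  have 0: "f i j = 0" if "i + j > d" for i j
  proof -
    have "graded {k. \<exists>a\<in>{i..}. k + a \<in> {k. \<exists>a\<in>{j..}. k + a \<in> {..d}}} (f i j)"
      unfolding f_def by (intro graded_skew graded_Omega A B d)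
    then have "graded {} (f i j)" by (rule graded_mono) (use that in auto)
    then show ?thesis by (simp add: graded_empty)
  qed
  have "Omega_perp (A + B) P = (\<Sum>n\<le>d. \<Sum>i\<le>n. f i (n - i))"
    by (simp add: Omega_perp_eq [OF graded_add [OF A B] d] Omega_add fps_mult_nth atLeast0AtMost
        skew_sum_left skew_mult f_def)
  also have "\<dots> = (\<Sum>(i, j)\<in>{(i, j). i + j \<le> d}. f i j)"
    by (rule sum.triangle_reindex_eq [symmetric])
  also have "\<dots> = (\<Sum>(i, j)\<in>{..d} \<times> {..d}. f i j)"
    using 0 not_le_imp_less by (intro sum.mono_neutral_left) auto
  also have "\<dots> = Omega_perp A (Omega_perp B P)"
    unfolding Omega_perp_eq [OF A graded_Omega_perp [OF B d]]
    by (simp add: Omega_perp_eq [OF B d] skew_sum_right f_def sum.cartesian_product)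
  finally show ?thesis .
qed


section \<open>The sum of all Schur functions\<close>

text \<open>For I = {..<n}, the sign of the permutation that sorts \<open>e\<close> into decreasing
  order, and 0 if a value repeats. The index set is a parameter so that the factors of one index can
  be split off.\<close>

definition sgn_set :: "nat set \<Rightarrow> (nat \<Rightarrow> nat) \<Rightarrow> int" where
  "sgn_set I e = (\<Prod>a\<in>I. \<Prod>b\<in>I. if a < b then sgn (int (e a) - int (e b)) else 1)"

lemma sgn_set_insert:
  assumes "finite I" "i \<notin> I"
  shows "sgn_set (insert i I) e = sgn_set I e *
    (\<Prod>m\<in>I. if i < m then sgn (int (e i) - int (e m)) else sgn (int (e m) - int (e i)))"
proof -
  define t where "t a b = (if a < b then sgn (int (e a) - int (e b)) else 1)" for a b
  have "sgn_set (insert i I) e = t i i * (\<Prod>b\<in>I. t i b) * (\<Prod>a\<in>I. t a i * (\<Prod>b\<in>I. t a b))"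
    using assms by (simp add: sgn_set_def flip: t_def)
  also have "\<dots> = sgn_set I e * (\<Prod>m\<in>I. t i m * t m i)"
    by (simp add: prod.distrib sgn_set_def t_def mult_ac)
  also have "(\<Prod>m\<in>I. t i m * t m i) =
      (\<Prod>m\<in>I. if i < m then sgn (int (e i) - int (e m)) else sgn (int (e m) - int (e i)))"
  proof (rule prod.cong [OF refl])
    fix m assume "m \<in> I"
    then have "m \<noteq> i" using assms by auto
    then show "t i m * t m i = (if i < m then sgn (int (e i) - int (e m)) else sgn (int (e m) - int (e i)))"
      by (cases "i < m") (auto simp: t_def)
  qed
  finally show ?thesis .
qed

lemma sgn_set_cong: "(\<And>i. i \<in> I \<Longrightarrow> e i = f i) \<Longrightarrow> sgn_set I e = sgn_set I f"
  unfolding sgn_set_def by (intro prod.cong) auto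

lemma sgn_set_swap:
  assumes ij: "i < n" "j < n" "i \<noteq> j"
  shows "sgn_set {..<n} (e \<circ> transpose i j) = - sgn_set {..<n} e"
proof -
  define J where "J = {..<n} - {i, j}"
  have J: "finite J" "i \<notin> insert j J" "j \<notin> J" "{..<n} = insert i (insert j J)"
    using ij by (auto simp: J_def)
  let ?f = "e \<circ> transpose i j"
  have f: "?f i = e j" "?f j = e i" and fm: "\<And>m. m \<in> J \<Longrightarrow> ?f m = e m"
    using J(2,3) by (auto simp: transpose_def)
  define r where "r i x m = (if i < m then sgn (x - int (e m)) else sgn (int (e m) - x))" for i x m
  have exp: "sgn_set {..<n} h = sgn_set J e * (\<Prod>m\<in>J. r j (int (h j)) m) *
      ((\<Prod>m\<in>J. r i (int (h i)) m) *
       (if i < j then sgn (int (h i) - int (h j)) else sgn (int (h j) - int (h i))))"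
    if "\<And>m. m \<in> J \<Longrightarrow> h m = e m" for h
  proof -
    have r: "(\<Prod>m\<in>J. if l < m then sgn (x - int (h m)) else sgn (int (h m) - x)) = (\<Prod>m\<in>J. r l x m)" for l x
      by (rule prod.cong) (auto simp: r_def that)
    have sJ: "sgn_set J h = sgn_set J e" by (rule sgn_set_cong) (rule that)
    have "finite (insert j J)" using J by simp
    then show ?thesis
      unfolding J(4) sgn_set_insert [OF \<open>finite (insert j J)\<close> J(2)] sgn_set_insert [OF J(1,3)]
        prod.insert [OF J(1,3)] r sJ
      by (simp add: mult_ac)
  qed
  \<comment> \<open>The factors that involve a third index m have the same product before and after
    the exchange, so only the factor of the pair i, j matters.\<close>
  have "r j (int (e i)) m * r i (int (e j)) m = r j (int (e j)) m * r i (int (e i)) m" for m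
    by (auto simp: r_def sgn_if)
  then have "(\<Prod>m\<in>J. r j (int (e i)) m) * (\<Prod>m\<in>J. r i (int (e j)) m) =
      (\<Prod>m\<in>J. r j (int (e j)) m) * (\<Prod>m\<in>J. r i (int (e i)) m)"
    by (simp flip: prod.distrib)
  moreover have exp_f: "sgn_set {..<n} ?f = sgn_set J e * (\<Prod>m\<in>J. r j (int (e i)) m) *
      ((\<Prod>m\<in>J. r i (int (e j)) m) *
       (if i < j then sgn (int (e j) - int (e i)) else sgn (int (e i) - int (e j))))"
    unfolding f [symmetric] by (rule exp) (rule fm)
  moreover have "sgn (int (e j) - int (e i)) = - sgn (int (e i) - int (e j))"
    by (simp add: sgn_if)
  ultimately show ?thesis
    unfolding exp_f exp [of e, OF refl]
    using ij(3) by (cases "i < j") (simp_all add: mult.assoc)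
qed

lemma antisymmetric_sgn: "antisymmetric n (sgn_set {..<n})"
  unfolding antisymmetric_def using sgn_set_swap by (auto intro: sgn_set_cong)

lemma sgn_set_strict_dec: "strict_dec n e \<Longrightarrow> sgn_set {..<n} e = 1"
  unfolding sgn_set_def by (intro prod.neutral ballI) (auto simp: strict_dec_def)

text \<open>Moving one bead changes its order relative to exactly the beads strictly between the old
  and the new position, each of which contributes -1.\<close>

lemma sgn_set_move:
  assumes i: "i < n" and inj: "inj_on e {..<n}"
  shows "sgn_set {..<n} (e(i := z)) = (if \<exists>m<n. m \<noteq> i \<and> e m = z then 0 else
    sgn_set {..<n} e * (- 1) ^ card {y \<in> e ` {..<n}. min (e i) z < y \<and> y < max (e i) z})"
proof -
  define I where "I = {..<n} - {i}"
  have I: "finite I" "i \<notin> I" "{..<n} = insert i I" unfolding I_def using i by auto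
  define r where "r x m = (if i < m then sgn (x - int (e m)) else sgn (int (e m) - x))" for x m
  define s where "s m = (if min (e i) z < e m \<and> e m < max (e i) z then - 1 else 1 :: int)" for m
  have 1: "sgn_set {..<n} (e(i := z)) = sgn_set I e * (\<Prod>m\<in>I. r (int z) m)"
  proof -
    have "sgn_set I (e(i := z)) = sgn_set I e"
      by (rule sgn_set_cong) (use I(2) in auto)
    moreover have "(\<Prod>m\<in>I. if i < m then sgn (int ((e(i := z)) i) - int ((e(i := z)) m))
        else sgn (int ((e(i := z)) m) - int ((e(i := z)) i))) = (\<Prod>m\<in>I. r (int z) m)"
      by (rule prod.cong) (use I(2) in \<open>auto simp: r_def\<close>)
    ultimately show ?thesis unfolding I(3) sgn_set_insert [OF I(1,2)] by simp
  qed
  have 2: "sgn_set {..<n} e = sgn_set I e * (\<Prod>m\<in>I. r (int (e i)) m)"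
    unfolding I(3) using I by (simp add: sgn_set_insert r_def)
  show ?thesis
  proof (cases "\<exists>m<n. m \<noteq> i \<and> e m = z")
    case True
    then obtain m where "m \<in> I" "e m = z" by (auto simp: I_def)
    then have "(\<Prod>m\<in>I. r (int z) m) = 0" using I(1) by (intro prod_zero bexI [of _ m]) (auto simp: r_def)
    then show ?thesis using True by (simp add: 1)
  next
    case False
    have "r (int z) m = r (int (e i)) m * s m" if "m \<in> I" for m
    proof -
      have "e m \<noteq> z" "e m \<noteq> e i" using that False inj_onD [OF inj, of m i] i by (auto simp: I_def)
      then show ?thesis by (auto simp: r_def s_def sgn_if)
    qed
    then have "(\<Prod>m\<in>I. r (int z) m) = (\<Prod>m\<in>I. r (int (e i)) m) * (\<Prod>m\<in>I. s m)"
      by (simp add: prod.distrib)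
    also have "(\<Prod>m\<in>I. s m) = (- 1) ^ card {m \<in> I. min (e i) z < e m \<and> e m < max (e i) z}"
      unfolding s_def using I(1) by (subst prod.inter_filter [symmetric]) auto
    also have "card {m \<in> I. min (e i) z < e m \<and> e m < max (e i) z} =
        card (e ` {m \<in> I. min (e i) z < e m \<and> e m < max (e i) z})"
      by (rule card_image [symmetric], rule inj_on_subset [OF inj]) (auto simp: I_def)
    also have "e ` {m \<in> I. min (e i) z < e m \<and> e m < max (e i) z} =
        {y \<in> e ` {..<n}. min (e i) z < y \<and> y < max (e i) z}"
      by (auto simp: I_def)
    finally show ?thesis by (subst if_not_P [OF False]) (simp add: 1 2)
  qed
qed

text \<open>With \<open>N x\<close> the number of elements of \<open>C\<close> in \<open>[x, x + k)\<close>, the difference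
  \<open>(- 1) ^ N (x + 1) - (- 1) ^ N x\<close> is nonzero iff exactly one of \<open>x\<close> and \<open>x + k\<close> is in \<open>C\<close>;
  so the signed count of the possible moves by \<open>k\<close> telescopes.\<close>

lemma signed_moves:
  fixes C :: "nat set"
  assumes C: "finite C" "{..<k} \<subseteq> C" and k: "k \<ge> 1"
  defines "N' \<equiv> \<lambda>x. card {y \<in> C. x < y \<and> y < x + k}"
  shows "(\<Sum>x\<in>C. if x + k \<in> C then 0 else (- 1) ^ N' x) -
    (\<Sum>x\<in>C. if k \<le> x \<and> x - k \<notin> C then (- 1) ^ N' (x - k) else 0) = (if odd k then 1 else (0 :: int))"
proof -
  define N where "N x = card {y \<in> C. x \<le> y \<and> y < x + k}" for x
  define M where "M = Suc (Max (insert 0 C))"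
  have M: "x < M" if "x \<in> C" for x using that C(1) by (simp add: M_def less_Suc_eq_le)
  define t where "t x = (if x \<in> C \<and> x + k \<notin> C then (- 1) ^ N' x else 0) -
      (if x \<notin> C \<and> x + k \<in> C then (- 1) ^ N' x else (0 :: int))" for x
  have step: "2 * t x = (- 1) ^ N (Suc x) - (- 1) ^ N x" for x
  proof -
    have a: "N x = (if x \<in> C then Suc (N' x) else N' x)"
    proof -
      have "{y \<in> C. x \<le> y \<and> y < x + k} =
          (if x \<in> C then insert x {y \<in> C. x < y \<and> y < x + k} else {y \<in> C. x < y \<and> y < x + k})"
        using k by (auto simp: le_less)
      then show ?thesis using C(1) by (simp add: N_def N'_def)
    qed
    have b: "N (Suc x) = (if x + k \<in> C then Suc (N' x) else N' x)"
    proof -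
      have "{y \<in> C. Suc x \<le> y \<and> y < Suc x + k} =
          (if x + k \<in> C then insert (x + k) {y \<in> C. x < y \<and> y < x + k} else {y \<in> C. x < y \<and> y < x + k})"
        using k by (auto simp: less_Suc_eq)
      then show ?thesis using C(1) by (simp add: N_def N'_def)
    qed
    show ?thesis by (simp add: a b t_def)
  qed
  \<comment> \<open>Above all beads N is 0, and at position 0 it is k because the first k positions
    are occupied; the telescoped value is therefore 1 - (-1)^k.\<close>
  have "2 * (\<Sum>x<M. t x) = (\<Sum>x<M. (- 1) ^ N (Suc x) - (- 1) ^ N x)"
    by (simp only: sum_distrib_left step)
  also have "\<dots> = (- 1) ^ N M - (- 1) ^ N 0"
    by (rule sum_lessThan_telescope)
  also have "N M = 0" unfolding N_def using M by fastforce
  also have "N 0 = k"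
  proof -
    have "{y \<in> C. 0 \<le> y \<and> y < 0 + k} = {..<k}" using C(2) by auto
    then show ?thesis by (simp add: N_def)
  qed
  finally have tot: "(\<Sum>x<M. t x) = (if odd k then 1 else 0)" by (auto split: if_splits)
  have A: "(\<Sum>x\<in>C. if x + k \<in> C then 0 else (- 1) ^ N' x) =
      (\<Sum>x<M. if x \<in> C \<and> x + k \<notin> C then (- 1) ^ N' x else (0 :: int))"
    by (rule sum.mono_neutral_cong_left) (use M in auto)
  have "(\<Sum>x\<in>C. if k \<le> x \<and> x - k \<notin> C then (- 1) ^ N' (x - k) else 0) =
      (\<Sum>x\<in>{x \<in> C. k \<le> x \<and> x - k \<notin> C}. (- 1) ^ N' (x - k) :: int)"
    using C(1) by (intro sum.mono_neutral_cong_right) auto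
  also have "\<dots> = (\<Sum>x\<in>{x. x < M \<and> x \<notin> C \<and> x + k \<in> C}. (- 1) ^ N' x)"
    by (rule sum.reindex_bij_witness [of _ "\<lambda>x. x + k" "\<lambda>x. x - k"]) (auto dest: M)
  also have "\<dots> = (\<Sum>x<M. if x \<notin> C \<and> x + k \<in> C then (- 1) ^ N' x else (0 :: int))"
    by (rule sum.mono_neutral_cong_left) auto
  finally show ?thesis using tot by (simp add: A t_def sum_subtractf)
qed

text \<open>Only moving one of the two coinciding beads can separate them, and the two results are
  mirror images with opposite signs.\<close>

lemma repeat_moves:
  assumes "a < n" "b < n" "a \<noteq> b" "c a = c b"
  shows "(\<Sum>i<n. sgn_set {..<n} (c(i := h (c i)))) = 0"
proof -
  have zero: "sgn_set {..<n} (c(i := h (c i))) = 0" if "i < n" "i \<noteq> a" "i \<noteq> b" for i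
    by (rule antisymmetric_repeat [OF antisymmetric_sgn assms(1-3)]) (use that assms in auto)
  have "c(b := h (c b)) = c(a := h (c a)) \<circ> transpose a b"
    using assms(3,4) by (auto simp: fun_eq_iff transpose_def)
  then have swap: "sgn_set {..<n} (c(b := h (c b))) = - sgn_set {..<n} (c(a := h (c a)))"
    using sgn_set_swap [OF assms(1-3)] by simp
  have "(\<Sum>i<n. sgn_set {..<n} (c(i := h (c i)))) = (\<Sum>i\<in>{a, b}. sgn_set {..<n} (c(i := h (c i))))"
    by (rule sum.mono_neutral_right) (use zero assms in auto)
  then show ?thesis using assms(3) swap by simp
qed

text \<open>In terms of the sum G of all Schur functions, the adjoint of p_k acts on G as
  multiplication by p_k, plus the identity if k is odd. The assumption \<open>full\<close> is the
  boundary condition of \<open>signed_moves\<close> at the lower end of the abacus.\<close>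

lemma sgn_moves:
  assumes k: "k \<ge> 1" and full: "inj_on c {..<n} \<Longrightarrow> {..<k} \<subseteq> c ` {..<n}"
  shows "(\<Sum>i<n. sgn_set {..<n} (add_at c i k)) =
    (\<Sum>i<n. if k \<le> c i then sgn_set {..<n} (sub_at c i k) else 0) +
    (if odd k then sgn_set {..<n} c else 0)"
proof (cases "inj_on c {..<n}")
  case False
  then obtain a b where ab: "a < n" "b < n" "a \<noteq> b" "c a = c b" by (auto simp: inj_on_def)
  have "sgn_set {..<n} c = 0" by (rule antisymmetric_repeat [OF antisymmetric_sgn ab])
  moreover have "(\<Sum>i<n. sgn_set {..<n} (add_at c i k)) = 0"
    unfolding add_at_def using repeat_moves [OF ab, of "\<lambda>x. x + k"] by simp
  moreover have "(\<Sum>i<n. if k \<le> c i then sgn_set {..<n} (sub_at c i k) else 0) = 0"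
  proof -
    have "(\<Sum>i<n. if k \<le> c i then sgn_set {..<n} (sub_at c i k) else 0) =
        (\<Sum>i<n. sgn_set {..<n} (c(i := (if k \<le> c i then c i - k else c i))))"
      using \<open>sgn_set {..<n} c = 0\<close> by (intro sum.cong) (auto simp: sub_at_def)
    then show ?thesis using repeat_moves [OF ab, of "\<lambda>x. if k \<le> x then x - k else x"] by simp
  qed
  ultimately show ?thesis by simp
next
  case inj: True
  define C where "C = c ` {..<n}"
  define N' where "N' x = card {y \<in> C. x < y \<and> y < x + k}" for x
  have bij: "(\<Sum>i<n. f (c i)) = (\<Sum>x\<in>C. f x)" for f :: "nat \<Rightarrow> int"
    unfolding C_def by (simp add: sum.reindex [OF inj])
  have up: "sgn_set {..<n} (add_at c i k) = sgn_set {..<n} c * (if c i + k \<in> C then 0 else (- 1) ^ N' (c i))"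
    if i: "i < n" for i
  proof -
    have "(\<exists>m<n. m \<noteq> i \<and> c m = c i + k) \<longleftrightarrow> c i + k \<in> C"
      unfolding C_def using k by (force simp: image_iff)
    then show ?thesis
      unfolding add_at_def sgn_set_move [OF i inj] by (simp add: N'_def C_def)
  qed
  have down: "sgn_set {..<n} (sub_at c i k) = sgn_set {..<n} c * (if c i - k \<notin> C then (- 1) ^ N' (c i - k) else 0)"
    if i: "i < n" "k \<le> c i" for i
  proof -
    have "(\<exists>m<n. m \<noteq> i \<and> c m = c i - k) \<longleftrightarrow> c i - k \<in> C"
      unfolding C_def using k i by (force simp: image_iff)
    then show ?thesis
      unfolding sub_at_def sgn_set_move [OF i(1) inj] using i k by (simp add: N'_def C_def)
  qed
  have "(\<Sum>i<n. sgn_set {..<n} (add_at c i k)) - (\<Sum>i<n. if k \<le> c i then sgn_set {..<n} (sub_at c i k) else 0) =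
      sgn_set {..<n} c * ((\<Sum>i<n. if c i + k \<in> C then 0 else (- 1) ^ N' (c i)) -
      (\<Sum>i<n. if k \<le> c i \<and> c i - k \<notin> C then (- 1) ^ N' (c i - k) else 0))"
    by (simp add: right_diff_distrib sum_distrib_left up down if_distrib cong: if_cong)
       (auto intro!: sum.cong simp: down)
  also have "\<dots> = sgn_set {..<n} c * (if odd k then 1 else 0)"
  proof -
    have "finite C" "{..<k} \<subseteq> C" using full [OF inj] by (simp_all add: C_def)
    from signed_moves [OF this k, folded N'_def] show ?thesis
      using bij [of "\<lambda>x. if x + k \<in> C then 0 else (- 1) ^ N' x"]
        bij [of "\<lambda>x. if k \<le> x \<and> x - k \<notin> C then (- 1) ^ N' (x - k) else 0"] by simp
  qed
  finally show ?thesis by (simp split: if_splits)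
qed


text \<open>By \<open>coefficient_eq_lookup\<close>, \<open>cf n P (beta n la)\<close> is the coefficient of \<open>schur la\<close> in \<open>P\<close>
  once \<open>n\<close> is large.\<close>

definition cf :: "nat \<Rightarrow> sym \<Rightarrow> (nat \<Rightarrow> nat) \<Rightarrow> rat poly" where
  "cf n P e = lookup (expand n P * alt n (delta n)) (expo n e)"

lemma cf_add: "cf n (P + Q) e = cf n P e + cf n Q e"
  by (simp add: cf_def is_hom_simps [OF is_hom_expand] distrib_right lookup_add)

lemma cf_0 [simp]: "cf n 0 e = 0"
  by (simp add: cf_def is_hom_simps [OF is_hom_expand])

lemma cf_sum: "cf n (sum f A) e = (\<Sum>x\<in>A. cf n (f x) e)"
  by (induction A rule: infinite_finite_induct) (simp_all add: cf_add)

lemma lookup_var_power_mult: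
  assumes "i < n"
  shows "lookup (var i ^ k * Q) (expo n e) = (if k \<le> e i then lookup Q (expo n (sub_at e i k)) else 0)"
proof (cases "k \<le> e i")
  case True
  have "expo n e = single i k + expo n (sub_at e i k)"
    using True assms by (intro poly_mapping_eqI) (auto simp: lookup_add lookup_expo lookup_single when_def sub_at_def)
  then show ?thesis
    using True by (simp add: var_power lookup_single_mult_add)
next
  case False
  have "expo n e \<noteq> single i k + m" for m
  proof
    assume "expo n e = single i k + m"
    then have "lookup (expo n e) i = k + lookup m i" by (simp add: lookup_add)
    then show False using False assms by (simp add: lookup_expo)
  qed
  then show ?thesis using False by (simp add: var_power lookup_single_mult_0)
qed

lemma cf_psum_mult:
  assumes "k \<ge> 1"
  shows "cf n (psum k * P) e = (\<Sum>i<n. if k \<le> e i then cf n P (sub_at e i k) else 0)"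
proof -
  have "cf n (psum k * P) e = lookup (\<Sum>i<n. var i ^ k * (expand n P * alt n (delta n))) (expo n e)"
    by (simp add: cf_def is_hom_simps [OF is_hom_expand] expand_psum [OF assms] sum_distrib_right mult.assoc)
  also have "\<dots> = (\<Sum>i<n. if k \<le> e i then cf n P (sub_at e i k) else 0)"
    unfolding lookup_sum cf_def by (intro sum.cong refl) (simp add: lookup_var_power_mult)
  finally show ?thesis .
qed

text \<open>Exchanging two exponents of the monomial composes every permutation of the Leibniz sum
  with a transposition on the right.\<close>

lemma antisymmetric_lookup_alt: "antisymmetric n (\<lambda>e. lookup (alt n f :: 'a::comm_ring_1 mpol) (expo n e))"
  unfolding antisymmetric_def
proof (intro conjI allI impI)
  fix e :: "nat \<Rightarrow> nat" and i j assume ij: "i < n" "j < n" "i \<noteq> j"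
  define \<tau> where "\<tau> = transpose i j"
  have \<tau>: "\<tau> permutes {..<n}" unfolding \<tau>_def using ij by (intro permutes_swap_id) auto
  have lt: "\<tau> m < n \<longleftrightarrow> m < n" for m using permutes_in_image [OF \<tau>, of m] by simp
  have inv: "\<tau> (\<tau> m) = m" for m by (simp add: \<tau>_def)
  have "lookup (alt n f :: 'a mpol) (expo n (e \<circ> \<tau>)) =
      (\<Sum>p | p permutes {..<n}. if \<forall>m<n. f ((p \<circ> \<tau>) m) = (e \<circ> \<tau>) m then of_int (sign (p \<circ> \<tau>)) else 0)"
    unfolding lookup_alt by (rule sum_permutations_compose_right [OF \<tau>])
  also have "\<dots> = (\<Sum>p | p permutes {..<n}. - (if \<forall>m<n. f (p m) = e m then of_int (sign p) else 0))"
  proof (rule sum.cong [OF refl])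
    fix p assume "p \<in> {p. p permutes {..<n}}"
    then have "sign (p \<circ> \<tau>) = sign p * sign \<tau>"
      using \<tau> by (auto intro!: sign_compose simp: permutation_permutes)
    also have "sign \<tau> = - 1" unfolding \<tau>_def using ij by (simp add: sign_swap_id)
    finally have s: "sign (p \<circ> \<tau>) = - sign p" by (simp only: mult_minus_right mult_1_right)
    have eqv: "(\<forall>m<n. f ((p \<circ> \<tau>) m) = (e \<circ> \<tau>) m) \<longleftrightarrow> (\<forall>m<n. f (p m) = e m)"
      using lt inv by (metis comp_apply)
    show "(if \<forall>m<n. f ((p \<circ> \<tau>) m) = (e \<circ> \<tau>) m then of_int (sign (p \<circ> \<tau>)) else (0 :: 'a)) =
        - (if \<forall>m<n. f (p m) = e m then of_int (sign p) else 0)"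
      unfolding s eqv by auto
  qed
  also have "\<dots> = - lookup (alt n f :: 'a mpol) (expo n e)"
    by (simp add: lookup_alt sum_negf)
  finally show "lookup (alt n f) (expo n (e \<circ> transpose i j)) = - lookup (alt n f :: 'a mpol) (expo n e)"
    by (simp add: \<tau>_def)
qed (simp cong: expo_cong)

definition schur_sum :: "nat list set \<Rightarrow> nat \<Rightarrow> sym" where
  "schur_sum A d = (\<Sum>la\<in>Par d \<inter> A. schur la)"

lemma graded_schur_sum: "graded {d} (schur_sum A d)"
  unfolding schur_sum_def by (intro graded_sum) (use graded_schur in \<open>auto simp: Par_def\<close>)

lemma expand_schur_sum:
  assumes "d \<le> n"
  shows "expand n (schur_sum A d) * alt n (delta n) = (\<Sum>la\<in>Par d \<inter> A. alternant n la)"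
  unfolding schur_sum_def is_hom_sum [OF is_hom_expand] sum_distrib_right
  using assms length_le_psize by (intro sum.cong refl expand_schur) (force simp: Par_def)+

lemma cf_schur_sum_beta:
  assumes "d \<le> n" "is_partition mu" "length mu \<le> n"
  shows "cf n (schur_sum A d) (beta n mu) = (if psize mu = d \<and> mu \<in> A then 1 else 0)"
proof -
  have "cf n (schur_sum A d) (beta n mu) = (\<Sum>la\<in>Par d \<inter> A. if la = mu then 1 else 0)"
    unfolding cf_def expand_schur_sum [OF assms(1)] lookup_sum
  proof (rule sum.cong [OF refl])
    fix la assume "la \<in> Par d \<inter> A"
    then have "is_partition la" "length la \<le> n" using assms(1) length_le_psize [of la] by (auto simp: Par_def)
    then show "lookup (alternant n la) (expo n (beta n mu)) = (if la = mu then 1 else 0)"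
      using assms by (intro lookup_alternant)
  qed
  also have "\<dots> = (if psize mu = d \<and> mu \<in> A then 1 else 0)"
    using assms(2) finite_Par [of d] by (auto simp: Par_def)
  finally show ?thesis .
qed

lemma antisymmetric_cf_schur_sum: "d \<le> n \<Longrightarrow> antisymmetric n (cf n (schur_sum A d))"
proof -
  assume d: "d \<le> n"
  note a = antisymmetric_lookup_alt [of n, where 'a = "rat poly"]
  show ?thesis
    unfolding antisymmetric_def cf_def expand_schur_sum [OF d] lookup_sum alternant_eq
    using antisymmetricD(2) [OF a] by (auto simp: sum_negf cong: expo_cong)
qed

text \<open>Injective exponents are sorted with the same sign on both sides, and on all others both
  functions vanish. Sorting keeps the sum, so equality can be checked one degree at a time.\<close>

lemma antisymmetric_eqI:
  fixes g h :: "(nat \<Rightarrow> nat) \<Rightarrow> 'b::{comm_ring_1,ring_char_0,semiring_no_zero_divisors}"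
  assumes g: "antisymmetric n g" and h: "antisymmetric n h"
    and eq: "\<And>f. strict_dec n f \<Longrightarrow> (\<Sum>i<n. f i) = (\<Sum>i<n. e i) \<Longrightarrow> g f = h f"
  shows "g e = h e"
proof (cases "inj_on e {..<n}")
  case False
  then obtain a b where "a < n" "b < n" "a \<noteq> b" "e a = e b" by (auto simp: inj_on_def)
  then show ?thesis using antisymmetric_repeat [OF g] antisymmetric_repeat [OF h] by metis
next
  case True
  then obtain q where q: "q permutes {..<n}" and dec: "strict_dec n (e \<circ> q)"
    using sort_exponents by blast
  have "(\<Sum>i<n. (e \<circ> q) i) = (\<Sum>i<n. e i)"
    unfolding comp_def by (rule sum.reindex_bij_betw [OF permutes_imp_bij [OF q]])
  then have "of_int (sign q) * g e = of_int (sign q) * h e"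
    using eq [OF dec] by (simp add: antisymmetric_permute [OF g q] antisymmetric_permute [OF h q])
  then show ?thesis by (simp add: sign_def split: if_splits)
qed

lemma antisymmetric_of_int:
  "antisymmetric n g \<Longrightarrow> antisymmetric n (\<lambda>e. of_int (g e) :: 'b::comm_ring_1)"
  unfolding antisymmetric_def by (metis of_int_minus)

text \<open>Both sides are antisymmetric and equal 1 on strictly decreasing exponents of this sum,
  since these are the bead positions of a partition of d.\<close>

lemma cf_schur_sum_UNIV:
  assumes "d \<le> n" "(\<Sum>i<n. e i) = d + (\<Sum>i<n. delta n i)"
  shows "cf n (schur_sum UNIV d) e = of_int (sgn_set {..<n} e)"
proof (rule antisymmetric_eqI [OF antisymmetric_cf_schur_sum [OF assms(1)]
      antisymmetric_of_int [OF antisymmetric_sgn]])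
  fix f assume f: "strict_dec n f" "(\<Sum>i<n. f i) = (\<Sum>i<n. e i)"
  define la where "la = strip n (\<lambda>j. f j - delta n j)"
  note la = strict_dec_partition [OF f(1), folded la_def]
  have "cf n (schur_sum UNIV d) f = cf n (schur_sum UNIV d) (beta n la)"
    by (rule antisymmetricD(1) [OF antisymmetric_cf_schur_sum [OF assms(1)]]) (rule la(3))
  then show "cf n (schur_sum UNIV d) f = of_int (sgn_set {..<n} f)"
    using la assms f by (simp add: cf_schur_sum_beta sgn_set_strict_dec)
qed

lemma sum_less_delta_repeat:
  assumes "(\<Sum>i<n. e i) < (\<Sum>i<n. delta n i)"
  shows "sgn_set {..<n} e = 0" "\<not> inj_on e {..<n}"
proof -
  show inj: "\<not> inj_on e {..<n}"
  proof
    assume "inj_on e {..<n}"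
    then obtain q where q: "q permutes {..<n}" and dec: "strict_dec n (e \<circ> q)"
      using sort_exponents by blast
    have "(\<Sum>i<n. (e \<circ> q) i) = (\<Sum>i<n. e i)"
      unfolding comp_def by (rule sum.reindex_bij_betw [OF permutes_imp_bij [OF q]])
    then show False using strict_dec_partition(4) [OF dec] assms by simp
  qed
  then obtain a b where "a < n" "b < n" "a \<noteq> b" "e a = e b" by (auto simp: inj_on_def)
  then show "sgn_set {..<n} e = 0" by (intro antisymmetric_repeat [OF antisymmetric_sgn])
qed

lemma sum_sub_at: "i < n \<Longrightarrow> k \<le> e i \<Longrightarrow> (\<Sum>j<n. sub_at e i k j) + k = (\<Sum>j<n. e j)"
  by (subst (1 2) sum.remove [of _ i]) (auto simp: sub_at_def)

text \<open>The logarithmic derivative of \<open>Omega (psum 1) * sq (Omega (schur [1, 1]))\<close>: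
  the first factor gives every p_(n+1), and the second adds p_k^2 - p_(2k) in degree 2k, which
  replaces p_(2k) by p_k^2.\<close>

definition box_deriv :: "sym fps" where
  "box_deriv = Abs_fps (\<lambda>n. if even n then psum (Suc n) else psum (Suc n div 2) ^ 2)"

lemma sum_swap_bounded:
  fixes f :: "nat \<Rightarrow> nat \<Rightarrow> 'b::comm_monoid_add"
  assumes "\<And>j. j < n \<Longrightarrow> e j \<le> K"
  shows "(\<Sum>j<n. \<Sum>k=1..e j. f j k) = (\<Sum>k=1..K. \<Sum>j<n. if k \<le> e j then f j k else 0)"
proof -
  have "(\<Sum>j<n. \<Sum>k=1..e j. f j k) = (\<Sum>j<n. \<Sum>k=1..K. if k \<le> e j then f j k else 0)"
  proof (rule sum.cong [OF refl])
    fix j assume "j \<in> {..<n}"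
    then have "e j \<le> K" using assms by simp
    then show "(\<Sum>k=1..e j. f j k) = (\<Sum>k=1..K. if k \<le> e j then f j k else 0)"
      by (intro sum.mono_neutral_cong_left) auto
  qed
  then show ?thesis by (simp add: sum.swap [of _ "{..<n}"])
qed

text \<open>Euler's relation for the sign function expresses d times the degree d part of G as the
  sum over k of p_k times the adjoint of p_k applied to G. By \<open>sgn_moves\<close> this adjoint
  is p_k, plus 1 for odd k, which leaves p_k^2 in degree 2k and p_k in odd degree k.\<close>

lemma logd_schur_sum: "logd (Abs_fps (schur_sum UNIV)) box_deriv"
proof (rule logd_recI)
  have "Par 0 = {[]}" by (auto simp: Par_def is_partition_def) (metis sum_list_eq_0_iff list.set_intros(1) neq_Nil_conv)
  moreover have "schur [] = 1"
    unfolding schur_def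
    by (rule the1_equality [OF schur_ex1(1)]) (auto simp: is_partition_def is_hom_simps [OF is_hom_expand])
  ultimately show "fps_nth (Abs_fps (schur_sum UNIV)) 0 = 1" by (simp add: schur_sum_def)
next
  fix d' :: nat
  define d where "d = Suc d'"
  let ?G = "schur_sum UNIV"
  let ?rhs = "\<Sum>i\<le>d'. fps_nth (Abs_fps ?G) i * fps_nth box_deriv (d' - i)"
  have rhs: "?rhs = (\<Sum>k=1..d. if odd k then psum k * ?G (d - k) else psum (k div 2) * (psum (k div 2) * ?G (d - k)))"
    unfolding d_def
    by (rule sum.reindex_bij_witness [of _ "\<lambda>k. Suc d' - k" "\<lambda>i. Suc d' - i"])
      (auto simp: box_deriv_def Suc_diff_le power2_eq_square mult_ac)
  have gr: "graded {d} ?rhs"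
    unfolding rhs
  proof (rule graded_sum)
    fix k assume k: "k \<in> {1..d}"
    show "graded {d} (if odd k then psum k * ?G (d - k) else psum (k div 2) * (psum (k div 2) * ?G (d - k)))"
    proof (cases "odd k")
      case True
      have "graded {k + (d - k)} (psum k * ?G (d - k))"
        using k by (intro graded_hom_mult graded_psum graded_schur_sum) auto
      then show ?thesis using True k by simp
    next
      case False
      then have "graded {k div 2 + (k div 2 + (d - k))} (psum (k div 2) * (psum (k div 2) * ?G (d - k)))"
        using k by (intro graded_hom_mult graded_psum graded_schur_sum) (auto elim: evenE)
      moreover have "k div 2 + (k div 2 + (d - k)) = d" using False k by (auto elim!: evenE)
      ultimately show ?thesis using False by simp
    qed
  qed
  have lhs_eq: "of_nat d * ?G d = const (of_nat d) * ?G d" by (simp add: const_of_nat)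
  have gl: "graded {d} (const (of_nat d) * ?G d)" by (rule graded_const_mult [OF graded_schur_sum])
  have "const (of_nat d) * ?G d = ?rhs"
  proof (rule schur_eqI)
    fix nu :: "nat list" assume nu: "is_partition nu"
    show "coefficient schur nu (const (of_nat d) * ?G d) = coefficient schur nu ?rhs"
    proof (cases "psize nu = d")
      case False
      then show ?thesis
        using coefficient_graded(2) [OF gr, of nu] coefficient_graded(2) [OF gl, of nu]
        by (cases "coefficient schur nu ?rhs = 0"; cases "coefficient schur nu (const (of_nat d) * ?G d) = 0") auto
    next
      case True
      \<comment> \<open>At most d rows of \<open>nu\<close> are nonempty, so the other d beads fill
        the positions 0, ..., d - 1. This gives \<open>sgn_moves\<close> its occupied positions for
        every k up to d.\<close>
      define n where "n = 2 * d"
      define e where "e = beta n nu"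
      define g where "g = sgn_set {..<n}"
      have len: "length nu \<le> d" using length_le_psize [OF nu] True by simp
      have sum_e: "(\<Sum>j<n. e j) = d + (\<Sum>j<n. delta n j)"
        unfolding e_def using len True by (subst sum_beta) (auto simp: n_def)
      have coeff: "coefficient schur nu P = cf n P e" if "graded {d} P" for P
        unfolding cf_def e_def
        by (rule coefficient_eq_lookup) (use nu len in \<open>auto simp: n_def intro: graded_mono [OF that]\<close>)
      have dec: "strict_dec n e" unfolding e_def by (rule strict_dec_beta [OF nu])
      have ge: "g e = 1" unfolding g_def by (rule sgn_set_strict_dec [OF dec])
      \<comment> \<open>A crude bound on all e j, so that the sums over j and k can be exchanged; it
        is also at least d.\<close>
      define K where "K = 2 * d + (\<Sum>j<n. e j)"
      have eK: "e j \<le> K" if "j < n" for j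
        unfolding K_def using member_le_sum [of j "{..<n}" e] that by simp
      \<comment> \<open>For k in range, S1 k and S2 k are the coefficients at \<open>e\<close> of
        p_k G and of p_k^2 G.\<close>
      define S1 where "S1 k = (\<Sum>j<n. if k \<le> e j then g (sub_at e j k) else 0)" for k
      define S2 where "S2 k = (\<Sum>j<n. if k \<le> e j then
        (\<Sum>i<n. if k \<le> sub_at e j k i then g (sub_at (sub_at e j k) i k) else 0) else 0)" for k
      have full: "{..<k} \<subseteq> sub_at e j k ` {..<n}"
        if j: "j < n" "1 \<le> k" "k \<le> e j" and inj: "inj_on (sub_at e j k) {..<n}" for j k
      proof
        fix v assume "v \<in> {..<k}"
        \<comment> \<open>For k > d the lowered exponents sum to less than the staircase and cannot
          be distinct.\<close>
        have "k \<le> d"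
        proof (rule ccontr)
          assume "\<not> k \<le> d"
          then have "(\<Sum>i<n. sub_at e j k i) < (\<Sum>i<n. delta n i)"
            using sum_sub_at [of j n k e, OF j(1,3)] sum_e by linarith
          then show False using sum_less_delta_repeat(2) inj by blast
        qed
        then have v: "v < d" using \<open>v \<in> {..<k}\<close> by simp
        define p where "p = n - 1 - v"
        have "p < n" "e p = v" using v len by (auto simp: p_def n_def e_def beta_def delta_def part_def)
        moreover have "p \<noteq> j" using \<open>e p = v\<close> j \<open>v \<in> {..<k}\<close> by auto
        ultimately show "v \<in> sub_at e j k ` {..<n}"
          by (intro image_eqI [of _ _ p]) (auto simp: sub_at_def)
      qed
      have "2 * (\<Sum>j<n. \<Sum>k=1..e j. \<Sum>i<n. g (add_at (sub_at e j k) i k)) =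
          2 * (\<Sum>j<n. int (e j)) - int n * (int n - 1)"
        using antisymmetric_Euler [OF antisymmetric_sgn, of n e] ge by (simp add: g_def)
      also have "(\<Sum>j<n. int (e j)) = int d + (\<Sum>j<n. int (delta n j))"
        using sum_e by (metis of_nat_add of_nat_sum)
      also have "2 * (int d + (\<Sum>j<n. int (delta n j))) - int n * (int n - 1) = 2 * int d"
        using arg_cong [OF sum_delta [of n], of int] by (cases n) (auto simp: algebra_simps)
      finally have "int d = (\<Sum>j<n. \<Sum>k=1..e j. \<Sum>i<n. g (add_at (sub_at e j k) i k))" by simp
      also have "\<dots> = (\<Sum>j<n. \<Sum>k=1..e j.
          (\<Sum>i<n. if k \<le> sub_at e j k i then g (sub_at (sub_at e j k) i k) else 0) +
          (if odd k then g (sub_at e j k) else 0))"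
        unfolding g_def using full by (intro sum.cong refl sgn_moves) auto
      also have "\<dots> = (\<Sum>k=1..K. S2 k + (if odd k then S1 k else 0))"
        by (subst sum_swap_bounded [where K = K, OF eK])
          (auto simp: S1_def S2_def sum.distrib [symmetric] intro!: sum.cong)
      finally have d: "int d = (\<Sum>k=1..K. S2 k + (if odd k then S1 k else 0))" .
      have c1: "cf n (psum k * ?G (d - k)) e = of_int (S1 k)" if "1 \<le> k" "k \<le> d" for k
      proof -
        have "cf n (?G (d - k)) (sub_at e j k) = of_int (g (sub_at e j k))" if "j < n" "k \<le> e j" for j
          unfolding g_def 
        proof (rule cf_schur_sum_UNIV)
          show "(\<Sum>i<n. sub_at e j k i) = d - k + (\<Sum>i<n. delta n i)"
            using sum_sub_at [of j n k e, OF that] sum_e \<open>k \<le> d\<close> by linarith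
        qed (simp add: n_def)
        then show ?thesis
          using that by (simp add: cf_psum_mult S1_def) (intro sum.cong, auto)
      qed
      have c2: "cf n (psum k * (psum k * ?G (d - 2 * k))) e = of_int (S2 k)" if "1 \<le> k" "2 * k \<le> d" for k
      proof -
        have "cf n (?G (d - 2 * k)) (sub_at (sub_at e j k) i k) = of_int (g (sub_at (sub_at e j k) i k))"
          if "j < n" "k \<le> e j" "i < n" "k \<le> sub_at e j k i" for i j
          unfolding g_def 
        proof (rule cf_schur_sum_UNIV)
          show "(\<Sum>l<n. sub_at (sub_at e j k) i k l) = d - 2 * k + (\<Sum>i<n. delta n i)"
            using sum_sub_at [of j n k e, OF that(1,2)] sum_sub_at [of i n k "sub_at e j k", OF that(3,4)]
              sum_e \<open>2 * k \<le> d\<close> by linarith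
        qed (simp add: n_def)
        then show ?thesis
          unfolding cf_psum_mult [OF that(1)] S2_def of_int_sum
          by (intro sum.cong refl) (auto intro!: sum.cong)
      qed
      \<comment> \<open>Beyond total degree d the lowered exponents again sum to less than the
        staircase, so the sums up to K may be cut off.\<close>
      have z1: "S1 k = 0" if "k > d" for k
        unfolding S1_def
      proof (rule sum.neutral, rule ballI)
        fix j assume "j \<in> {..<n}"
        then show "(if k \<le> e j then g (sub_at e j k) else 0) = 0"
          using sum_sub_at [of j n k e] sum_less_delta_repeat(1) [of "sub_at e j k" n] sum_e that by (auto simp: g_def)
      qed
      have z2: "S2 k = 0" if "2 * k > d" for k
      proof -
        have "g (sub_at (sub_at e j k) i k) = 0" if "j < n" "k \<le> e j" "i < n" "k \<le> sub_at e j k i" for i j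
          unfolding g_def using sum_sub_at [of j n k e, OF that(1,2)] sum_sub_at [of i n k "sub_at e j k", OF that(3,4)]
            sum_e \<open>2 * k > d\<close>
          by (intro sum_less_delta_repeat(1)) linarith
        then show ?thesis unfolding S2_def by (intro sum.neutral ballI) (auto intro!: sum.neutral)
      qed
      have "cf n ?rhs e = (\<Sum>k=1..d. if odd k then of_int (S1 k) else of_int (S2 (k div 2)))"
        unfolding rhs cf_sum
      proof (rule sum.cong [OF refl])
        fix k assume k: "k \<in> {1..d}"
        show "cf n (if odd k then psum k * ?G (d - k) else psum (k div 2) * (psum (k div 2) * ?G (d - k))) e =
            (if odd k then of_int (S1 k) else of_int (S2 (k div 2)))"
        proof (cases "odd k")
          case True
          then show ?thesis using c1 [of k] k by simp
        next
          case False
          then obtain h where h: "k = 2 * h" by (auto elim: evenE)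
          then show ?thesis using c2 [of h] k by simp
        qed
      qed
      also have "\<dots> = of_int (\<Sum>k=1..d. (if odd k then S1 k else 0) + (if even k then S2 (k div 2) else 0))"
        by (simp add: if_distrib cong: if_cong) (intro sum.cong, auto)
      also have "(\<Sum>k=1..d. (if odd k then S1 k else 0) + (if even k then S2 (k div 2) else 0)) =
          (\<Sum>k=1..d. if odd k then S1 k else 0) + (\<Sum>k=1..d. if even k then S2 (k div 2) else 0)"
        by (rule sum.distrib)
      also have "(\<Sum>k=1..d. if odd k then S1 k else 0) = (\<Sum>k=1..K. if odd k then S1 k else 0)"
        by (rule sum.mono_neutral_left) (auto simp: K_def z1)
      also have "(\<Sum>k=1..d. if even k then S2 (k div 2) else 0) = (\<Sum>k\<in>{k. 1 \<le> k \<and> k \<le> d \<and> even k}. S2 (k div 2))"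
        by (rule sum.mono_neutral_cong_right) auto
      also have "\<dots> = (\<Sum>k\<in>{k. 1 \<le> k \<and> 2 * k \<le> d}. S2 k)"
        by (rule sum.reindex_bij_witness [of _ "\<lambda>k. 2 * k" "\<lambda>k. k div 2"]) (auto elim!: evenE)
      also have "\<dots> = (\<Sum>k=1..K. S2 k)"
        using z2 not_le_imp_less by (intro sum.mono_neutral_left) (auto simp: K_def)
      also have "(\<Sum>k=1..K. if odd k then S1 k else 0) + (\<Sum>k=1..K. S2 k) = int d"
        unfolding d by (simp add: sum.distrib)
      finally have "cf n ?rhs e = of_nat d" by simp
      moreover have "cf n (?G d) e = 1"
        unfolding e_def using nu len True by (subst cf_schur_sum_beta) (auto simp: n_def)
      ultimately show ?thesis
        by (simp only: coefficient_const_mult coeff [OF gr] coeff [OF graded_schur_sum] mult_1_right)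
    qed
  qed
  then show "of_nat (Suc d') * fps_nth (Abs_fps ?G) (Suc d') = ?rhs"
    unfolding lhs_eq [symmetric] by (simp only: d_def fps_nth_Abs_fps)
qed


section \<open>Elementary symmetric functions\<close>

lemma logd_hom:
  assumes h: "is_hom h" and F: "logd F L"
  shows "logd (Abs_fps (\<lambda>n. h (fps_nth F n))) (Abs_fps (\<lambda>n. h (fps_nth L n)))"
proof (rule logd_recI)
  show "fps_nth (Abs_fps (\<lambda>n. h (fps_nth F n))) 0 = 1"
    using F h by (simp add: logd_def is_hom_simps)
next
  fix n
  have "h (of_nat (Suc n) * fps_nth F (Suc n)) = h (\<Sum>i\<le>n. fps_nth F i * fps_nth L (n - i))"
    by (simp only: logd_rec [OF F])
  then show "of_nat (Suc n) * fps_nth (Abs_fps (\<lambda>n. h (fps_nth F n))) (Suc n) =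
      (\<Sum>i\<le>n. fps_nth (Abs_fps (\<lambda>n. h (fps_nth F n))) i * fps_nth (Abs_fps (\<lambda>n. h (fps_nth L n))) (n - i))"
    by (simp only: is_hom_simps [OF h] is_hom_of_nat [OF h] is_hom_sum [OF h] fps_nth_Abs_fps)
qed

text \<open>Replacing z by c z multiplies coefficient n by c ^ n; the derivative supplies one more
  factor c.\<close>

lemma logd_scale:
  assumes F: "logd F L"
  shows "logd (Abs_fps (\<lambda>n. c ^ n * fps_nth F n)) (Abs_fps (\<lambda>n. c ^ Suc n * fps_nth L n))"
proof (rule logd_recI)
  show "fps_nth (Abs_fps (\<lambda>n. c ^ n * fps_nth F n)) 0 = 1"
    using F by (simp add: logd_def)
next
  fix n
  have "of_nat (Suc n) * (c ^ Suc n * fps_nth F (Suc n)) = c ^ Suc n * (of_nat (Suc n) * fps_nth F (Suc n))"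
    by (simp only: mult.left_commute)
  also have "\<dots> = (\<Sum>i\<le>n. c ^ Suc n * (fps_nth F i * fps_nth L (n - i)))"
    by (simp only: logd_rec [OF F] sum_distrib_left)
  also have "\<dots> = (\<Sum>i\<le>n. (c ^ i * fps_nth F i) * (c ^ Suc (n - i) * fps_nth L (n - i)))"
  proof (rule sum.cong [OF refl])
    fix i assume "i \<in> {..n}"
    then have "c ^ Suc n = c ^ i * c ^ Suc (n - i)" by (subst power_add [symmetric]) simp
    then show "c ^ Suc n * (fps_nth F i * fps_nth L (n - i)) = (c ^ i * fps_nth F i) * (c ^ Suc (n - i) * fps_nth L (n - i))"
      by (simp only: mult_ac)
  qed
  finally show "of_nat (Suc n) * fps_nth (Abs_fps (\<lambda>n. c ^ n * fps_nth F n)) (Suc n) =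
      (\<Sum>i\<le>n. fps_nth (Abs_fps (\<lambda>n. c ^ n * fps_nth F n)) i * fps_nth (Abs_fps (\<lambda>n. c ^ Suc n * fps_nth L n)) (n - i))"
    by (simp only: fps_nth_Abs_fps)
qed

text \<open>The second series is the expansion of c / (1 + c z).\<close>

lemma logd_linear: "logd (1 + fps_const c * fps_X) (Abs_fps (\<lambda>k. c * (- c) ^ k))"
proof (rule logd_recI)
  fix n :: nat
  let ?F = "1 + fps_const c * fps_X" and ?L = "Abs_fps (\<lambda>k. c * (- c) ^ k)"
  have F: "fps_nth ?F i = (if i = 0 then 1 else if i = 1 then c else 0)" for i
    by (simp add: fps_X_def)
  show "of_nat (Suc n) * fps_nth ?F (Suc n) = (\<Sum>i\<le>n. fps_nth ?F i * fps_nth ?L (n - i))"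
  proof (cases n)
    case 0
    then show ?thesis by (simp add: F)
  next
    case (Suc m)
    have "(\<Sum>i\<le>n. fps_nth ?F i * fps_nth ?L (n - i)) = (\<Sum>i\<in>{0, 1}. fps_nth ?F i * fps_nth ?L (n - i))"
      using Suc by (intro sum.mono_neutral_right) (auto simp: F)
    also have "\<dots> = 0" using Suc by (simp add: F)
    finally show ?thesis using Suc by (simp add: F)
  qed
qed simp

lemma logd_prod:
  "finite S \<Longrightarrow> (\<And>i. i \<in> S \<Longrightarrow> logd (F i) (L i)) \<Longrightarrow> logd (\<Prod>i\<in>S. F i) (\<Sum>i\<in>S. L i)"
  by (induction S rule: finite_induct) (simp_all add: logd_1 logd_mult)

lemma fps_nth_prod_linear:
  fixes c :: "nat \<Rightarrow> 'a::comm_ring_1"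
  assumes "finite S"
  shows "fps_nth (\<Prod>i\<in>S. 1 + fps_const (c i) * fps_X) r = (\<Sum>A | A \<subseteq> S \<and> card A = r. \<Prod>i\<in>A. c i)"
proof -
  have "(\<Prod>i\<in>S. 1 + fps_const (c i) * fps_X) = (\<Sum>A\<in>Pow S. \<Prod>i\<in>A. fps_const (c i) * fps_X)"
    using prod_add [OF assms, of "\<lambda>i. fps_const (c i) * fps_X" "\<lambda>_. 1"] by (simp add: add.commute)
  also have "\<dots> = (\<Sum>A\<in>Pow S. fps_const (\<Prod>i\<in>A. c i) * fps_X ^ card A)"
  proof (rule sum.cong [OF refl])
    fix A assume "A \<in> Pow S"
    have "(\<Prod>i\<in>A. fps_const (c i)) = fps_const (\<Prod>i\<in>A. c i)"
      by (induction A rule: infinite_finite_induct) (simp_all flip: fps_const_mult)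
    then show "(\<Prod>i\<in>A. fps_const (c i) * fps_X) = fps_const (\<Prod>i\<in>A. c i) * fps_X ^ card A"
      by (simp add: prod.distrib)
  qed
  also have "fps_nth \<dots> r = (\<Sum>A\<in>Pow S. if card A = r then \<Prod>i\<in>A. c i else 0)"
    by (simp add: fps_sum_nth fps_X_power_iff) (intro sum.cong, auto)
  also have "\<dots> = (\<Sum>A | A \<subseteq> S \<and> card A = r. \<Prod>i\<in>A. c i)"
    by (rule sum.mono_neutral_cong_right) (use assms in auto)
  finally show ?thesis .
qed

text \<open>The elementary symmetric function e_r, obtained from h_r[-X] = (-1)^r e_r.\<close>

definition elem :: "nat \<Rightarrow> sym" where
  "elem r = (- 1) ^ r * fps_nth (Omega (- XX)) r"

lemma adams_XX: "adams k (psum (Suc 0)) = psum k"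
  by (simp add: adams_psum)

lemma logd_elem: "logd (Abs_fps elem) (Abs_fps (\<lambda>n. (- 1) ^ n * psum (Suc n)))"
proof -
  have "Abs_fps elem = Abs_fps (\<lambda>n. (- 1) ^ n * fps_nth (Omega (- XX)) n)"
    by (simp add: elem_def [abs_def])
  moreover have "Abs_fps (\<lambda>n. (- 1) ^ n * psum (Suc n)) =
      Abs_fps (\<lambda>n. (- 1) ^ Suc n * fps_nth (Abs_fps (\<lambda>n. adams (Suc n) (- XX))) n :: sym)"
    by (simp add: is_hom_uminus [OF is_hom_adams] adams_XX)
  ultimately show ?thesis using logd_scale [OF logd_Omega [of "- XX"], of "- 1"] by (simp only:)
qed

text \<open>In n variables the series of the e_r has the same logarithmic derivative as the product
  of the factors 1 + x_i z.\<close>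

lemma expand_elem: "expand n (elem r) = (\<Sum>A | A \<subseteq> {..<n} \<and> card A = r. \<Prod>i\<in>A. var i)"
proof -
  let ?E = "Abs_fps (\<lambda>r. expand n (elem r))" and ?L = "\<Sum>i<n. Abs_fps (\<lambda>k. var i * (- var i) ^ k) :: rat poly mpol fps"
  have "expand n ((- 1) ^ k * psum (Suc k)) = fps_nth ?L k" for k
  proof -
    have "expand n ((- 1) ^ k) = (- 1) ^ k"
      by (simp only: is_hom_power [OF is_hom_expand] is_hom_uminus [OF is_hom_expand] is_hom_simps [OF is_hom_expand])
    moreover have "expand n (psum (Suc k)) = (\<Sum>i<n. var i ^ Suc k)" by (rule expand_psum) simp
    ultimately have "expand n ((- 1) ^ k * psum (Suc k)) = (\<Sum>i<n. (- 1) ^ k * var i ^ Suc k)"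
      by (simp only: is_hom_simps [OF is_hom_expand] sum_distrib_left)
    also have "\<dots> = (\<Sum>i<n. var i * (- var i) ^ k)"
    proof (rule sum.cong [OF refl])
      fix i :: nat
      show "(- 1) ^ k * var i ^ Suc k = var i * (- var i :: rat poly mpol) ^ k"
        by (subst power_minus) (simp only: power_Suc mult_ac)
    qed
    finally show ?thesis by (simp add: fps_sum_nth)
  qed
  then have "Abs_fps (\<lambda>k. expand n (fps_nth (Abs_fps (\<lambda>n. (- 1) ^ n * psum (Suc n))) k)) = ?L"
    by (intro fps_ext) (simp only: fps_nth_Abs_fps)
  moreover have "logd ?E (Abs_fps (\<lambda>k. expand n (fps_nth (Abs_fps (\<lambda>n. (- 1) ^ n * psum (Suc n))) k)))"
    using logd_hom [OF is_hom_expand logd_elem, of n] by (simp only: fps_nth_Abs_fps)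
  ultimately have "logd ?E ?L" by (simp only:)
  moreover have "logd (\<Prod>i<n. 1 + fps_const (var i) * fps_X) ?L"
    by (intro logd_prod logd_linear) simp
  ultimately have "?E = (\<Prod>i<n. 1 + fps_const (var i) * fps_X)"
    by (rule logd_unique)
  then have "fps_nth ?E r = fps_nth (\<Prod>i<n. 1 + fps_const (var i) * fps_X) r" by (simp only:)
  then show ?thesis by (simp add: fps_nth_prod_linear)
qed

text \<open>On bead positions this removes one cell from each row in A, that is, a vertical strip
  whenever the result is again strictly decreasing.\<close>

definition dec_on :: "nat set \<Rightarrow> (nat \<Rightarrow> nat) \<Rightarrow> nat \<Rightarrow> nat" where
  "dec_on A e i = (if i \<in> A then e i - 1 else e i)"

lemma lookup_prod_var_mult:
  assumes A: "A \<subseteq> {..<n}"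
  shows "lookup ((\<Prod>i\<in>A. var i) * Q :: 'a::comm_ring_1 mpol) (expo n e) =
    (if \<forall>i\<in>A. 1 \<le> e i then lookup Q (expo n (dec_on A e)) else 0)"
proof -
  define a where "a = (\<Sum>i\<in>A. single i (1::nat))"
  have fin: "finite A" using A finite_subset by blast
  have P: "(\<Prod>i\<in>A. var i) = single a (1 :: 'a)"
    unfolding a_def using fin by (induction A rule: finite_induct) (simp_all add: var_def mult_single)
  have la: "lookup a i = (if i \<in> A then 1 else 0)" for i
    using fin by (simp add: a_def lookup_sum lookup_single when_def)
  show ?thesis
  proof (cases "\<forall>i\<in>A. 1 \<le> e i")
    case True
    then have "expo n e = a + expo n (dec_on A e)"
      using A by (intro poly_mapping_eqI) (auto simp: lookup_add la lookup_expo dec_on_def)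
    then show ?thesis using True by (simp add: P lookup_single_mult_add)
  next
    case False
    then obtain i where i: "i \<in> A" "e i = 0" by (auto simp: not_le)
    have "expo n e \<noteq> a + m" for m
    proof
      assume "expo n e = a + m"
      then have "lookup (expo n e) i = 1 + lookup m i" using i by (simp add: lookup_add la)
      then show False using i by (simp add: lookup_expo split: if_splits)
    qed
    then show ?thesis using False unfolding P by (subst lookup_single_mult_0) auto
  qed
qed

lemma cf_elem_mult:
  "cf n (elem r * P) e = (\<Sum>A | A \<subseteq> {..<n} \<and> card A = r. if \<forall>i\<in>A. 1 \<le> e i then cf n P (dec_on A e) else 0)"
proof -
  have "cf n (elem r * P) e =
      lookup (\<Sum>A | A \<subseteq> {..<n} \<and> card A = r. (\<Prod>i\<in>A. var i) * (expand n P * alt n (delta n))) (expo n e)"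
    by (simp add: cf_def is_hom_simps [OF is_hom_expand] expand_elem sum_distrib_right mult.assoc)
  then show ?thesis
    unfolding lookup_sum cf_def by (simp only:) (intro sum.cong refl, simp add: lookup_prod_var_mult)
qed

lemma cf_const_mult: "cf n (const a * P) e = a * cf n P e"
  by (simp add: cf_def is_hom_simps [OF is_hom_expand] mult.assoc lookup_const_mult)

text \<open>The scalar c is general because c = -1 gives \<open>Omega (- XX)\<close> and c = 1 the
  series of the e_r. Summing over r merges the subsets of size r into all subsets.\<close>

lemma cf_elem_series:
  "cf n (fps_nth (Abs_fps (\<lambda>r. const (c ^ r) * elem r) * F) d) e =
    (\<Sum>A\<in>Pow {..<n}. if card A \<le> d \<and> (\<forall>i\<in>A. 1 \<le> e i)
      then c ^ card A * cf n (fps_nth F (d - card A)) (dec_on A e) else 0)"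
proof -
  define f where "f A = (if \<forall>i\<in>A. 1 \<le> e i then c ^ card A * cf n (fps_nth F (d - card A)) (dec_on A e) else 0)" for A
  have "cf n (fps_nth (Abs_fps (\<lambda>r. const (c ^ r) * elem r) * F) d) e =
      (\<Sum>r\<le>d. c ^ r * cf n (elem r * fps_nth F (d - r)) e)"
    by (simp add: fps_mult_nth atLeast0AtMost cf_sum mult.assoc cf_const_mult)
  also have "\<dots> = (\<Sum>r\<le>d. \<Sum>A | A \<subseteq> {..<n} \<and> card A = r. f A)"
    unfolding cf_elem_mult sum_distrib_left by (intro sum.cong refl) (auto simp: f_def)
  also have "\<dots> = (\<Sum>r\<le>d. sum f {A \<in> {A \<in> Pow {..<n}. card A \<le> d}. card A = r})"
    by (intro sum.cong refl) auto
  also have "\<dots> = sum f {A \<in> Pow {..<n}. card A \<le> d}"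
    by (rule sum.group) auto
  also have "\<dots> = (\<Sum>A\<in>Pow {..<n}. if card A \<le> d \<and> (\<forall>i\<in>A. 1 \<le> e i)
      then c ^ card A * cf n (fps_nth F (d - card A)) (dec_on A e) else 0)"
    by (rule sum.mono_neutral_cong_left) (auto simp: f_def)
  finally show ?thesis .
qed

lemma sum_dec_on:
  assumes "A \<subseteq> {..<n}" "\<forall>i\<in>A. 1 \<le> e i"
  shows "(\<Sum>i<n. dec_on A e i) + card A = (\<Sum>i<n. e i)"
proof -
  have "(\<Sum>i<n. e i) = (\<Sum>i<n. dec_on A e i + (if i \<in> A then 1 else 0))"
    using assms by (intro sum.cong) (auto simp: dec_on_def)
  also have "\<dots> = (\<Sum>i<n. dec_on A e i) + card A"
    using assms(1) by (simp add: sum.distrib Int_absorb1 flip: sum.inter_restrict)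
  finally show ?thesis ..
qed

lemma strict_decI:
  assumes "\<And>i. Suc i < n \<Longrightarrow> e (Suc i) < e i"
  shows "strict_dec n e"
  unfolding strict_dec_def
proof (intro allI impI)
  fix i j assume "i < j \<and> j < n"
  then have "Suc i \<le> j" "j < n" by auto
  then show "e j < e i"
  proof (induction j rule: dec_induct)
    case (step m)
    then show ?case using assms [of m] by linarith
  qed (use assms in simp)
qed


section \<open>Littlewood's identities\<close>

text \<open>Adding or removing x is a sign-reversing involution on S.\<close>

lemma toggle_cancel:
  assumes S: "finite S" "\<And>A. A \<in> S \<Longrightarrow> finite A"
    and closed: "\<And>A. A \<in> S \<Longrightarrow> insert x A \<in> S" "\<And>A. A \<in> S \<Longrightarrow> A - {x} \<in> S"
  shows "(\<Sum>A\<in>S. (- 1) ^ card A) = (0 :: 'a::comm_ring_1)"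
proof -
  define S0 where "S0 = {A \<in> S. x \<notin> A}"
  have split: "S = S0 \<union> insert x ` S0" and disj: "S0 \<inter> insert x ` S0 = {}"
  proof -
    have "A \<in> insert x ` S0" if "A \<in> S" "x \<in> A" for A
      using that closed(2) [of A] by (intro image_eqI [of _ _ "A - {x}"]) (auto simp: S0_def)
    then show "S = S0 \<union> insert x ` S0" using closed(1) by (auto simp: S0_def)
  qed (auto simp: S0_def)
  have inj: "inj_on (insert x) S0"
    by (rule inj_onI) (auto simp: S0_def dest: insert_ident [THEN iffD1, rotated 2])
  have "finite S0" using S(1) by (simp add: S0_def)
  then have "(\<Sum>A\<in>S. (- 1) ^ card A) = (\<Sum>A\<in>S0. (- 1) ^ card A) + (\<Sum>A\<in>S0. (- 1) ^ card (insert x A) :: 'a)"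
    by (subst split) (simp add: sum.union_disjoint disj sum.reindex [OF inj])
  also have "(\<Sum>A\<in>S0. (- 1) ^ card (insert x A)) = (\<Sum>A\<in>S0. - ((- 1) ^ card A) :: 'a)"
    by (intro sum.cong) (auto simp: S0_def S(2))
  finally show ?thesis by (simp add: sum_negf)
qed

text \<open>\<open>Suc i\<close> is not confined to {m..<N} by the condition, so a tie at the last
  index N - 1 keeps that index out of A.\<close>

definition chains :: "(nat \<Rightarrow> bool) \<Rightarrow> nat \<Rightarrow> nat \<Rightarrow> nat set set" where
  "chains t N m = {A. A \<subseteq> {m..<N} \<and> (\<forall>i\<in>A. t i \<longrightarrow> Suc i \<in> A)}"

lemma finite_chains: "finite (chains t N m)" "A \<in> chains t N m \<Longrightarrow> finite A"
proof -
  have "chains t N m \<subseteq> Pow {m..<N}" by (auto simp: chains_def)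
  then show "finite (chains t N m)" by (rule finite_subset) simp
  show "A \<in> chains t N m \<Longrightarrow> finite A" by (auto simp: chains_def intro: finite_subset)
qed

definition chain_sum :: "(nat \<Rightarrow> bool) \<Rightarrow> nat \<Rightarrow> nat \<Rightarrow> 'a::comm_ring_1" where
  "chain_sum t N m = (\<Sum>A\<in>chains t N m. (- 1) ^ card A)"

text \<open>The sets \<open>A\<close> in \<open>chains t N m\<close> are the vertical strips that can be removed from a partition
  whose rows \<open>i\<close> and \<open>i + 1\<close> have equal length iff \<open>t i\<close>; they cancel in pairs that
  differ by one element.\<close>

lemma chain_sum_untied: "m < N \<Longrightarrow> \<not> t m \<Longrightarrow> chain_sum t N m = 0"
  unfolding chain_sum_def
  by (rule toggle_cancel [where x = m]) (auto simp: finite_chains, auto simp: chains_def)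

text \<open>If A contains m + 1, then m can be added or removed freely, and these sets cancel.
  Otherwise the tie keeps m out as well, and A lies in {m + 2..<N}.\<close>

lemma chain_sum_tied:
  assumes "Suc m < N" "t m"
  shows "chain_sum t N m = chain_sum t N (m + 2)"
proof -
  define S where "S = {A \<in> chains t N m. Suc m \<in> A}"
  have "chains t N m = S \<union> chains t N (m + 2)"
  proof (intro equalityI subsetI)
    fix A assume A: "A \<in> chains t N m"
    show "A \<in> S \<union> chains t N (m + 2)"
    proof (cases "Suc m \<in> A")
      case False
      then have "m \<notin> A" using A assms(2) by (auto simp: chains_def)
      have "i \<ge> m + 2" if "i \<in> A" for i
      proof -
        have "i \<ge> m" "i \<noteq> m" "i \<noteq> Suc m" using that A False \<open>m \<notin> A\<close> by (auto simp: chains_def)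
        then show ?thesis by simp
      qed
      then show ?thesis using A by (auto simp: chains_def)
    qed (use A in \<open>simp add: S_def\<close>)
  next
    fix A assume "A \<in> S \<union> chains t N (m + 2)"
    then show "A \<in> chains t N m" by (fastforce simp: S_def chains_def)
  qed
  moreover have "S \<inter> chains t N (m + 2) = {}" by (auto simp: S_def chains_def)
  moreover have "finite S" by (simp add: S_def finite_chains)
  ultimately have "chain_sum t N m = (\<Sum>A\<in>S. (- 1) ^ card A) + (chain_sum t N (m + 2) :: 'a)"
    unfolding chain_sum_def by (simp add: sum.union_disjoint finite_chains)
  also have "(\<Sum>A\<in>S. (- 1) ^ card A) = (0 :: 'a)"
    by (rule toggle_cancel [where x = m]) (use assms in \<open>auto simp: S_def finite_chains, auto simp: chains_def\<close>)
  finally show ?thesis by simp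
qed

text \<open>The largest element of a nonempty A would need its successor in A.\<close>

lemma chain_sum_all_tied:
  assumes "\<And>i. m \<le> i \<Longrightarrow> i < N \<Longrightarrow> t i"
  shows "chain_sum t N m = 1"
proof -
  have "A = {}" if A: "A \<in> chains t N m" for A
  proof (rule ccontr)
    assume "A \<noteq> {}"
    then have "Max A \<in> A" using finite_chains(2) [OF A] by simp
    then have "Suc (Max A) \<in> A" using A assms by (auto simp: chains_def)
    then have "Suc (Max A) \<le> Max A" using finite_chains(2) [OF A] by simp
    then show False by simp
  qed
  then have "chains t N m = {{}}" by (auto simp: chains_def)
  then show ?thesis by (simp add: chain_sum_def)
qed

text \<open>Equal rows are removed two at a time from the top, which preserves the parity of every
  column, until either nothing is left or the two top rows differ.\<close>

lemma chain_sum_rows: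
  assumes anti: "\<And>i j. i \<le> j \<Longrightarrow> v j \<le> (v i :: nat)" and zero: "\<And>i. l \<le> i \<Longrightarrow> v i = 0" and "l < N"
  shows "chain_sum (\<lambda>i. v i = v (Suc i)) N m =
    ((if \<forall>j. even (card {i. m \<le> i \<and> i < l \<and> j < v i}) then 1 else 0) :: 'a::comm_ring_1)"
proof (induction "l - m" arbitrary: m rule: less_induct)
  case less
  show ?case
  proof (cases "l \<le> m")
    case True
    have e: "{i. m \<le> i \<and> i < l \<and> j < v i} = {}" for j using True by auto
    show ?thesis unfolding e using True zero by (simp add: chain_sum_all_tied)
  next
    case m: False
    show ?thesis
    proof (cases "v m = v (Suc m)")
      case True
      have "even (card {i. m \<le> i \<and> i < l \<and> j < v i}) \<longleftrightarrow> even (card {i. m + 2 \<le> i \<and> i < l \<and> j < v i})" for j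
      proof (cases "j < v m")
        case j: True
        then have "Suc m < l" using True zero [of "Suc m"] by (cases "Suc m < l") auto
        have "{i. m \<le> i \<and> i < l \<and> j < v i} = insert m (insert (Suc m) {i. m + 2 \<le> i \<and> i < l \<and> j < v i})"
          using True j \<open>Suc m < l\<close> by (auto simp: le_less Suc_le_eq)
        then show ?thesis by simp
      next
        case j: False
        then have "\<not> j < v i" if "m \<le> i" for i using anti [OF that] by simp
        then have a: "{i. m \<le> i \<and> i < l \<and> j < v i} = {}" and b: "{i. m + 2 \<le> i \<and> i < l \<and> j < v i} = {}" by auto
        show ?thesis unfolding a b ..
      qed
      moreover have "chain_sum (\<lambda>i. v i = v (Suc i)) N m = (chain_sum (\<lambda>i. v i = v (Suc i)) N (m + 2) :: 'a)"
        using m \<open>l < N\<close> True by (intro chain_sum_tied) auto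
      moreover have "l - (m + 2) < l - m" using m by arith
      note less [OF this]
      ultimately show ?thesis by (simp only:)
    next
      case False
      \<comment> \<open>Column \<open>v (Suc m)\<close> then contains only the cell of row m, so it
        is odd, in agreement with the vanishing of the untied sum.\<close>
      then have lt: "v (Suc m) < v m" using anti [of m "Suc m"] by simp
      have "{i. m \<le> i \<and> i < l \<and> v (Suc m) < v i} = {m}"
      proof -
        have "i = m" if "m \<le> i" "v (Suc m) < v i" for i
          using that anti [of "Suc m" i] by (cases "i = m") auto
        then show ?thesis using m lt by auto
      qed
      then have "odd (card {i. m \<le> i \<and> i < l \<and> v (Suc m) < v i})" by simp
      then have "\<not> (\<forall>j. even (card {i. m \<le> i \<and> i < l \<and> j < v i}))" by blast
      then show ?thesis using False m \<open>l < N\<close> by (simp only: if_False) (rule chain_sum_untied, auto)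
    qed
  qed
qed

section \<open>Removing vertical strips: relations between the sums of Schur functions\<close>

lemma graded_fps_eqI:
  fixes F G :: "sym fps"
  assumes gr: "\<And>d. graded {d} (fps_nth F d)" "\<And>d. graded {d} (fps_nth G d)"
    and eq: "\<And>d nu. nu \<in> Par d \<Longrightarrow>
      cf (d + 2) (fps_nth F d) (beta (d + 2) nu) = cf (d + 2) (fps_nth G d) (beta (d + 2) nu)"
  shows "F = G"
proof (rule fps_ext)
  fix d
  show "fps_nth F d = fps_nth G d"
  proof (rule schur_eqI)
    fix nu assume nu: "is_partition nu"
    show "coefficient schur nu (fps_nth F d) = coefficient schur nu (fps_nth G d)"
    proof (cases "psize nu = d")
      case True
      then have len: "length nu \<le> d + 2" using length_le_psize [OF nu] by simp
      have "coefficient schur nu P = cf (d + 2) P (beta (d + 2) nu)" if "graded {d} P" for P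
        unfolding cf_def using nu len by (intro coefficient_eq_lookup graded_mono [OF that]) auto
      then show ?thesis using gr eq [of nu d] nu True by (simp add: Par_def)
    next
      case False
      then have "coefficient schur nu P = 0" if "graded {d} P" for P
        using coefficient_graded(2) [OF that, of nu] by auto
      then show ?thesis using gr by simp
    qed
  qed
qed

lemma graded_elem: "graded {r} (elem r)"
proof -
  have "graded {r} (fps_nth (Abs_fps elem) r)"
  proof (rule logd_graded [OF logd_elem])
    fix n :: nat
    have "graded {0} ((- 1) ^ n :: sym)"
      using graded_const [of "(- 1) ^ n"] by (simp add: const_power const_uminus)
    then have "graded {0 + Suc n} ((- 1) ^ n * psum (Suc n) :: sym)"
      by (intro graded_hom_mult graded_psum) auto
    then show "graded {Suc n} (fps_nth (Abs_fps (\<lambda>n. (- 1) ^ n * psum (Suc n) :: sym)) n)" by simp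
  qed auto
  then show ?thesis by simp
qed

lemma graded_elem_series:
  assumes "\<And>d. graded {d} (fps_nth F d)"
  shows "graded {d} (fps_nth (Abs_fps (\<lambda>r. const (c r) * elem r) * F) d)"
  unfolding fps_mult_nth fps_nth_Abs_fps
proof (rule graded_sum)
  fix i assume "i \<in> {0..d}"
  moreover have "graded {i + (d - i)} (const (c i) * elem i * fps_nth F (d - i))"
    by (intro graded_hom_mult graded_const_mult graded_elem assms)
  ultimately show "graded {d} (const (c i) * elem i * fps_nth F (d - i))" by simp
qed

lemma Omega_minus_XX: "Omega (- XX) = Abs_fps (\<lambda>r. const ((- 1) ^ r) * elem r)"
proof (rule fps_ext)
  fix r
  have "const ((- 1) ^ r) * ((- 1) ^ r :: sym) = 1"
    by (simp add: const_power const_uminus flip: power_mult_distrib)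
  then show "fps_nth (Omega (- XX)) r = fps_nth (Abs_fps (\<lambda>r. const ((- 1) ^ r) * elem r)) r"
    by (simp add: elem_def mult.assoc [symmetric])
qed

text \<open>Lowering strictly decreasing exponents by at most 1 either keeps them strictly
  decreasing, giving a partition, or makes two neighbours equal, and then the coefficient is 0 by
  antisymmetry.\<close>

lemma cf_elem_schur_sum:
  fixes c :: "rat poly"
  assumes nu: "nu \<in> Par d" and n: "d \<le> n"
  defines "e \<equiv> beta n nu"
  shows "cf n (fps_nth (Abs_fps (\<lambda>r. const (c ^ r) * elem r) * Abs_fps (schur_sum S)) d) e =
    (\<Sum>A\<in>Pow {..<n}. if (\<forall>i\<in>A. 1 \<le> e i) \<and> strict_dec n (dec_on A e) \<and> strip n (\<lambda>j. dec_on A e j - delta n j) \<in> S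
      then c ^ card A else 0)"
  unfolding cf_elem_series
proof (rule sum.cong [OF refl])
  fix A assume A: "A \<in> Pow {..<n}"
  have dec: "strict_dec n e" unfolding e_def using nu by (intro strict_dec_beta) (simp add: Par_def)
  have sum_e: "(\<Sum>i<n. e i) = d + (\<Sum>i<n. delta n i)"
    unfolding e_def using nu n length_le_psize [of nu] by (subst sum_beta) (auto simp: Par_def)
  show "(if card A \<le> d \<and> (\<forall>i\<in>A. 1 \<le> e i)
      then c ^ card A * cf n (fps_nth (Abs_fps (schur_sum S)) (d - card A)) (dec_on A e) else 0) =
    (if (\<forall>i\<in>A. 1 \<le> e i) \<and> strict_dec n (dec_on A e) \<and> strip n (\<lambda>j. dec_on A e j - delta n j) \<in> S
      then c ^ card A else 0)"
  proof (cases "\<forall>i\<in>A. 1 \<le> e i")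
    case pos: True
    have sum_dec: "(\<Sum>i<n. dec_on A e i) + card A = d + (\<Sum>i<n. delta n i)"
      using sum_dec_on [of A n e] A pos sum_e by simp
    show ?thesis
    proof (cases "strict_dec n (dec_on A e)")
      case True
      define la where "la = strip n (\<lambda>j. dec_on A e j - delta n j)"
      note la = strict_dec_partition [OF True, folded la_def]
      have sz: "psize la + card A = d" using la(4) sum_dec by simp
      have "cf n (schur_sum S (d - card A)) (dec_on A e) = cf n (schur_sum S (d - card A)) (beta n la)"
        by (rule antisymmetricD(1) [OF antisymmetric_cf_schur_sum]) (use la(3) n in auto)
      also have "\<dots> = (if la \<in> S then 1 else 0)"
        using sz n la by (subst cf_schur_sum_beta) auto
      finally show ?thesis using pos True sz by (simp add: la_def)
    next
      case False
      have "cf n (schur_sum S (d - card A)) (dec_on A e) = 0"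
      proof -
        obtain i where i: "Suc i < n" "\<not> dec_on A e (Suc i) < dec_on A e i"
          using False strict_decI by blast
        have "e (Suc i) < e i" using dec i by (simp add: strict_dec_def)
        then have "dec_on A e i = dec_on A e (Suc i)"
          using i(2) by (auto simp: dec_on_def split: if_splits)
        then show ?thesis
          using i n by (intro antisymmetric_repeat [OF antisymmetric_cf_schur_sum, of _ _ i "Suc i"]) auto
      qed
      then show ?thesis using False by simp
    qed
  qed auto
qed

lemma part_strip_dec_on:
  assumes nu: "is_partition nu" and dec: "strict_dec n (dec_on A (beta n nu))" and i: "i < n"
    and pos: "\<forall>i\<in>A. 1 \<le> beta n nu i"
  shows "part (strip n (\<lambda>j. dec_on A (beta n nu) j - delta n j)) i + (if i \<in> A then 1 else 0) = part nu i"
  using strict_dec_partition(3) [OF dec i] pos by (auto simp: dec_on_def beta_def split: if_splits)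

text \<open>On the right the coefficient at \<open>nu\<close> counts the vertical strips removable
  from \<open>nu\<close>, with sign (-1)^size; \<open>chain_sum_rows\<close> evaluates it to 1 or 0
  according to the parity of the columns.\<close>

lemma schur_sum_VDom:
  "Abs_fps (schur_sum (diamond_partitions VDom)) = Omega (- XX) * Abs_fps (schur_sum UNIV)"
proof (rule graded_fps_eqI)
  fix d nu assume nu: "nu \<in> Par d"
  \<comment> \<open>Row d + 1 is empty with exponent 0 and cannot be lowered, so strips lie in the
    first d + 1 rows. These exceed the length of \<open>nu\<close>, as \<open>chain_sum_rows\<close>
    requires.\<close>
  define n where "n = d + 2"
  define e where "e = beta n nu"
  define v where "v = part nu"
  have "d \<le> n" by (simp add: n_def)
  have part: "is_partition nu" and len: "length nu \<le> d" using nu length_le_psize [of nu] by (auto simp: Par_def)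
  have v0: "v i = 0" if "length nu \<le> i" for i using that by (simp add: v_def part_def)
  have dec: "strict_dec n e" unfolding e_def by (rule strict_dec_beta [OF part])
  have e: "e i = v i + (Suc d - i)" for i by (simp add: e_def n_def v_def beta_def delta_def)
  have iff: "(\<forall>i\<in>A. 1 \<le> e i) \<and> strict_dec n (dec_on A e) \<longleftrightarrow> A \<in> chains (\<lambda>i. v i = v (Suc i)) (Suc d) 0"
    if A: "A \<subseteq> {..<n}" for A
  proof
    assume *: "(\<forall>i\<in>A. 1 \<le> e i) \<and> strict_dec n (dec_on A e)"
    then have "Suc d \<notin> A" using v0 len by (auto simp: e)
    then have "A \<subseteq> {0..<Suc d}" using A by (auto simp: n_def less_Suc_eq)
    moreover have "Suc i \<in> A" if i: "i \<in> A" "v i = v (Suc i)" for i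
    proof (rule ccontr)
      assume "Suc i \<notin> A"
      have "i < Suc d" using i \<open>A \<subseteq> {0..<Suc d}\<close> by auto
      then have "dec_on A e (Suc i) < dec_on A e i" using * by (simp add: strict_dec_def n_def)
      then show False using i \<open>Suc i \<notin> A\<close> \<open>i < Suc d\<close> by (simp add: dec_on_def e)
    qed
    ultimately show "A \<in> chains (\<lambda>i. v i = v (Suc i)) (Suc d) 0" by (simp add: chains_def)
  next
    assume *: "A \<in> chains (\<lambda>i. v i = v (Suc i)) (Suc d) 0"
    have "dec_on A e (Suc i) < dec_on A e i" if i: "Suc i < n" for i
    proof -
      have le: "v (Suc i) \<le> v i" unfolding v_def by (rule part_antitone [OF part]) simp
      moreover have "v (Suc i) \<noteq> v i" if "i \<in> A" "Suc i \<notin> A" using that * by (auto simp: chains_def)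
      ultimately have lt: "v (Suc i) < v i" if "i \<in> A" "Suc i \<notin> A" using that by simp
      have e1: "e i = v i + Suc (d - i)" "e (Suc i) = v (Suc i) + (d - i)"
        using i by (simp_all add: e n_def Suc_diff_le)
      have "0 < d - i" if "Suc i \<in> A" using that * by (auto simp: chains_def)
      then show ?thesis
        using lt le by (cases "i \<in> A"; cases "Suc i \<in> A") (simp_all add: dec_on_def e1)
    qed
    then have "strict_dec n (dec_on A e)" by (rule strict_decI)
    moreover have "1 \<le> e i" if "i \<in> A" for i using that * by (auto simp: chains_def e)
    ultimately show "(\<forall>i\<in>A. 1 \<le> e i) \<and> strict_dec n (dec_on A e)" by blast
  qed
  have "cf n (fps_nth (Omega (- XX) * Abs_fps (schur_sum UNIV)) d) e =
      (\<Sum>A\<in>Pow {..<n}. if A \<in> chains (\<lambda>i. v i = v (Suc i)) (Suc d) 0 then (- 1) ^ card A else 0)"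
    unfolding Omega_minus_XX e_def cf_elem_schur_sum [OF nu \<open>d \<le> n\<close>]
    by (rule sum.cong [OF refl]) (use iff in \<open>simp add: e_def\<close>)
  also have "\<dots> = chain_sum (\<lambda>i. v i = v (Suc i)) (Suc d) 0"
    unfolding chain_sum_def
    by (rule sum.mono_neutral_cong_right) (auto simp: chains_def n_def)
  also have "\<dots> = (if \<forall>j. even (column_length nu j) then 1 else 0)"
  proof -
    have c: "{i. 0 \<le> i \<and> i < length nu \<and> j < v i} = {i. i < length nu \<and> j < nu ! i}" for j
      by (auto simp: v_def part_def)
    have "length nu < Suc d" using len by simp
    then show ?thesis
      using chain_sum_rows [of v "length nu" "Suc d" 0, where 'a = "rat poly"] part_antitone [OF part] v0
      unfolding column_length_def c by (simp add: v_def)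
  qed
  also have "\<dots> = cf n (fps_nth (Abs_fps (schur_sum (diamond_partitions VDom))) d) e"
    unfolding e_def using part len nu by (simp add: cf_schur_sum_beta n_def Par_def)
  finally show "cf (d + 2) (fps_nth (Abs_fps (schur_sum (diamond_partitions VDom))) d) (beta (d + 2) nu) =
      cf (d + 2) (fps_nth (Omega (- XX) * Abs_fps (schur_sum UNIV)) d) (beta (d + 2) nu)"
    by (simp add: e_def n_def)
qed (simp add: graded_schur_sum, unfold Omega_minus_XX, rule graded_elem_series, simp add: graded_schur_sum)

text \<open>From each partition exactly one vertical strip can be removed so that all rows become even:
  the last cells of the odd rows.\<close>

lemma schur_sum_HDom:
  "Abs_fps elem * Abs_fps (schur_sum (diamond_partitions HDom)) = Abs_fps (schur_sum UNIV)"
proof -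
  let ?H = "diamond_partitions HDom"
  have elem: "Abs_fps elem = Abs_fps (\<lambda>r. const (1 ^ r) * elem r)" by simp
  show ?thesis
    unfolding elem
  proof (rule graded_fps_eqI)
    fix d nu assume nu: "nu \<in> Par d"
    define n where "n = d + 2"
    define e where "e = beta n nu"
    have "d \<le> n" by (simp add: n_def)
    have part: "is_partition nu" and len: "length nu \<le> n"
      using nu length_le_psize [of nu] by (auto simp: Par_def n_def)
    have dec: "strict_dec n e" unfolding e_def by (rule strict_dec_beta [OF part])
    define B where "B = {i. i < n \<and> odd (part nu i)}"
    have even_iff: "la \<in> ?H \<longleftrightarrow> (\<forall>i<n. even (part la i))" if "is_partition la" "length la \<le> n" for la
      using that by (auto simp: part_def all_set_conv_all_nth)
    have iff: "(\<forall>i\<in>A. 1 \<le> e i) \<and> strict_dec n (dec_on A e) \<and> strip n (\<lambda>j. dec_on A e j - delta n j) \<in> ?H \<longleftrightarrow> A = B"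
      if A: "A \<subseteq> {..<n}" for A
    proof
      assume *: "(\<forall>i\<in>A. 1 \<le> e i) \<and> strict_dec n (dec_on A e) \<and> strip n (\<lambda>j. dec_on A e j - delta n j) \<in> ?H"
      define la where "la = strip n (\<lambda>j. dec_on A e j - delta n j)"
      have la: "is_partition la" "length la \<le> n"
        unfolding la_def using strict_dec_partition [of n "dec_on A e"] * by auto
      have "i \<in> A \<longleftrightarrow> odd (part nu i)" if i: "i < n" for i
      proof -
        have eq: "part la i + (if i \<in> A then 1 else 0) = part nu i"
          unfolding la_def e_def using * i by (intro part_strip_dec_on part) (auto simp: e_def)
        moreover have "even (part la i)" using * even_iff [OF la] i by (simp add: la_def)
        ultimately show ?thesis by (cases "i \<in> A") (simp_all flip: eq)
      qed
      then show "A = B" using A by (auto simp: B_def)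
    next
      assume AB: "A = B"
      have pos: "\<forall>i\<in>A. 1 \<le> e i" by (auto simp: AB B_def e_def beta_def elim!: oddE)
      have rows: "dec_on A e i = 2 * (part nu i div 2) + delta n i" if "i < n" for i
        using that by (auto simp: AB B_def dec_on_def e_def beta_def elim!: oddE)
      have "dec_on A e (Suc i) < dec_on A e i" if "Suc i < n" for i
      proof -
        have "part nu (Suc i) div 2 \<le> part nu i div 2"
          by (intro div_le_mono part_antitone part) simp
        then show ?thesis using that by (simp add: rows delta_def)
      qed
      then have sd: "strict_dec n (dec_on A e)" by (rule strict_decI)
      define la where "la = strip n (\<lambda>j. dec_on A e j - delta n j)"
      note la = strict_dec_partition [OF sd, folded la_def]
      have "part la i = 2 * (part nu i div 2)" if "i < n" for i
        using la(3) [OF that] rows [OF that] by (simp add: beta_def)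
      then have "la \<in> ?H" using even_iff [OF la(1,2)] by simp
      then show "(\<forall>i\<in>A. 1 \<le> e i) \<and> strict_dec n (dec_on A e) \<and> strip n (\<lambda>j. dec_on A e j - delta n j) \<in> ?H"
        using pos sd by (simp only: la_def)
    qed
    have "cf n (fps_nth (Abs_fps (\<lambda>r. const (1 ^ r) * elem r) * Abs_fps (schur_sum ?H)) d) e =
        (\<Sum>A\<in>Pow {..<n}. if A = B then 1 else 0)"
      unfolding e_def cf_elem_schur_sum [OF nu \<open>d \<le> n\<close>]
    proof (rule sum.cong [OF refl])
      fix A assume "A \<in> Pow {..<n}"
      then show "(if (\<forall>i\<in>A. 1 \<le> beta n nu i) \<and> strict_dec n (dec_on A (beta n nu)) \<and>
          strip n (\<lambda>j. dec_on A (beta n nu) j - delta n j) \<in> ?H then 1 ^ card A else 0) = (if A = B then 1 else (0 :: rat poly))"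
        using iff [of A] by (simp only: e_def power_one Pow_iff)
    qed
    also have "\<dots> = 1" by (simp add: B_def) auto
    also have "\<dots> = cf n (fps_nth (Abs_fps (schur_sum UNIV)) d) e"
      unfolding e_def using part len nu by (simp add: cf_schur_sum_beta n_def Par_def)
    finally show "cf (d + 2) (fps_nth (Abs_fps (\<lambda>r. const (1 ^ r) * elem r) * Abs_fps (schur_sum ?H)) d) (beta (d + 2) nu) =
        cf (d + 2) (fps_nth (Abs_fps (schur_sum UNIV)) d) (beta (d + 2) nu)"
      by (simp only: e_def n_def)
  qed (rule graded_elem_series, simp_all add: graded_schur_sum)
qed


section \<open>Comparison with plethystic exponentials\<close>

definition sq :: "'a::zero fps \<Rightarrow> 'a fps" where
  "sq F = Abs_fps (\<lambda>n. if even n then fps_nth F (n div 2) else 0)"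

text \<open>\<open>sq F\<close> is F(z^2), with derivative 2 z F'(z^2). For a domino g, of degree 2,
  it converts the series variable of \<open>Omega g\<close> into the degree.\<close>

lemma logd_sq:
  assumes F: "logd F L"
  shows "logd (sq F) (Abs_fps (\<lambda>n. if odd n then 2 * fps_nth L (n div 2) else 0))"
proof (rule logd_recI)
  show "fps_nth (sq F) 0 = 1" using F by (simp add: sq_def logd_def)
next
  fix n :: nat
  let ?L = "Abs_fps (\<lambda>n. if odd n then 2 * fps_nth L (n div 2) else 0)"
  show "of_nat (Suc n) * fps_nth (sq F) (Suc n) = (\<Sum>i\<le>n. fps_nth (sq F) i * fps_nth ?L (n - i))"
  proof (cases "even n")
    case True
    then have "(\<Sum>i\<le>n. fps_nth (sq F) i * fps_nth ?L (n - i)) = 0"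
      by (intro sum.neutral) (auto simp: sq_def)
    then show ?thesis using True by (simp add: sq_def)
  next
    case False
    then obtain m where m: "n = 2 * m + 1" by (elim oddE)
    have half: "(Suc (2 * m) - 2 * b) div 2 = m - b" for b by presburger
    have "(\<Sum>i\<le>n. fps_nth (sq F) i * fps_nth ?L (n - i)) =
        (\<Sum>i\<in>{i. i \<le> n \<and> even i}. fps_nth F (i div 2) * (2 * fps_nth L ((n - i) div 2)))"
      using False by (intro sum.mono_neutral_cong_right) (auto simp: sq_def)
    also have "\<dots> = (\<Sum>i\<le>m. fps_nth F i * (2 * fps_nth L (m - i)))"
      by (rule sum.reindex_bij_witness [of _ "\<lambda>i. 2 * i" "\<lambda>i. i div 2"]) (auto simp: m half elim!: evenE)
    also have "\<dots> = 2 * (of_nat (Suc m) * fps_nth F (Suc m))"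
      unfolding logd_rec [OF F] by (simp add: sum_distrib_left mult.left_commute)
    also have "\<dots> = of_nat (Suc n) * fps_nth (sq F) (Suc n)"
      by (simp add: m sq_def algebra_simps)
    finally show ?thesis ..
  qed
qed

lemma Par_1: "Par 1 = {[1]}"
proof (intro equalityI subsetI)
  fix la assume "la \<in> Par 1"
  then have la: "is_partition la" "psize la = 1" by (auto simp: Par_def)
  show "la \<in> {[1]}"
  proof (cases la)
    case (Cons a xs)
    then have "a \<noteq> 0" "0 \<notin> set xs" "a + psize xs = 1" using la by (auto simp: is_partition_def)
    then have "psize xs = 0" "a = 1" by linarith+
    then have "xs = []" using \<open>0 \<notin> set xs\<close> by (cases xs) auto
    then show ?thesis using Cons \<open>a = 1\<close> by simp
  qed (use la in simp)
qed (auto simp: Par_def is_partition_def)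

lemma Par_2: "Par 2 = {[2], [1, 1]}"
proof (intro equalityI subsetI)
  fix la assume "la \<in> Par 2"
  then have la: "is_partition la" "psize la = 2" by (auto simp: Par_def)
  show "la \<in> {[2], [1, 1]}"
  proof (cases la)
    case (Cons a xs)
    then have a: "a \<noteq> 0" "0 \<notin> set xs" "a + psize xs = 2" "is_partition xs" using la by (auto simp: is_partition_def)
    then consider "a = 2" "psize xs = 0" | "a = 1" "psize xs = 1" by linarith
    then show ?thesis
    proof cases
      case 1
      then have "xs = []" using a by (cases xs) auto
      then show ?thesis using Cons 1 by simp
    next
      case 2
      then have "xs \<in> Par 1" using a by (simp add: Par_def)
      then show ?thesis using Cons 2 by (simp add: Par_1 [simplified])
    qed
  qed (use la in simp)
qed (auto simp: Par_def is_partition_def)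

lemma schur_Nil: "schur [] = 1"
  unfolding schur_def
  by (rule the1_equality [OF schur_ex1(1)]) (auto simp: is_partition_def is_hom_simps [OF is_hom_expand])

lemma schur_sum_0: "schur_sum UNIV 0 = 1"
  using logd_schur_sum by (simp add: logd_def)

lemma schur_1: "schur [1] = psum 1"
proof -
  have "schur_sum UNIV 1 = psum 1"
    using logd_rec [OF logd_schur_sum, of 0] by (simp add: schur_sum_0 box_deriv_def)
  then show ?thesis using Par_1 by (simp add: schur_sum_def)
qed

lemma logd_VDom:
  "logd (Abs_fps (schur_sum (diamond_partitions VDom)))
    (Abs_fps (\<lambda>n. if odd n then psum (Suc n div 2) ^ 2 - psum (Suc n) else 0))"
proof -
  have "Abs_fps (\<lambda>n. adams (Suc n) (- XX)) + box_deriv =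
      Abs_fps (\<lambda>n. if odd n then psum (Suc n div 2) ^ 2 - psum (Suc n) else 0)"
    by (rule fps_ext) (simp add: box_deriv_def is_hom_uminus [OF is_hom_adams] adams_XX)
  then show ?thesis
    unfolding schur_sum_VDom using logd_mult [OF logd_Omega logd_schur_sum, of "- XX"] by (simp only:)
qed

text \<open>[1, 1] is the only partition of 2 with even columns, so the recursion of
  \<open>logd_VDom\<close> in degree 2 computes s_11 without expanding determinants.\<close>

lemma two_schur_11: "2 * schur [1, 1] = psum 1 ^ 2 - psum 2"
proof -
  let ?V = "diamond_partitions VDom"
  have cl: "column_length [1, 1] j = (if j = 0 then 2 else 0)" "column_length [2] 0 = 1" for j
  proof -
    have "{i. i < length [1, 1 :: nat] \<and> j < [1, 1 :: nat] ! i} = (if j = 0 then {0, 1} else {})"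
      by (auto simp: nth_Cons' split: if_splits)
    then show "column_length [1, 1] j = (if j = 0 then 2 else 0)" by (simp add: column_length_def)
    have "{i. i < length [2 :: nat] \<and> 0 < [2 :: nat] ! i} = {0}" by auto
    then show "column_length [2] 0 = 1" by (simp add: column_length_def)
  qed
  have "[2] \<notin> ?V" using cl(2) by (metis diamond_partitions.simps(4) mem_Collect_eq odd_one)
  moreover have "[1, 1] \<in> ?V" using cl(1) by (simp add: is_partition_def)
  ultimately have "Par 2 \<inter> ?V = {[1, 1]}" unfolding Par_2 by auto
  then have V2: "schur_sum ?V 2 = schur [1, 1]" by (simp add: schur_sum_def)
  have V0: "schur_sum ?V 0 = 1" using logd_VDom by (simp add: logd_def)
  have V1: "schur_sum ?V 1 = 0" using logd_rec [OF logd_VDom, of 0] by simp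
  have "2 * schur_sum ?V 2 = psum 1 ^ 2 - psum 2"
    using logd_rec [OF logd_VDom, of 1] V0 V1 by (simp add: numeral_2_eq_2)
  then show ?thesis by (simp only: V2)
qed

lemma half_2: "const [:1 / 2:] * 2 = (1 :: sym)"
proof -
  have "(2 :: sym) = const [:2:]"
    using const_of_nat [of 2, where 'a = "rat poly"] by (simp add: numeral_poly)
  then show ?thesis by (simp only: const_mult [symmetric]) (simp flip: one_pCons)
qed

lemma schur_11: "schur [1, 1] = const [:1 / 2:] * (psum 1 ^ 2 - psum 2)"
  unfolding two_schur_11 [symmetric] by (simp add: mult.assoc [symmetric] half_2)

lemma schur_2: "schur [2] = const [:1 / 2:] * (psum 1 ^ 2 + psum 2)"
proof -
  have "schur_sum UNIV 1 = psum 1" using Par_1 by (simp add: schur_sum_def schur_1 [simplified])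
  then have "2 * schur_sum UNIV 2 = 2 * psum 1 ^ 2"
    using logd_rec [OF logd_schur_sum, of 1]
    by (simp add: schur_sum_0 box_deriv_def numeral_2_eq_2)
  moreover have "schur_sum UNIV 2 = schur [2] + schur [1, 1]"
    by (simp add: schur_sum_def Par_2)
  ultimately have "2 * schur [2] = 2 * psum 1 ^ 2 - 2 * schur [1, 1]"
    by (simp add: algebra_simps)
  also have "\<dots> = psum 1 ^ 2 + psum 2" unfolding two_schur_11 by simp
  finally have "2 * schur [2] = psum 1 ^ 2 + psum 2" .
  then have "const [:1 / 2:] * (2 * schur [2]) = const [:1 / 2:] * (psum 1 ^ 2 + psum 2)" by (simp only:)
  then show ?thesis by (simp add: mult.assoc [symmetric] half_2)
qed

lemma adams_quadratic:
  "k \<ge> 1 \<Longrightarrow> adams k (const [:1 / 2:] * (psum 1 ^ 2 - psum 2)) = const [:1 / 2:] * (psum k ^ 2 - psum (2 * k))"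
  "k \<ge> 1 \<Longrightarrow> adams k (const [:1 / 2:] * (psum 1 ^ 2 + psum 2)) = const [:1 / 2:] * (psum k ^ 2 + psum (2 * k))"
  using adams_psum [of 2 k] adams_XX [of k]
  by (simp_all add: is_hom_simps [OF is_hom_adams] is_hom_diff [OF is_hom_adams] is_hom_power [OF is_hom_adams]
      adams_const adams_coeff_const)

lemma two_half: "2 * (const [:1 / 2:] * P) = (P :: sym)"
  by (simp add: mult.assoc [symmetric] mult.commute [of 2] half_2)

text \<open>By \<open>schur_11\<close>, 2 p_k[s_11] = p_k^2 - p_(2k), which is the logarithmic
  derivative already found for partitions with even columns.\<close>

lemma VDom_series: "Abs_fps (schur_sum (diamond_partitions VDom)) = sq (Omega (schur [1, 1]))"
proof (rule logd_unique [OF logd_VDom])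
  have "Abs_fps (\<lambda>n. if odd n then 2 * fps_nth (Abs_fps (\<lambda>n. adams (Suc n) (schur [1, 1]))) (n div 2) else 0) =
      Abs_fps (\<lambda>n. if odd n then psum (Suc n div 2) ^ 2 - psum (Suc n) else 0)"
    by (rule fps_ext) (auto simp: schur_11 [simplified] adams_quadratic [simplified] two_half elim!: oddE)
  then show "logd (sq (Omega (schur [1, 1]))) (Abs_fps (\<lambda>n. if odd n then psum (Suc n div 2) ^ 2 - psum (Suc n) else 0))"
    using logd_sq [OF logd_Omega, of "schur [1, 1]"] by (simp only:)
qed

text \<open>After multiplication by the series of the e_r both sides have the logarithmic derivative
  \<open>box_deriv\<close>: the e_r contribute - p_(2k), which cancels the p_(2k) from s_2. The
  common factor is then cancelled in the integral domain of power series.\<close>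

lemma HDom_series: "Abs_fps (schur_sum (diamond_partitions HDom)) = sq (Omega (schur [2]))"
proof -
  have "Abs_fps (\<lambda>n. (- 1) ^ n * psum (Suc n)) +
      Abs_fps (\<lambda>n. if odd n then 2 * fps_nth (Abs_fps (\<lambda>n. adams (Suc n) (schur [2]))) (n div 2) else 0) = box_deriv"
    by (rule fps_ext) (auto simp: box_deriv_def schur_2 adams_quadratic [simplified] two_half elim!: oddE)
  then have "logd (Abs_fps elem * sq (Omega (schur [2]))) box_deriv"
    using logd_mult [OF logd_elem logd_sq [OF logd_Omega, of "schur [2]"]] by (simp only:)
  then have "Abs_fps elem * sq (Omega (schur [2])) = Abs_fps elem * Abs_fps (schur_sum (diamond_partitions HDom))"
    unfolding schur_sum_HDom by (rule logd_unique [OF _ logd_schur_sum])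
  moreover have "Abs_fps elem \<noteq> 0"
    using logd_elem unfolding logd_def by (metis fps_zero_nth zero_neq_one)
  ultimately show ?thesis by simp
qed

lemma Box_series: "Abs_fps (schur_sum UNIV) = Omega (psum 1) * sq (Omega (schur [1, 1]))"
proof (rule logd_unique [OF logd_schur_sum])
  have "Abs_fps (\<lambda>n. adams (Suc n) (psum 1)) +
      Abs_fps (\<lambda>n. if odd n then psum (Suc n div 2) ^ 2 - psum (Suc n) else 0) = box_deriv"
    by (rule fps_ext) (simp add: box_deriv_def adams_XX)
  then show "logd (Omega (psum 1) * sq (Omega (schur [1, 1]))) box_deriv"
    using logd_mult [OF logd_Omega logd_VDom, of "psum 1"] by (simp only: VDom_series)
qed

text \<open>p_k raises t to the k-th power as well, so a factor t ^ j in the alphabet acts as z -> t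
  ^ j z.\<close>

lemma Omega_scale: "Omega (const (tvar ^ j) * A) = Abs_fps (\<lambda>n. const (tvar ^ (j * n)) * fps_nth (Omega A) n)"
proof (rule logd_unique [OF logd_Omega])
  have "adams (Suc n) (const (tvar ^ j) * A) = const (tvar ^ j) ^ Suc n * adams (Suc n) A" for n
  proof -
    have "adams_coeff (Suc n) (tvar ^ j) = (tvar ^ j) ^ Suc n"
      by (simp only: is_hom_power [OF is_hom_adams_coeff] adams_coeff_tvar power_mult [symmetric] mult.commute)
    then show ?thesis
      by (simp only: is_hom_simps [OF is_hom_adams] adams_const) (simp only: const_power)
  qed
  then have "Abs_fps (\<lambda>n. adams (Suc n) (const (tvar ^ j) * A)) =
      Abs_fps (\<lambda>n. const (tvar ^ j) ^ Suc n * fps_nth (Abs_fps (\<lambda>n. adams (Suc n) A)) n)"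
    by (simp only: fps_nth_Abs_fps)
  moreover have "Abs_fps (\<lambda>n. const (tvar ^ (j * n)) * fps_nth (Omega A) n) =
      Abs_fps (\<lambda>n. const (tvar ^ j) ^ n * fps_nth (Omega A) n)"
    by (simp only: const_power power_mult)
  ultimately show "logd (Abs_fps (\<lambda>n. const (tvar ^ (j * n)) * fps_nth (Omega A) n))
      (Abs_fps (\<lambda>n. adams (Suc n) (const (tvar ^ j) * A)))"
    using logd_scale [OF logd_Omega] by (simp only:)
qed

lemma f_diamond_t_eq:
  "f_diamond_t Empty = 0"
  "f_diamond_t Box = const (tvar ^ 1) * psum 1 + const (tvar ^ 2) * schur [1, 1]"
  "f_diamond_t HDom = const (tvar ^ 2) * schur [2]"
  "f_diamond_t VDom = const (tvar ^ 2) * schur [1, 1]"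
proof -
  have ad: "adams k (const tvar * XX) = const (tvar ^ k) * psum k" for k
    by (simp add: is_hom_simps [OF is_hom_adams] adams_const adams_coeff_tvar adams_XX)
  have hom: "is_hom (\<lambda>P. pleth P (const tvar * XX))"
    unfolding pleth_def by (rule is_hom_psubst [OF is_hom_const])
  have p: "pleth (psum k) (const tvar * XX) = const (tvar ^ k) * psum k" if "k \<ge> 1" for k
    using that by (simp only: pleth_def psubst_psum [OF is_hom_const] ad)
  have c: "pleth (const a) (const tvar * XX) = const a" for a
    by (simp only: pleth_def psubst_const [OF is_hom_const])
  have 11: "pleth (schur [1, 1]) (const tvar * XX) = const (tvar ^ 2) * schur [1, 1]"
    unfolding schur_11 is_hom_simps [OF hom] is_hom_diff [OF hom] is_hom_power [OF hom] c
    by (simp only: p one_le_numeral order_refl power_one_right power_mult_distrib const_power right_diff_distrib mult_ac)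
  have 2: "pleth (schur [2]) (const tvar * XX) = const (tvar ^ 2) * schur [2]"
    unfolding schur_2 is_hom_simps [OF hom] is_hom_power [OF hom] c
    by (simp only: p one_le_numeral order_refl power_one_right power_mult_distrib const_power distrib_left mult_ac)
  show "f_diamond_t Empty = 0" using is_hom_simps(1) [OF hom] by (simp add: f_diamond_t_def)
  show "f_diamond_t HDom = const (tvar ^ 2) * schur [2]" "f_diamond_t VDom = const (tvar ^ 2) * schur [1, 1]"
    by (simp_all only: f_diamond_t_def f_diamond.simps 11 2)
  show "f_diamond_t Box = const (tvar ^ 1) * psum 1 + const (tvar ^ 2) * schur [1, 1]"
    by (simp only: f_diamond_t_def f_diamond.simps schur_1 is_hom_simps [OF hom] 11 p order_refl)
qed

lemma graded_f_diamond: "graded {1..} (f_diamond d)" "graded {1..} (f_diamond_t d)"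
proof -
  have s: "graded {1..} (psum 1 :: sym)" "graded {1..} (schur [1, 1])" "graded {1..} (schur [2])"
    by (rule graded_mono [OF graded_psum] graded_mono [OF graded_schur]; simp add: is_partition_def)+
  show "graded {1..} (f_diamond d)"
    by (cases d) (use s in \<open>auto simp only: f_diamond.simps schur_1 intro!: graded_add graded_0\<close>)
  show "graded {1..} (f_diamond_t d)"
    by (cases d) (use s in \<open>auto simp only: f_diamond_t_eq intro!: graded_add graded_0 graded_const_mult\<close>)
qed

text \<open>The summands of \<open>\<Omega>[f\<^sub>\<diamondsuit>[tX]]\<close> are not homogeneous in the auxiliary variable of
  \<open>Omega\<close>, so a partial sum also contains an incomplete part of higher degree.\<close>

lemma Omega_f_diamond_t:
  "\<exists>J. graded {N<..} J \<and> (\<Sum>n\<le>N. fps_nth (Omega (f_diamond_t d)) n) =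
    (\<Sum>m\<le>N. const (tvar ^ m) * schur_sum (diamond_partitions d) m) + J"
proof -
  define T where "T m = const (tvar ^ m) * schur_sum (diamond_partitions d) m" for m
  have T: "graded {m} (T m)" for m
    unfolding T_def by (intro graded_const_mult graded_schur_sum)
  have domino: "\<exists>J. graded {N<..} J \<and> (\<Sum>n\<le>N. fps_nth (Omega (f_diamond_t d)) n) = (\<Sum>m\<le>N. T m) + J"
    if f: "f_diamond_t d = const (tvar ^ 2) * g" and g: "Abs_fps (schur_sum (diamond_partitions d)) = sq (Omega g)" for g
  proof -
    have sum: "schur_sum (diamond_partitions d) m = (if even m then fps_nth (Omega g) (m div 2) else 0)" for m
      using arg_cong [OF g, of "\<lambda>F. fps_nth F m"] by (simp add: sq_def)
    \<comment> \<open>Series index n carries degree 2 n, so the partial sum up to N reaches degree 2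
      N; the terms with 2 n > N form the remainder.\<close>
    have O: "fps_nth (Omega (f_diamond_t d)) n = T (2 * n)" for n
      by (simp add: f Omega_scale T_def sum)
    have "(\<Sum>n\<le>N. T (2 * n)) = (\<Sum>n\<in>{n. 2 * n \<le> N}. T (2 * n)) + (\<Sum>n\<in>{n. n \<le> N \<and> N < 2 * n}. T (2 * n))"
      by (subst sum.union_disjoint [symmetric])
        (auto intro: finite_subset [of _ "{..N}"] intro!: sum.cong)
    also have "(\<Sum>n\<in>{n. 2 * n \<le> N}. T (2 * n)) = (\<Sum>m\<in>{m. m \<le> N \<and> even m}. T m)"
      by (rule sum.reindex_bij_witness [of _ "\<lambda>m. m div 2" "\<lambda>n. 2 * n"]) auto
    also have "\<dots> = (\<Sum>m\<le>N. T m)"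
      by (rule sum.mono_neutral_left) (auto simp: T_def sum)
    finally have "(\<Sum>n\<le>N. fps_nth (Omega (f_diamond_t d)) n) = (\<Sum>m\<le>N. T m) + (\<Sum>n\<in>{n. n \<le> N \<and> N < 2 * n}. T (2 * n))"
      by (simp only: O)
    moreover have "graded {N<..} (\<Sum>n\<in>{n. n \<le> N \<and> N < 2 * n}. T (2 * n))"
      by (intro graded_sum graded_mono [OF T]) auto
    ultimately show ?thesis by blast
  qed
  have "\<exists>J. graded {N<..} J \<and> (\<Sum>n\<le>N. fps_nth (Omega (f_diamond_t d)) n) = (\<Sum>m\<le>N. T m) + J"
  proof (cases d)
    case Empty
    have "T m = (if m = 0 then 1 else 0)" for m
    proof -
      have "Par m \<inter> {[]} = (if m = 0 then {[]} else {})" by (auto simp: Par_def is_partition_def)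
      then show ?thesis by (simp add: T_def Empty schur_sum_def schur_Nil)
    qed
    moreover have "fps_nth (Omega (f_diamond_t d)) n = (if n = 0 then 1 else 0)" for n
      by (simp add: Empty f_diamond_t_eq Omega_0)
    ultimately show ?thesis by (intro exI [of _ 0]) simp
  next
    case HDom
    show ?thesis by (rule domino [of "schur [2]"]) (simp_all only: HDom f_diamond_t_eq HDom_series)
  next
    case VDom
    show ?thesis by (rule domino [of "schur [1, 1]"]) (simp_all only: VDom f_diamond_t_eq VDom_series)
  next
    case Box
    \<comment> \<open>The term of series index a + b and degree a + 2 b: the partial sum is bounded
      in the first and has to be regrouped by the second.\<close>
    define u where "u a b = const (tvar ^ (a + 2 * b)) * (fps_nth (Omega (psum 1)) a * fps_nth (Omega (schur [1, 1])) b)" for a b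
    have gr: "graded {a + 2 * b} (u a b)" for a b
    proof -
      have "graded {a} (fps_nth (Omega (psum 1)) a)"
        by (rule logd_graded [OF logd_Omega]) (auto simp: adams_XX graded_psum)
      moreover have "graded {2 * b} (fps_nth (Omega (schur [1, 1])) b)"
      proof -
        have "schur_sum (diamond_partitions VDom) (2 * b) = fps_nth (Omega (schur [1, 1])) b"
          using arg_cong [OF VDom_series, of "\<lambda>F. fps_nth F (2 * b)"] by (simp add: sq_def)
        then show ?thesis using graded_schur_sum [of "2 * b" "diamond_partitions VDom"] by simp
      qed
      ultimately show ?thesis unfolding u_def by (intro graded_const_mult graded_hom_mult)
    qed
    have "fps_nth (Omega (f_diamond_t d)) n = (\<Sum>a\<le>n. u a (n - a))" for n
      by (simp only: Box f_diamond_t_eq Omega_add Omega_scale fps_mult_nth atLeast0AtMost fps_nth_Abs_fps u_def)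
        (simp only: power_add const_mult mult_1 mult_1_right mult_ac)
    then have "(\<Sum>n\<le>N. fps_nth (Omega (f_diamond_t d)) n) = (\<Sum>(a, b)\<in>{(a, b). a + b \<le> N}. u a b)"
      by (simp only: sum.triangle_reindex_eq)
    also have "\<dots> = (\<Sum>(a, b)\<in>{(a, b). a + 2 * b \<le> N}. u a b) + (\<Sum>(a, b)\<in>{(a, b). a + b \<le> N \<and> N < a + 2 * b}. u a b)"
    proof (subst sum.union_disjoint [symmetric])
      show "finite {(a, b). a + 2 * b \<le> N}" "finite {(a, b). a + b \<le> N \<and> N < a + 2 * b}"
        by (rule finite_subset [of _ "{..N} \<times> {..N}"]; auto)+
    qed (auto intro!: sum.cong)
    also have "(\<Sum>(a, b)\<in>{(a, b). a + 2 * b \<le> N}. u a b) = (\<Sum>m\<le>N. T m)"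
    proof -
      have Tm: "T m = (\<Sum>a\<in>{a. a \<le> m \<and> even (m - a)}. u a ((m - a) div 2))" for m
      proof -
        have "Abs_fps (schur_sum (diamond_partitions Box)) = Abs_fps (schur_sum UNIV)"
          by (rule fps_ext) (auto simp: schur_sum_def Par_def intro!: sum.cong)
        then have "T m = const (tvar ^ m) * fps_nth (Omega (psum 1) * sq (Omega (schur [1, 1]))) m"
          unfolding T_def Box Box_series [symmetric] by (metis fps_nth_Abs_fps)
        also have "\<dots> = (\<Sum>a\<le>m. const (tvar ^ m) * (fps_nth (Omega (psum 1)) a * fps_nth (sq (Omega (schur [1, 1]))) (m - a)))"
          by (simp only: fps_mult_nth atLeast0AtMost sum_distrib_left)
        also have "\<dots> = (\<Sum>a\<in>{a. a \<le> m \<and> even (m - a)}. u a ((m - a) div 2))"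
          by (rule sum.mono_neutral_cong_right) (auto simp: sq_def u_def)
        finally show ?thesis .
      qed
      have "(\<Sum>m\<le>N. T m) = (\<Sum>(m, a)\<in>(SIGMA m:{..N}. {a. a \<le> m \<and> even (m - a)}). u a ((m - a) div 2))"
        unfolding Tm by (rule sum.Sigma) auto
      also have "\<dots> = (\<Sum>(a, b)\<in>{(a, b). a + 2 * b \<le> N}. u a b)"
        by (rule sum.reindex_bij_witness [of _ "\<lambda>(a, b). (a + 2 * b, a)" "\<lambda>(m, a). (a, (m - a) div 2)"]) auto
      finally show ?thesis ..
    qed
    finally have "(\<Sum>n\<le>N. fps_nth (Omega (f_diamond_t d)) n) =
        (\<Sum>m\<le>N. T m) + (\<Sum>(a, b)\<in>{(a, b). a + b \<le> N \<and> N < a + 2 * b}. u a b)" .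
    moreover have "graded {N<..} (\<Sum>(a, b)\<in>{(a, b). a + b \<le> N \<and> N < a + 2 * b}. u a b)"
      by (rule graded_sum) (auto intro!: graded_mono [OF gr])
    ultimately show ?thesis by blast
  qed
  then show ?thesis by (simp only: T_def)
qed


section \<open>Homogeneity of the \<open>t\<close>-analogue\<close>

text \<open>The joint degree in both alphabets: X sits in the coefficients and Y in the exponents of
  a \<open>sym2\<close>.\<close>

definition total_graded :: "nat \<Rightarrow> sym2 \<Rightarrow> bool" where
  "total_graded d Q \<longleftrightarrow> (\<forall>m\<in>keys Q. graded {k. k + wt m = d} (lookup Q m))"

lemma total_graded_lookup: "total_graded d Q \<Longrightarrow> graded {k. k + wt m = d} (lookup Q m)"
  by (cases "m \<in> keys Q") (auto simp: total_graded_def in_keys_iff)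

lemma total_graded_add: "total_graded d P \<Longrightarrow> total_graded d Q \<Longrightarrow> total_graded d (P + Q)"
  using total_graded_lookup unfolding total_graded_def lookup_add by (blast intro: graded_add)

lemma total_graded_sum: "(\<And>x. x \<in> S \<Longrightarrow> total_graded d (f x)) \<Longrightarrow> total_graded d (sum f S)"
  using total_graded_lookup
  by (induction S rule: infinite_finite_induct) (simp_all add: total_graded_add, simp_all add: total_graded_def)

lemma total_graded_single: "graded {k. k + wt m = d} P \<Longrightarrow> total_graded d (single m P)"
  by (simp add: total_graded_def)

lemma total_graded_mult:
  assumes P: "total_graded a P" and Q: "total_graded b Q"
  shows "total_graded (a + b) (P * Q)"
proof -
  have "P * Q = (\<Sum>m\<in>keys P. single m (lookup P m)) * (\<Sum>m\<in>keys Q. single m (lookup Q m))"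
    by (simp only: sum_single_lookup)
  also have "\<dots> = (\<Sum>m\<in>keys P. \<Sum>m'\<in>keys Q. single (m + m') (lookup P m * lookup Q m'))"
    by (simp add: sum_product mult_single)
  also have "total_graded (a + b) \<dots>"
  proof (intro total_graded_sum total_graded_single)
    fix m m'
    show "graded {k. k + wt (m + m') = a + b} (lookup P m * lookup Q m')"
      by (rule graded_mult [OF total_graded_lookup [OF P] total_graded_lookup [OF Q]]) auto
  qed
  finally show ?thesis .
qed

lemma total_graded_const: "graded {d} P \<Longrightarrow> total_graded d (const P)"
  unfolding const_def by (rule total_graded_single) simp

lemma total_graded_psum: "k \<ge> 1 \<Longrightarrow> total_graded k (psum k)"
  unfolding psum_def var_def by (rule total_graded_single) (auto intro: graded_mono [OF graded_1])

lemma is_hom_const_const: "is_hom (\<lambda>c. const (const c))"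
  by (rule is_hom_comp [OF is_hom_const is_hom_const])

lemma is_hom_const_adams: "is_hom (\<lambda>c. const (adams k c))"
  by (rule is_hom_comp [OF is_hom_const is_hom_adams])

lemma is_hom_adams2: "is_hom (adams2 k)"
  unfolding adams2_def adams_ext_def by (rule is_hom_psubst [OF is_hom_const_adams])

lemma adams2_const: "adams2 k (const P) = const (adams k P)"
  unfolding adams2_def adams_ext_def by (rule psubst_const [OF is_hom_const_adams])

lemma adams2_psum: "adams2 k (psum (Suc 0)) = psum k"
  unfolding adams2_def adams_ext_def using psubst_psum [OF is_hom_const_adams, of 1] by simp

lemma total_graded_pleth2:
  assumes P: "graded {d} P"
  shows "total_graded d (pleth2 P (in_X (const q) * in_X XX + (1 - in_X (const q)) * in_Y XX))"
proof -
  define A where "A = in_X (const q) * in_X XX + (1 - in_X (const q)) * in_Y XX"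
  have Y: "in_Y XX = psum 1"
    unfolding in_Y_def by (rule psubst_psum [OF is_hom_const_const]) simp
  have tg: "total_graded k (adams2 k A)" if k: "k \<ge> 1" for k
  proof -
    \<comment> \<open>This is p_k[qX + (1 - q)Y], with \<open>adams_coeff k q\<close> for the
      coefficient q; both alphabets enter through their k-th power sums only.\<close>
    have "adams2 k A = const (const (adams_coeff k q) * psum k) + const (1 - const (adams_coeff k q)) * psum k"
      by (simp add: A_def Y [simplified] in_X_def is_hom_simps [OF is_hom_adams2] is_hom_diff [OF is_hom_adams2]
          adams2_const adams2_psum adams_const adams_XX const_mult const_diff)
    moreover have "total_graded k (const (const (adams_coeff k q) * psum k))"
      by (intro total_graded_const graded_const_mult graded_psum k)
    moreover have "total_graded (0 + k) (const (1 - const (adams_coeff k q)) * psum k)"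
      by (intro total_graded_mult total_graded_const total_graded_psum k graded_diff graded_1 graded_const)
    ultimately show ?thesis by (simp add: total_graded_add)
  qed
  have ev: "total_graded (wt m) (ev (\<lambda>k. adams2 k A) m)" for m
  proof (induction m rule: exponent_induct)
    case zero
    then show ?case using total_graded_const [OF graded_1] by simp
  next
    case (add i m)
    then have "total_graded (Suc i + wt m) (adams2 (Suc i) A * ev (\<lambda>k. adams2 k A) m)"
      by (intro total_graded_mult tg) auto
    then show ?case by (simp add: ev_add)
  qed
  have "total_graded d (const (const (lookup P m)) * ev (\<lambda>k. adams2 k A) m)" if "m \<in> keys P" for m
  proof -
    have "wt m = d" using that P by (auto simp: graded_def)
    moreover have "total_graded (0 + wt m) (const (const (lookup P m)) * ev (\<lambda>k. adams2 k A) m)"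
      by (intro total_graded_mult total_graded_const graded_const ev)
    ultimately show ?thesis by simp
  qed
  then show ?thesis unfolding pleth2_def psubst_ev A_def [symmetric] by (intro total_graded_sum)
qed

lemma is_hom_Y_to_X: "is_hom Y_to_X"
  unfolding Y_to_X_def by (rule is_hom_psubst [OF is_hom_id])

lemma Y_to_X_in_Y: "Y_to_X (in_Y P) = P"
proof -
  have hom: "is_hom in_Y" unfolding in_Y_def by (rule is_hom_psubst [OF is_hom_const_const])
  have "is_hom (\<lambda>P. Y_to_X (in_Y P))" by (rule is_hom_comp [OF is_hom_Y_to_X hom])
  then show ?thesis
  proof (rule hom_eqI [OF _ is_hom_id])
    show "Y_to_X (in_Y (const c)) = const c" for c
      by (simp only: in_Y_def psubst_const [OF is_hom_const_const] Y_to_X_def psubst_const [OF is_hom_id])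
    show "Y_to_X (in_Y (var i)) = var i" for i
      by (simp only: in_Y_def psubst_var [OF is_hom_const_const] Y_to_X_def psubst_psum [OF is_hom_id])
         (simp add: psum_def psubst_var [OF is_hom_id])
  qed
qed

text \<open>The substitution keeps the joint degree, V raises the degree in Y by s, and identifying
  Y with X adds the two degrees.\<close>

lemma graded_t_analogue:
  assumes P: "graded {d} P" and V: "\<And>k Q. graded {k} Q \<Longrightarrow> graded {k + s} (V Q)"
  shows "graded {d + s} (t_analogue q V P)"
proof -
  define Q where "Q = pleth2 P (in_X (const q) * in_X XX + (1 - in_X (const q)) * in_Y XX)"
  have Q: "total_graded d Q" unfolding Q_def by (rule total_graded_pleth2 [OF P])
  have X: "Y_to_X (in_X R) = R" for R
    by (simp only: in_X_def Y_to_X_def psubst_const [OF is_hom_id])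
  have "t_analogue q V P = (\<Sum>m\<in>keys Q. lookup Q m * V (single m 1))"
    unfolding t_analogue_def Q_def [symmetric]
    by (simp add: act_Y_def is_hom_sum [OF is_hom_Y_to_X] is_hom_simps [OF is_hom_Y_to_X] X Y_to_X_in_Y)
  also have "graded {d + s} \<dots>"
  proof (rule graded_sum)
    fix m
    have "graded {wt m + s} (V (single m 1))" by (intro V graded_single) simp
    then show "graded {d + s} (lookup Q m * V (single m 1))"
      by (rule graded_mult [OF total_graded_lookup [OF Q, of m]]) auto
  qed
  finally show ?thesis .
qed

lemma graded_Omega_XX: "graded {n} (fps_nth (Omega XX) n)" "graded {n} (fps_nth (Omega (- XX)) n)"
  by (rule logd_graded [OF logd_Omega];
      simp add: adams_XX is_hom_uminus [OF is_hom_adams] graded_psum)+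

text \<open>Summand n first lowers the degree by n and then raises it by r + n.\<close>

lemma graded_bernstein:
  assumes "graded {d} P"
  shows "graded {d + r} (bernstein (int r) P)"
  unfolding bernstein_def Sum_any.expand_set
proof (rule graded_sum)
  fix n
  have "nat (int r + int n) = r + n" by simp
  moreover have "graded {k. \<exists>a\<in>{n}. k + a \<in> {d}} (skew (fps_nth (Omega (- XX)) n) P)"
    by (rule graded_skew [OF graded_Omega_XX(2) assms])
  then have "graded {d + r} (fps_nth (Omega XX) (r + n) * skew (fps_nth (Omega (- XX)) n) P)"
    by (rule graded_mult [OF graded_Omega_XX(1)]) auto
  ultimately show "graded {d + r} (if 0 \<le> int r + int n
      then fps_nth (Omega XX) (nat (int r + int n)) * skew (fps_nth (Omega (- XX)) n) P else 0)"
    by (simp del: nat_add_distrib)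
qed

lemma graded_bernstein_list:
  "graded {d} P \<Longrightarrow> graded {d + psize r} (bernstein_list (map int r) P)"
proof (induction r)
  case (Cons a r)
  then have "graded {d + psize r + a} (bernstein (int a) (bernstein_list (map int r) P))"
    by (intro graded_bernstein)
  then show ?case by (simp add: bernstein_list_def add_ac)
qed (simp add: bernstein_list_def)

section \<open>The theorem\<close>

lemma Omega_perp_sum:
  assumes "graded {1..} A"
  shows "Omega_perp A (sum f S) = (\<Sum>x\<in>S. Omega_perp A (f x))"
proof -
  have "Omega_perp A 0 = 0"
    using Omega_perp_const_mult [OF assms, of 0 0] by simp
  then show ?thesis
    by (induction S rule: infinite_finite_induct) (simp_all add: Omega_perp_add_right [OF assms])
qed

lemma Omega_perp_cancel:
  assumes "graded {1..} A" "A + B = 0"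
  shows "Omega_perp A (Omega_perp B P) = P"
proof -
  have "B = - A" using assms(2) by (simp add: eq_neg_iff_add_eq_0 add.commute)
  then have "Omega_perp (A + B) P = Omega_perp A (Omega_perp B P)"
    using assms(1) by (intro Omega_perp_add) simp_all
  then show ?thesis using assms(2) by (simp add: Omega_perp_0_left)
qed

text \<open>The operators of f and of -f are inverse to each other, and the latter maps Schur
  functions to the \<open>s_diamond\<close> family. Hence the two definite descriptions of the
  expansion have the same defining predicate.\<close>

lemma coefficient_s_diamond:
  "coefficient (s_diamond d) la P = coefficient schur la (Omega_perp (f_diamond d) P)"
proof -
  let ?f = "f_diamond d"
  have f: "graded {1..} ?f" "graded {1..} (- ?f)" using graded_f_diamond(1) [of d] by simp_all
  have "P = (\<Sum>la\<in>keys c. const (lookup c la) * s_diamond d la) \<longleftrightarrow>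
      Omega_perp ?f P = (\<Sum>la\<in>keys c. const (lookup c la) * schur la)" for c
  proof -
    have "(\<Sum>la\<in>keys c. const (lookup c la) * s_diamond d la) =
        Omega_perp (- ?f) (\<Sum>la\<in>keys c. const (lookup c la) * schur la)"
      by (simp add: s_diamond_def Omega_perp_sum [OF f(2)] Omega_perp_const_mult [OF f(2)])
    moreover have "P = Omega_perp (- ?f) Q \<longleftrightarrow> Omega_perp ?f P = Q" for Q
      using Omega_perp_cancel [OF f(1), of "- ?f" Q] Omega_perp_cancel [OF f(2), of ?f P] by auto
    ultimately show ?thesis by (simp only:)
  qed
  then show ?thesis by (simp only: coefficient_def expansion_def)
qed

definition t_product :: "nat list list \<Rightarrow> sym" where
  "t_product R = foldr (\<lambda>r. t_analogue (tvar ^ 2) (bernstein_list (map int r))) R 1"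

lemma graded_t_product: "graded {\<Sum>r\<leftarrow>R. psize r} (t_product R)"
proof (induction R)
  case Nil
  then show ?case by (simp add: t_product_def graded_1)
next
  case (Cons r R)
  have "graded {(\<Sum>r\<leftarrow>R. psize r) + psize r} (t_analogue (tvar ^ 2) (bernstein_list (map int r)) (t_product R))"
    by (rule graded_t_analogue [OF Cons graded_bernstein_list])
  then show ?case by (simp add: t_product_def add.commute)
qed

lemma H_diamond_product:
  "foldr (\<lambda>r. H_diamond d (map int r)) R 1 = Omega_perp (f_diamond_t d - f_diamond d) (t_product R)"
proof (induction R)
  case Nil
  have gr: "graded {1..} (f_diamond_t d - f_diamond d)" by (intro graded_diff graded_f_diamond)
  have "graded {..0} (1 :: sym)" by (rule graded_mono [OF graded_1]) simp
  from Omega_perp_eq [OF gr this] show ?case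
    using logd_Omega [of "f_diamond_t d - f_diamond d"]
    by (simp add: t_product_def logd_def skew_1_left)
next
  case (Cons r R)
  have "Omega_perp (f_diamond d - f_diamond_t d) (Omega_perp (f_diamond_t d - f_diamond d) (t_product R)) = t_product R"
    by (rule Omega_perp_cancel [OF graded_diff [OF graded_f_diamond]]) simp
  then show ?case using Cons by (simp add: H_diamond_def t_product_def)
qed

text \<open>The change of basis contributes \<open>f_diamond d\<close> and the telescoped product
  \<open>f_diamond_t d - f_diamond d\<close>; they add up to \<open>f_diamond_t d\<close>.\<close>

lemma K_diamond_eq: "K_diamond d la R = coefficient schur la (Omega_perp (f_diamond_t d) (t_product R))"
proof -
  have "Omega_perp (f_diamond d + (f_diamond_t d - f_diamond d)) (t_product R) =
      Omega_perp (f_diamond d) (Omega_perp (f_diamond_t d - f_diamond d) (t_product R))"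
    by (intro Omega_perp_add graded_diff graded_f_diamond)
  then show ?thesis
    by (simp add: K_diamond_def coefficient_s_diamond H_diamond_product)
qed

theorem mainTheorem6:
  fixes d :: diamond and R :: "nat list list" and la :: "nat list"
  assumes "\<forall>r\<in>set R. is_partition r"
    and "is_partition la"
  defines "N \<equiv> (\<Sum>r\<leftarrow>R. psize r)"
  shows "K_diamond d la R =
    tvar ^ (N - psize la) *
      (\<Sum>ta | is_partition ta \<and> psize ta = N.
         K_diamond Empty ta R *
           (\<Sum>mu | mu \<in> diamond_partitions d \<and> psize mu + psize la = N. LR ta la mu))"
proof -
  define U where "U = t_product R"
  have U: "graded {N} U" unfolding U_def N_def by (rule graded_t_product)
  then have U': "graded {..N} U" by (rule graded_mono) simp
  have K0: "K_diamond Empty ta R = coefficient schur ta U" for ta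
    by (simp add: K_diamond_eq f_diamond_t_eq Omega_perp_0_left U_def)
  let ?S = "schur_sum (diamond_partitions d)"
  \<comment> \<open>J lives in degrees above N, so its product with \<open>schur la\<close> is
    orthogonal to U, which is homogeneous of degree N.\<close>
  obtain J where J: "graded {N<..} J"
    "(\<Sum>n\<le>N. fps_nth (Omega (f_diamond_t d)) n) = (\<Sum>m\<le>N. const (tvar ^ m) * ?S m) + J"
    using Omega_f_diamond_t by blast
  have "K_diamond d la R = scalar (\<Sum>n\<le>N. skew (fps_nth (Omega (f_diamond_t d)) n) U) (schur la)"
    by (simp add: K_diamond_eq U_def [symmetric] Omega_perp_eq [OF graded_f_diamond(2) U'] scalar_schur_right assms(2))
  also have "\<dots> = scalar U ((\<Sum>n\<le>N. fps_nth (Omega (f_diamond_t d)) n) * schur la)"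
    by (simp add: scalar_sum_left scalar_skew sum_distrib_right scalar_sum_right)
  also have "\<dots> = (\<Sum>m\<le>N. tvar ^ m * scalar U (?S m * schur la)) + scalar U (J * schur la)"
    by (simp only: J(2) distrib_right sum_distrib_right scalar_add_right scalar_sum_right mult.assoc scalar_const_mult_right)
  also have "scalar U (J * schur la) = 0"
  proof -
    have "graded {N<..} (J * schur la)"
      by (rule graded_mult [OF J(1) graded_schur [OF assms(2)]]) auto
    then show ?thesis by (rule scalar_graded_disjoint [OF U]) simp
  qed
  \<comment> \<open>Only m = N - psize la matches the degree of U. If \<open>psize la\<close>
    exceeds N, no m remains, just as no \<open>mu\<close> remains in the claim, so the truncated
    exponent of t does no harm.\<close>
  also have "(\<Sum>m\<le>N. tvar ^ m * scalar U (?S m * schur la)) =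
      (\<Sum>m\<in>{m. m + psize la = N}. tvar ^ m * scalar U (?S m * schur la))"
  proof (rule sum.mono_neutral_right)
    show "\<forall>m\<in>{..N} - {m. m + psize la = N}. tvar ^ m * scalar U (?S m * schur la) = 0"
    proof
      fix m assume m: "m \<in> {..N} - {m. m + psize la = N}"
      have "graded {m + psize la} (?S m * schur la)"
        by (rule graded_hom_mult [OF graded_schur_sum graded_schur [OF assms(2)]])
      then have "scalar U (?S m * schur la) = 0"
        by (rule scalar_graded_disjoint [OF U]) (use m in auto)
      then show "tvar ^ m * scalar U (?S m * schur la) = 0" by simp
    qed
  qed auto
  also have "\<dots> = tvar ^ (N - psize la) *
      (\<Sum>ta | is_partition ta \<and> psize ta = N. coefficient schur ta U *
        (\<Sum>mu | mu \<in> diamond_partitions d \<and> psize mu + psize la = N. LR ta la mu))"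
  proof (cases "psize la \<le> N")
    case True
    define M where "M = N - psize la"
    have M: "{m. m + psize la = N} = {M}" using True by (auto simp: M_def)
    have dp: "is_partition mu" if "mu \<in> diamond_partitions d" for mu
      using that by (cases d) (auto simp: is_partition_def)
    have set: "{mu. mu \<in> diamond_partitions d \<and> psize mu + psize la = N} = Par M \<inter> diamond_partitions d"
      using True dp by (auto simp: M_def Par_def)
    have "scalar U (?S M * schur la) = (\<Sum>ta\<in>Par N. coefficient schur ta U * coefficient schur ta (?S M * schur la))"
      by (rule scalar_superset [OF finite_Par]) (use coefficient_graded [OF U] in \<open>auto simp: Par_def\<close>)
    also have "\<dots> = (\<Sum>ta\<in>Par N. coefficient schur ta U * (\<Sum>mu\<in>Par M \<inter> diamond_partitions d. LR ta la mu))"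
      by (simp only: schur_sum_def sum_distrib_right coefficient_sum LR_def) (simp only: mult.commute)
    finally show ?thesis unfolding M set by (simp add: M_def Par_def)
  next
    case False
    then have "{m. m + psize la = N} = {}" "{mu. mu \<in> diamond_partitions d \<and> psize mu + psize la = N} = {}" by auto
    then show ?thesis by simp
  qed
  finally show ?thesis by (simp add: K0)
qed

end
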